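(* Let $\Omega\subset\mathbb{R}^n$ be a bounded Lipschitz domain and let $M:\Omega\times\mathbb{R}^n\to[0,\infty)$ be a weak $N$-function that is continuous with respect to both variables. Then the following assertions hold. (i) If $\gamma=0$ and $M$ satisfies condition $\mathsf{(B^{iso}_\gamma)}$ or $\mathsf{(B^{ort}_\gamma)}$ (with $\gamma=0$), then for any $\varphi\in V_0^1L_M(\Omega)$ there exists a sequence $\{\varphi_\delta\}_{\delta>0}\subset C_c^\infty(\Omega)$ such that, as $\delta\to0$, $\varphi_\delta\to\varphi$ strongly in $L^1(\Omega)$ and in measure, and $\nabla\varphi_\delta\to\nabla\varphi$ modularly in $L_M(\Omega;\mathbb{R}^n)$. (ii) If $\gamma\in(0,1]$ and $M$ satisfies condition $\mathsf{(B^{iso}_\gamma)}$ or $\mathsf{(B^{ort}_\gamma)}$, then for any $\varphi\in V_0^1L_M(\Omega)\cap C^{0,\gamma}(\Omega)$ there exists a sequence $\{\varphi_\delta\}_{\delta>0}\subset C_c^\infty(\Omega)$ such that, as $\delta\to0$, $\varphi_\delta\to\varphi$ strongly in $L^1(\Omega)$ and in measure, and $\nabla\varphi_\delta\to\nabla\varphi$ modularly in $L_M(\Omega;\mathbb{R}^n)$. Moreover, in both cases, if $\varphi\in L^\infty(\Omega)$, then there exists $c=c(\Omega)>0$ such that $\|\varphi_\delta\|_{L^\infty(\Omega)}\le c\|\varphi\|_{L^\infty(\Omega)}$.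
   Context: Weak $N$-functions. For $\ell\ge1$, a function $N:\Omega\times\mathbb{R}^\ell\to[0,\infty)$ is a weak $N$-function if: (1) it is Carathéodory (measurable in $x$, continuous in $\xi$); (2) $N(x,0)=0$ and $\xi\mapsto N(x,\xi)$ is convex for a.a. $x\in\Omega$; (3) $N(x,\xi)=N(x,-\xi)$ for a.a. $x\in\Omega$ and all $\xi$; (4) there exist convex functions $m_1,m_2:[0,\infty)\to[0,\infty)$ with $m_1(0)=0$, $m_1(s)>0$ for $s>0$, such that $m_1(|\xi|)\le N(x,\xi)\le m_2(|\xi|)$ for a.a. $x\in\Omega$ and all $\xi$. A function $m:\Omega\times[0,\infty)\to[0,\infty)$ is called a weak $N$-function if $(x,t)\mapsto m(x,|t|)$ is a weak $N$-function on $\Omega\times\mathbb{R}$. For a ball $B$ and a weak $N$-function $N$: $N_B^-(\xi)=\operatorname{ess\,inf}_{y\in B\cap\Omega}N(y,\xi)$ and $N_B^+(\xi)=\operatorname{ess\,sup}_{y\in B\cap\Omega}N(y,\xi)$. Condition $\mathsf{(B^{iso}_\gamma)}$: $M(x,\xi)=m(x,|\xi|)$ with a weak $N$-function $m:\Omega\times[0,\infty)\to[0,\infty)$, and there exist constants $c^\Diamond,C^\Diamond\ge1$ such that for every ball $B$ with radius $r\le1$ and all $\xi\in\mathbb{R}^n$ with $|\xi|\le c^\Diamond r^{\gamma-1}$ there holds $m_B^+(|\xi|)\le m_B^-(C^\Diamond|\xi|)+1$. Condition $\mathsf{(B^{ort}_\gamma)}$: $M(x,\xi)=\sum_{i=1}^nM_i(x,|\xi_i|)$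 for $\xi=(\xi_1,\dots,\xi_n)$, with weak $N$-functions $M_i:\Omega\times[0,\infty)\to[0,\infty)$, and there exist constants $c^\Diamond,C^\Diamond\ge1$ such that for every ball $B$ with radius $r\le1$, all $i$, and all $\xi_i\in\mathbb{R}$ with $|\xi_i|\le c^\Diamond r^{\gamma-1}$ there holds $(M_i)_B^+(|\xi_i|)\le(M_i)_B^-(C^\Diamond|\xi_i|)+1$. Function spaces. $L_M(\Omega;\mathbb{R}^n)$ is the smallest linear space containing all measurable $\xi:\Omega\to\mathbb{R}^n$ with $\int_\Omega M(x,\xi(x))\,dx<\infty$. $V^1_0L_M(\Omega)=\{f\in W^{1,1}_0(\Omega):\nabla f\in L_M(\Omega;\mathbb{R}^n)\}$. For $\gamma\in(0,1]$, $h\in C^{0,\gamma}(\Omega)$ means $\sup_{x\ne y\in\Omega}|h(x)-h(y)|/|x-y|^\gamma<\infty$. A family $\xi_\delta$ converges modularly to $\xi$ in $L_M(\Omega;\mathbb{R}^n)$ if there exists $\lambda>0$ such that $\int_\Omega M\left(x,\frac{\xi_\delta-\xi}{\lambda}\right)dx\to0$. *)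

theory Defs
  imports "HOL-Analysis.Analysis" "HOL-Probability.Essential_Supremum"
begin

section \<open>Domains, gradients and test functions\<close>

text \<open>A function is an honest function on the whole space of which only the values on \<open>\<Omega>\<close>
  matter; it serves as a representative of its class modulo equality almost everywhere. All
  measure-theoretic notions refer to the (complete) Lebesgue measure.\<close>

text \<open>Near each boundary point, \<open>\<Omega>\<close> is the strict epigraph of a Lipschitz function in a rotated
  coordinate system. The rotated system is given by its last axis \<open>e\<close>: the last coordinate of \<open>x\<close>
  is \<open>x \<bullet> e\<close>, and the remaining ones are represented by the orthogonal projection
  \<open>x - (x \<bullet> e) *\<^sub>R e\<close> of \<open>x\<close> to the hyperplane orthogonal to \<open>e\<close>.\<close>

definition bounded_Lipschitz_domain :: "'a::euclidean_space set \<Rightarrow> bool" where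
  "bounded_Lipschitz_domain \<Omega> \<longleftrightarrow>
     open \<Omega> \<and> connected \<Omega> \<and> \<Omega> \<noteq> {} \<and> bounded \<Omega> \<and>
     (\<forall>z \<in> frontier \<Omega>. \<exists>r>0. \<exists>e L. \<exists>g :: 'a \<Rightarrow> real.
        norm e = 1 \<and> L-lipschitz_on {y. y \<bullet> e = 0} g \<and>
        \<Omega> \<inter> ball z r = {x \<in> ball z r. g (x - (x \<bullet> e) *\<^sub>R e) < x \<bullet> e})"

definition grad :: "(real^'n \<Rightarrow> real) \<Rightarrow> real^'n \<Rightarrow> real^'n" where
  "grad f x = (\<chi> i. frechet_derivative f (at x) (axis i 1))"

primrec C_k :: "nat \<Rightarrow> (real^'n \<Rightarrow> real) \<Rightarrow> bool" where
  "C_k 0 f \<longleftrightarrow> continuous_on UNIV f"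
| "C_k (Suc k) f \<longleftrightarrow> f differentiable_on UNIV \<and> (\<forall>i. C_k k (\<lambda>x. grad f x $ i))"

definition Cc_infinity :: "(real^'n) set \<Rightarrow> (real^'n \<Rightarrow> real) set" where
  "Cc_infinity \<Omega> =
     {u. (\<forall>k. C_k k u) \<and> compact (closure {x. u x \<noteq> 0}) \<and> closure {x. u x \<noteq> 0} \<subseteq> \<Omega>}"


section \<open>Sobolev spaces\<close>

definition has_weak_gradient ::
    "(real^'n) set \<Rightarrow> (real^'n \<Rightarrow> real) \<Rightarrow> (real^'n \<Rightarrow> real^'n) \<Rightarrow> bool" where
  "has_weak_gradient \<Omega> f g \<longleftrightarrow>
     (\<forall>K. compact K \<and> K \<subseteq> \<Omega> \<longrightarrow> f absolutely_integrable_on K \<and> g absolutely_integrable_on K) \<and>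
     (\<forall>u \<in> Cc_infinity \<Omega>. \<forall>i.
        (LINT x:\<Omega>|lebesgue. f x * grad u x $ i) = - (LINT x:\<Omega>|lebesgue. g x $ i * u x))"

text \<open>The weak gradient is unique up to equality almost everywhere in \<open>\<Omega>\<close>. Everything below is
  invariant under such changes, so the choice of the representative is immaterial.\<close>

definition weak_grad :: "(real^'n) set \<Rightarrow> (real^'n \<Rightarrow> real) \<Rightarrow> real^'n \<Rightarrow> real^'n" where
  "weak_grad \<Omega> f = (SOME g. has_weak_gradient \<Omega> f g)"

definition W11 :: "(real^'n) set \<Rightarrow> (real^'n \<Rightarrow> real) set" where
  "W11 \<Omega> = {f. f absolutely_integrable_on \<Omega> \<and> (\<exists>g. has_weak_gradient \<Omega> f g) \<and>
               weak_grad \<Omega> f absolutely_integrable_on \<Omega>}"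

definition W11_norm :: "(real^'n) set \<Rightarrow> (real^'n \<Rightarrow> real) \<Rightarrow> real" where
  "W11_norm \<Omega> f = (LINT x:\<Omega>|lebesgue. \<bar>f x\<bar>) + (LINT x:\<Omega>|lebesgue. norm (weak_grad \<Omega> f x))"

text \<open>The closure of the test functions in \<open>W11 \<Omega>\<close>.\<close>

definition W11_0 :: "(real^'n) set \<Rightarrow> (real^'n \<Rightarrow> real) set" where
  "W11_0 \<Omega> = {f \<in> W11 \<Omega>. \<exists>u :: nat \<Rightarrow> real^'n \<Rightarrow> real.
     (\<forall>k. u k \<in> Cc_infinity \<Omega>) \<and> (\<lambda>k. W11_norm \<Omega> (\<lambda>x. u k x - f x)) \<longlonglongrightarrow> 0}"


section \<open>Weak N-functions and Musielak-Orlicz spaces\<close>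

definition weak_N_function ::
    "'a::euclidean_space set \<Rightarrow> ('a \<Rightarrow> 'b::euclidean_space \<Rightarrow> real) \<Rightarrow> bool" where
  "weak_N_function \<Omega> N \<longleftrightarrow>
     (\<forall>x\<in>\<Omega>. \<forall>\<xi>. 0 \<le> N x \<xi>) \<and>
     (\<forall>\<xi>. (\<lambda>x. N x \<xi>) \<in> borel_measurable (lebesgue_on \<Omega>)) \<and>
     (AE x in lebesgue_on \<Omega>. continuous_on UNIV (N x)) \<and>
     (AE x in lebesgue_on \<Omega>. N x 0 = 0 \<and> convex_on UNIV (N x)) \<and>
     (AE x in lebesgue_on \<Omega>. \<forall>\<xi>. N x \<xi> = N x (- \<xi>)) \<and>
     (\<exists>m1 m2 :: real \<Rightarrow> real.
        convex_on {0..} m1 \<and> convex_on {0..} m2 \<and>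
        (\<forall>s\<ge>0. 0 \<le> m1 s \<and> 0 \<le> m2 s) \<and> m1 0 = 0 \<and> (\<forall>s>0. 0 < m1 s) \<and>
        (AE x in lebesgue_on \<Omega>. \<forall>\<xi>. m1 (norm \<xi>) \<le> N x \<xi> \<and> N x \<xi> \<le> m2 (norm \<xi>)))"

definition weak_N_function_half ::
    "'a::euclidean_space set \<Rightarrow> ('a \<Rightarrow> real \<Rightarrow> real) \<Rightarrow> bool" where
  "weak_N_function_half \<Omega> m \<longleftrightarrow> weak_N_function \<Omega> (\<lambda>x t. m x \<bar>t\<bar>)"

text \<open>Extended real values give the usual conventions for balls not meeting \<open>\<Omega>\<close>: then the
  essential supremum is \<open>-\<infinity>\<close> and the essential infimum is \<open>\<infinity>\<close>.\<close>

definition N_plus ::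
    "'a::euclidean_space set \<Rightarrow> 'a set \<Rightarrow> ('a \<Rightarrow> 'b \<Rightarrow> real) \<Rightarrow> 'b \<Rightarrow> ereal" where
  "N_plus \<Omega> B N \<xi> = esssup (lebesgue_on (B \<inter> \<Omega>)) (\<lambda>y. ereal (N y \<xi>))"

definition N_minus ::
    "'a::euclidean_space set \<Rightarrow> 'a set \<Rightarrow> ('a \<Rightarrow> 'b \<Rightarrow> real) \<Rightarrow> 'b \<Rightarrow> ereal" where
  "N_minus \<Omega> B N \<xi> = - esssup (lebesgue_on (B \<inter> \<Omega>)) (\<lambda>y. - ereal (N y \<xi>))"

definition B_iso :: "real \<Rightarrow> (real^'n) set \<Rightarrow> (real^'n \<Rightarrow> real^'n \<Rightarrow> real) \<Rightarrow> bool" where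
  "B_iso \<gamma> \<Omega> M \<longleftrightarrow>
     (\<exists>m. weak_N_function_half \<Omega> m \<and> (\<forall>x\<in>\<Omega>. \<forall>\<xi>. M x \<xi> = m x (norm \<xi>)) \<and>
        (\<exists>c\<ge>1. \<exists>C\<ge>1. \<forall>z r. 0 < r \<and> r \<le> 1 \<longrightarrow>
           (\<forall>\<xi> :: real^'n. norm \<xi> \<le> c * r powr (\<gamma> - 1) \<longrightarrow>
              N_plus \<Omega> (ball z r) m (norm \<xi>) \<le> N_minus \<Omega> (ball z r) m (C * norm \<xi>) + 1)))"

definition B_ort :: "real \<Rightarrow> (real^'n) set \<Rightarrow> (real^'n \<Rightarrow> real^'n \<Rightarrow> real) \<Rightarrow> bool" where
  "B_ort \<gamma> \<Omega> M \<longleftrightarrow>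
     (\<exists>m :: 'n \<Rightarrow> real^'n \<Rightarrow> real \<Rightarrow> real.
        (\<forall>i. weak_N_function_half \<Omega> (m i)) \<and>
        (\<forall>x\<in>\<Omega>. \<forall>\<xi>. M x \<xi> = (\<Sum>i\<in>UNIV. m i x \<bar>\<xi> $ i\<bar>)) \<and>
        (\<exists>c\<ge>1. \<exists>C\<ge>1. \<forall>z r. 0 < r \<and> r \<le> 1 \<longrightarrow>
           (\<forall>i. \<forall>t :: real. \<bar>t\<bar> \<le> c * r powr (\<gamma> - 1) \<longrightarrow>
              N_plus \<Omega> (ball z r) (m i) \<bar>t\<bar> \<le> N_minus \<Omega> (ball z r) (m i) (C * \<bar>t\<bar>) + 1)))"

definition linear_function_space :: "('a \<Rightarrow> 'b::real_vector) set \<Rightarrow> bool" where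
  "linear_function_space V \<longleftrightarrow>
     (\<lambda>x. 0) \<in> V \<and> (\<forall>f\<in>V. \<forall>g\<in>V. (\<lambda>x. f x + g x) \<in> V) \<and> (\<forall>a. \<forall>f\<in>V. (\<lambda>x. a *\<^sub>R f x) \<in> V)"

definition modular ::
    "'a::euclidean_space set \<Rightarrow> ('a \<Rightarrow> 'b \<Rightarrow> real) \<Rightarrow> ('a \<Rightarrow> 'b) \<Rightarrow> ennreal" where
  "modular \<Omega> M \<xi> = (\<integral>\<^sup>+x. ennreal (M x (\<xi> x)) \<partial>lebesgue_on \<Omega>)"

definition L_M :: "'a::euclidean_space set \<Rightarrow> ('a \<Rightarrow> 'b::euclidean_space \<Rightarrow> real) \<Rightarrow> ('a \<Rightarrow> 'b) set" where
  "L_M \<Omega> M =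
     linear_function_space hull {\<xi> \<in> borel_measurable (lebesgue_on \<Omega>). modular \<Omega> M \<xi> < \<infinity>}"

definition V10_LM :: "(real^'n) set \<Rightarrow> (real^'n \<Rightarrow> real^'n \<Rightarrow> real) \<Rightarrow> (real^'n \<Rightarrow> real) set" where
  "V10_LM \<Omega> M = {f \<in> W11_0 \<Omega>. weak_grad \<Omega> f \<in> L_M \<Omega> M}"

definition C_0_gamma :: "real \<Rightarrow> 'a::metric_space set \<Rightarrow> ('a \<Rightarrow> real) set" where
  "C_0_gamma \<gamma> \<Omega> =
     {h. bdd_above {\<bar>h x - h y\<bar> / dist x y powr \<gamma> | x y. x \<in> \<Omega> \<and> y \<in> \<Omega> \<and> x \<noteq> y}}"

definition Linf_norm :: "'a::euclidean_space set \<Rightarrow> ('a \<Rightarrow> real) \<Rightarrow> ereal" where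
  "Linf_norm \<Omega> f = esssup (lebesgue_on \<Omega>) (\<lambda>x. ereal \<bar>f x\<bar>)"

definition Linf :: "'a::euclidean_space set \<Rightarrow> ('a \<Rightarrow> real) set" where
  "Linf \<Omega> = {f \<in> borel_measurable (lebesgue_on \<Omega>). Linf_norm \<Omega> f < \<infinity>}"


section \<open>Convergence of families indexed by \<open>\<delta> > 0\<close>, as \<open>\<delta> \<rightarrow> 0\<close>\<close>

definition converges_L1 :: "'a::euclidean_space set \<Rightarrow> (real \<Rightarrow> 'a \<Rightarrow> real) \<Rightarrow> ('a \<Rightarrow> real) \<Rightarrow> bool" where
  "converges_L1 \<Omega> F f \<longleftrightarrow>
     ((\<lambda>\<delta>. \<integral>\<^sup>+x. ennreal \<bar>F \<delta> x - f x\<bar> \<partial>lebesgue_on \<Omega>) \<longlongrightarrow> 0) (at_right 0)"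

definition converges_in_measure ::
    "'a::euclidean_space set \<Rightarrow> (real \<Rightarrow> 'a \<Rightarrow> real) \<Rightarrow> ('a \<Rightarrow> real) \<Rightarrow> bool" where
  "converges_in_measure \<Omega> F f \<longleftrightarrow>
     (\<forall>\<epsilon>>0. ((\<lambda>\<delta>. emeasure lebesgue {x\<in>\<Omega>. \<epsilon> \<le> \<bar>F \<delta> x - f x\<bar>}) \<longlongrightarrow> 0) (at_right 0))"

definition converges_modularly ::
    "'a::euclidean_space set \<Rightarrow> ('a \<Rightarrow> 'b::euclidean_space \<Rightarrow> real) \<Rightarrow>
     (real \<Rightarrow> 'a \<Rightarrow> 'b) \<Rightarrow> ('a \<Rightarrow> 'b) \<Rightarrow> bool" where
  "converges_modularly \<Omega> M F f \<longleftrightarrow>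
     (\<exists>k>0. ((\<lambda>\<delta>. modular \<Omega> M (\<lambda>x. (F \<delta> x - f x) /\<^sub>R k)) \<longlongrightarrow> 0) (at_right 0))"

definition smooth_approximation ::
    "(real^'n) set \<Rightarrow> (real^'n \<Rightarrow> real^'n \<Rightarrow> real) \<Rightarrow>
     (real \<Rightarrow> real^'n \<Rightarrow> real) \<Rightarrow> (real^'n \<Rightarrow> real) \<Rightarrow> bool" where
  "smooth_approximation \<Omega> M F f \<longleftrightarrow>
     (\<forall>\<delta>>0. F \<delta> \<in> Cc_infinity \<Omega>) \<and>
     converges_L1 \<Omega> F f \<and>
     converges_in_measure \<Omega> F f \<and>
     converges_modularly \<Omega> M (\<lambda>\<delta>. grad (F \<delta>)) (weak_grad \<Omega> f)"

end

theory Submission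
  imports Defs
begin

text \<open>The approximants are mollifications. The domain is split by a partition of unity, and each
  piece \<open>\<theta> \<phi>\<close> is convolved with kernels supported in an inward cone, which moves its support into
  \<open>\<Omega>\<close> (\<open>bounded_Lipschitz_domain_cutoff_system\<close>). Convergence in \<open>L\<^sup>1\<close>, of the functions and of the
  gradients, is then clear; the task is to dominate the energies \<open>M x (grad u x / \<Lambda>)\<close> by functions
  that converge in \<open>L\<^sup>1\<close>.

  Under either condition \<open>M\<close> is a sum of functions of one variable along coordinate axes
  (\<open>balanced_N_function\<close>), and at two points of a ball of radius \<open>r\<close> these are comparable up to an
  additive constant, for arguments up to \<open>r powr (\<gamma> - 1)\<close>. So if the gradient of the mollification at
  scale \<open>r\<close> is not larger than this, its energy at a point is bounded by one plus the average of the
  energy of the gradient of \<open>\<phi>\<close> over the ball. For \<open>\<phi>\<close> Hoelder continuous with exponent \<open>\<gamma>\<close> the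
  gradients have this size after division by a constant, provided that the extension of \<open>\<phi>\<close> by zero is
  still Hoelder continuous. This is so because a function in the closure of the test functions cannot
  jump to zero at the boundary (\<open>sobolev0_small_near_boundary\<close>).

  For \<open>\<gamma> = 0\<close> the same argument applies to bounded \<open>\<phi>\<close>, with a scaling factor \<open>\<Lambda>\<close> proportional to
  the bound. An unbounded \<open>\<phi>\<close> is truncated first, but then \<open>\<Lambda>\<close> would grow with the level \<open>N\<close> of
  truncation, whereas modular convergence requires a single \<open>\<Lambda>\<close>. The remedy is to average the
  mollifications at \<open>L\<close> scales \<open>s, 2 s, 4 s, \<dots>\<close>. The gradient is then only of size \<open>N / (L s)\<close>. If it has
  the size \<open>t\<close> at some point, then the scales far above \<open>N / (L t)\<close> contribute little to it, and the
  others see only a ball on which arguments of size \<open>t\<close> are admissible as soon as \<open>L\<close> exceeds a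
  multiple of \<open>N\<close>. This is \<open>multiscale_estimate\<close>; it gives a bound that does not depend on \<open>N\<close>, with
  \<open>L\<close> chosen after \<open>N\<close> in \<open>unbounded_approximation\<close>.

  The approximants satisfy \<open>\<bar>u\<bar> \<le> J sup \<bar>\<phi>\<bar>\<close>, where \<open>J\<close> is the number of members of the partition of
  unity, since neither truncation nor convolution with a mollifier increases the supremum.\<close>

section \<open>Calculus of \<open>C\<^sup>k\<close> functions and a smooth bump\<close>

lemma grad_nth_eq:
  assumes "(f has_derivative f') (at x)"
  shows "grad f x $ i = f' (axis i 1)"
  using frechet_derivative_at[OF assms] by (simp add: grad_def)

lemma has_derivative_grad:
  fixes f :: "real^'n \<Rightarrow> real"
  assumes "f differentiable (at x)"
  shows "(f has_derivative (\<lambda>h. grad f x \<bullet> h)) (at x)"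
proof -
  obtain f' where f': "(f has_derivative f') (at x)"
    using assms unfolding differentiable_def by blast
  then interpret linear f' by (rule has_derivative_linear)
  have "f' h = grad f x \<bullet> h" for h
  proof -
    have "f' h = f' (\<Sum>i\<in>UNIV. h $ i *\<^sub>R axis i 1)"
      by (simp add: basis_expansion scalar_mult_eq_scaleR[symmetric])
    also have "\<dots> = (\<Sum>i\<in>UNIV. h $ i * grad f x $ i)"
      by (simp add: sum scaleR grad_nth_eq[OF f'])
    finally show ?thesis by (simp add: inner_vec_def mult.commute)
  qed
  then have "f' = (\<lambda>h. grad f x \<bullet> h)" by auto
  with f' show ?thesis by simp
qed

lemma grad_eqI:
  fixes f :: "real^'n \<Rightarrow> real"
  assumes "(f has_derivative (\<lambda>h. v \<bullet> h)) (at x)"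
  shows "grad f x = v"
  by (simp add: vec_eq_iff grad_nth_eq[OF assms] inner_axis)

text \<open>Continuity is required of the derivatives of top order only. The lower orders and the closure
  properties below follow by induction on the order, for all functions at once.\<close>

lemma C_k_Suc_imp: "C_k (Suc k) f \<Longrightarrow> C_k k f"
proof (induction k arbitrary: f)
  case 0 then show ?case by (auto intro: differentiable_imp_continuous_on)
next
  case (Suc k) then show ?case by (auto simp del: C_k.simps(1))
qed

lemma C_k_const [simp]: "C_k k (\<lambda>x::real^'n. c)"
proof (induction k arbitrary: c)
  case (Suc k)
  have "grad (\<lambda>x::real^'n. c) = (\<lambda>x. 0)" by (intro ext grad_eqI) simp
  then show ?case using Suc by simp
qed simp

lemma C_k_differentiable: "C_k (Suc k) f \<Longrightarrow> f differentiable (at x)"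
  by (simp add: differentiable_on_def)

lemma C_k_add: "C_k k f \<Longrightarrow> C_k k g \<Longrightarrow> C_k k (\<lambda>x. f x + g x)"
proof (induction k arbitrary: f g)
  case (Suc k)
  have "grad (\<lambda>x. f x + g x) x = grad f x + grad g x" for x
    using Suc.prems[THEN C_k_differentiable, of x]
    by (intro grad_eqI) (auto intro!: derivative_eq_intros has_derivative_grad simp: inner_add_left)
  with Suc show ?case by (auto intro!: derivative_intros)
qed (auto intro: continuous_on_add)

lemma grad_mult:
  fixes f :: "real^'n \<Rightarrow> real"
  assumes "f differentiable (at x)" "g differentiable (at x)"
  shows "grad (\<lambda>x. f x * g x) x = f x *\<^sub>R grad g x + g x *\<^sub>R grad f x"
  using assms
  by (intro grad_eqI) (auto intro!: derivative_eq_intros has_derivative_grad simp: inner_add_left algebra_simps)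

lemma C_k_mult: "C_k k f \<Longrightarrow> C_k k g \<Longrightarrow> C_k k (\<lambda>x. f x * g x)"
proof (induction k arbitrary: f g)
  case (Suc k)
  have "grad (\<lambda>x. f x * g x) x = f x *\<^sub>R grad g x + g x *\<^sub>R grad f x" for x
    using Suc.prems[THEN C_k_differentiable, of x] by (rule grad_mult)
  moreover have "C_k k f" "C_k k g" using Suc.prems C_k_Suc_imp by auto
  ultimately show ?case using Suc by (auto intro!: derivative_intros C_k_add)
qed (auto intro: continuous_on_mult)

lemma C_k_sum: "(\<And>j. j \<in> S \<Longrightarrow> C_k k (f j)) \<Longrightarrow> C_k k (\<lambda>x. \<Sum>j\<in>S. f j x)"
  by (induction S rule: infinite_finite_induct) (auto intro: C_k_add)

lemma C_k_coordinate: "C_k k (\<lambda>x. x $ i)"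
proof (cases k)
  case (Suc k')
  have "grad (\<lambda>x. x $ i) = (\<lambda>x. axis i 1)"
    using bounded_linear_imp_has_derivative[OF bounded_linear_vec_nth[of i]]
    by (intro ext grad_eqI) (simp add: inner_axis')
  then show ?thesis using Suc
    by (auto simp: differentiable_on_def intro!: bounded_linear_imp_differentiable bounded_linear_vec_nth)
qed (auto intro!: continuous_intros)

lemma has_derivative_compose_real:
  fixes f :: "real^'n \<Rightarrow> real"
  assumes "(h has_real_derivative d) (at (f x))" "f differentiable (at x)"
  shows "((\<lambda>x. h (f x)) has_derivative (\<lambda>v. (d *\<^sub>R grad f x) \<bullet> v)) (at x)"
  using has_derivative_compose[OF has_derivative_grad[OF assms(2)], of h "\<lambda>v. d * v"] assms(1)
  by (simp add: has_field_derivative_def)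

lemmas grad_compose_real = has_derivative_compose_real[THEN grad_eqI]

text \<open>A smooth function of one variable is given as a sequence of functions, each the derivative
  of its predecessor, since the induction on the order has to pass to the next derivative.\<close>

lemma C_k_compose_real:
  assumes "\<And>j t. (F j has_real_derivative F (Suc j) t) (at t)" "\<And>k. C_k k q"
  shows "C_k k (\<lambda>x. F j (q x))"
proof (induction k arbitrary: j)
  case 0
  have "continuous_on UNIV (F j)"
    using assms(1) by (meson DERIV_isCont continuous_at_imp_continuous_on)
  with assms(2)[of 0] show ?case by (auto intro: continuous_on_compose2)
next
  case (Suc k)
  have d: "q differentiable (at x)" for x using assms(2)[of "Suc 0"] by (rule C_k_differentiable)
  have "grad (\<lambda>x. F j (q x)) x = F (Suc j) (q x) *\<^sub>R grad q x" for x
    by (rule grad_compose_real[OF assms(1) d])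
  moreover have "(\<lambda>x. F j (q x)) differentiable_on UNIV"
    using has_derivative_compose_real[OF assms(1) d]
    by (auto simp: differentiable_on_def differentiable_def)
  moreover have "C_k k (\<lambda>x. grad q x $ i)" for i using assms(2)[of "Suc k"] by simp
  ultimately show ?case using Suc by (auto intro!: C_k_mult)
qed

lemma tendsto_poly_times_exp_minus:
  fixes p :: "real poly"
  shows "((\<lambda>x. x ^ k * poly p x * exp (- x)) \<longlongrightarrow> 0) at_top"
proof (induction p arbitrary: k)
  case (pCons a p)
  have "((\<lambda>x. a * (x ^ k / exp x) + x ^ Suc k * poly p x * exp (- x)) \<longlongrightarrow> a * 0 + 0) at_top"
    by (intro tendsto_intros pCons.IH tendsto_power_div_exp_0)
  then show ?case by (simp add: algebra_simps exp_minus divide_inverse)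
qed simp

text \<open>The derivatives of \<open>t \<mapsto> exp (- 1/t)\<close>, extended by zero to the left half-line, are of
  the form \<open>p (1/t) * exp (- 1/t)\<close> with polynomials \<open>p\<close>; this is the recursion between them.\<close>

primrec flat_poly :: "nat \<Rightarrow> real poly" where
  "flat_poly 0 = 1"
| "flat_poly (Suc j) = [:0, 0, 1:] * (flat_poly j - pderiv (flat_poly j))"

definition flat :: "nat \<Rightarrow> real \<Rightarrow> real" where
  "flat j t = (if 0 < t then poly (flat_poly j) (1 / t) * exp (- (1 / t)) else 0)"

lemma flat_has_derivative: "(flat j has_real_derivative flat (Suc j) t) (at t)"
proof -
  consider "t > 0" | "t < 0" | "t = 0" by linarith
  then show ?thesis
  proof cases
    case 1
    have "((\<lambda>t. poly (flat_poly j) (1 / t) * exp (- (1 / t))) has_real_derivative flat (Suc j) t) (at t)"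
      using 1 by (auto intro!: derivative_eq_intros DERIV_chain2[OF poly_DERIV]
          simp: flat_def field_simps power2_eq_square)
    then show ?thesis
      by (rule has_field_derivative_transform_within_open[where S="{0<..}"]) (use 1 in \<open>auto simp: flat_def\<close>)
  next
    case 2
    have "((\<lambda>t. 0) has_real_derivative flat (Suc j) t) (at t)" using 2 by (simp add: flat_def)
    then show ?thesis
      by (rule has_field_derivative_transform_within_open[where S="{..<0}"]) (use 2 in \<open>auto simp: flat_def\<close>)
  next
    case 3
    have "((\<lambda>h. flat j h / h) \<longlongrightarrow> 0) (at_right 0)"
    proof -
      have "((\<lambda>h. (1 / h) ^ 1 * poly (flat_poly j) (1 / h) * exp (- (1 / h))) \<longlongrightarrow> 0) (at_right (0::real))"
        by (rule filterlim_compose[OF tendsto_poly_times_exp_minus])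
           (simp add: filterlim_inverse_at_top_right divide_inverse)
      then show ?thesis
        by (rule Lim_transform_eventually)
           (auto simp: flat_def eventually_at_filter)
    qed
    moreover have "((\<lambda>h. flat j h / h) \<longlongrightarrow> 0) (at_left 0)"
      by (rule Lim_transform_eventually[OF tendsto_const])
         (auto simp: flat_def eventually_at_filter)
    ultimately have "((\<lambda>h. flat j h / h) \<longlongrightarrow> 0) (at 0)"
      by (simp add: filterlim_at_split)
    then show ?thesis using 3 by (simp add: DERIV_def flat_def)
  qed
qed

lemma flat_pos: "0 < t \<Longrightarrow> 0 < flat 0 t" and flat_nonneg: "0 \<le> flat 0 t"
  and flat_eq_0: "t \<le> 0 \<Longrightarrow> flat 0 t = 0"
  by (auto simp: flat_def)

lemma grad_zero_off_support:
  fixes k :: "real^'n \<Rightarrow> real"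
  assumes "closed S" "\<And>z. z \<notin> S \<Longrightarrow> k z = 0" "z \<notin> S"
  shows "grad k z = 0"
proof (rule grad_eqI)
  have "((\<lambda>z. 0) has_derivative (\<lambda>h. 0)) (at z)" by simp
  then show "(k has_derivative (\<lambda>h. 0 \<bullet> h)) (at z)"
    unfolding inner_zero_left
    by (rule has_derivative_transform_within_open[where s="- S"]) (use assms in auto)
qed

lemma integrable_continuous_compact_support:
  fixes f :: "'a::euclidean_space \<Rightarrow> 'b::{banach, second_countable_topology}"
  assumes "continuous_on UNIV f" "compact S" "\<And>z. z \<notin> S \<Longrightarrow> f z = 0"
  shows "integrable lborel f"
proof -
  have "integrable lborel (\<lambda>x. indicator S x *\<^sub>R f x)"
    using assms by (intro borel_integrable_compact) (auto intro: continuous_on_subset)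
  also have "(\<lambda>x. indicator S x *\<^sub>R f x) = f"
    using assms(3) by (auto simp: indicator_def)
  finally show ?thesis .
qed

text \<open>Open nonempty sets are not null; through this fact properties that hold almost everywhere
  pass to all points if they are closed under limits.\<close>

lemma AE_lborel_open_ex:
  fixes U :: "'a::euclidean_space set"
  assumes "AE x in lborel. P x" "open U" "U \<noteq> {}"
  shows "\<exists>x\<in>U. P x"
proof (rule ccontr)
  assume *: "\<not> (\<exists>x\<in>U. P x)"
  obtain N where N: "{x. \<not> P x} \<subseteq> N" "N \<in> null_sets lborel"
    using AE_E[OF assms(1)] by (auto simp: null_sets_def)
  then have "U \<subseteq> N" using * by auto
  then have "negligible U"
    using N(2) by (meson negligible_iff_null_sets null_sets_completionI negligible_subset)
  then show False using open_not_negligible assms(2,3) by blast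
qed

lemma continuous_C_k: "C_k k f \<Longrightarrow> continuous_on UNIV f"
  by (induction k) (auto dest: differentiable_imp_continuous_on)

lemma continuous_grad: "C_k (Suc k) f \<Longrightarrow> continuous_on UNIV (grad f)"
  by (subst continuous_on_componentwise) (auto simp: Basis_vec_def inner_axis dest: continuous_C_k)

lemma integral_lborel_scale:
  fixes F :: "'a::euclidean_space \<Rightarrow> 'b::{banach, second_countable_topology}"
  assumes "F \<in> borel_measurable borel" "s > 0"
  shows "(LINT z|lborel. F (z /\<^sub>R s)) = s ^ DIM('a) *\<^sub>R (LINT z|lborel. F z)"
proof -
  have "(LINT z|lborel. F (z /\<^sub>R s)) =
      (LINT z|density (distr lborel borel (\<lambda>x. 0 + s *\<^sub>R x)) (\<lambda>_. \<bar>s\<bar> ^ DIM('a)). F (z /\<^sub>R s))"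
    using lborel_affine[of s "0::'a"] assms by simp
  also have "\<dots> = s ^ DIM('a) *\<^sub>R (LINT z|lborel. F z)"
    using assms by (simp add: integral_density integral_distr)
  finally show ?thesis .
qed

text \<open>Dilating a bump supported in a small ball about a vector \<open>e\<close> gives kernels which average
  over \<open>x - s *\<^sub>R w\<close> with \<open>w\<close> close to \<open>e\<close>. For a direction \<open>e\<close> pointing into the domain,
  convolution with such a kernel moves supports into the domain.\<close>

lemma directed_kernels:
  fixes e :: "real^'n"
  assumes "\<kappa> > 0"
  obtains k :: "real \<Rightarrow> real^'n \<Rightarrow> real" and A where "A > 0"
    "\<And>s j. C_k j (k s)" "\<And>s z. s > 0 \<Longrightarrow> 0 \<le> k s z"
    "\<And>s z. s > 0 \<Longrightarrow> z \<notin> (\<lambda>w. s *\<^sub>R w) ` cball e \<kappa> \<Longrightarrow> k s z = 0"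
    "\<And>s. s > 0 \<Longrightarrow> (LINT z|lborel. k s z) = 1"
    "\<And>s. s > 0 \<Longrightarrow> (LINT z|lborel. norm (grad (k s) z)) \<le> A / s"
proof -
  define q where "q a x = \<kappa>\<^sup>2 - (\<Sum>i\<in>UNIV. (a * x $ i + - e $ i) * (a * x $ i + - e $ i))" for a and x :: "real^'n"
  define b where "b x = flat 0 (q 1 x)" for x
  have q: "q a x = \<kappa>\<^sup>2 - (norm (a *\<^sub>R x - e))\<^sup>2" for a x
    unfolding q_def power2_norm_eq_inner by (simp add: inner_vec_def)
  have Cq: "C_k j (q a)" for j a
  proof -
    have "C_k j (\<lambda>x. \<kappa>\<^sup>2 + (-1) * (\<Sum>i\<in>UNIV. (a * x $ i + - e $ i) * (a * x $ i + - e $ i)))"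
      by (intro C_k_add C_k_mult C_k_sum C_k_const C_k_coordinate)
    then show ?thesis unfolding q_def by simp
  qed
  have Cflat: "C_k j (\<lambda>x. flat 0 (q a x))" for j a
    by (rule C_k_compose_real[where F=flat and j=0 and q="q a"]) (rule flat_has_derivative Cq)+
  have b0: "b z = 0" if "z \<notin> cball e \<kappa>" for z
  proof -
    have "\<kappa> \<le> norm (z - e)" using that by (simp add: dist_norm norm_minus_commute)
    then have "\<kappa>\<^sup>2 \<le> (norm (z - e))\<^sup>2" using assms by (intro power_mono) auto
    then show ?thesis by (simp add: b_def q flat_eq_0)
  qed
  have Cb: "C_k j b" for j using Cflat[of j 1] by (simp add: b_def[abs_def])
  have bi: "integrable lborel b"
    by (rule integrable_continuous_compact_support[OF continuous_C_k[OF Cb] compact_cball b0])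
  have bnn: "0 \<le> b z" for z by (simp add: b_def flat_nonneg)
  define c where "c = (LINT z|lborel. b z)"
  have "c \<noteq> 0"
  proof
    assume "c = 0"
    then have "AE z in lborel. b z = 0"
      using integral_nonneg_eq_0_iff_AE[OF bi] bnn by (auto simp: c_def)
    then obtain z where "z \<in> ball e \<kappa>" "b z = 0"
      using AE_lborel_open_ex[of "\<lambda>z. b z = 0" "ball e \<kappa>"] assms by auto
    moreover from \<open>z \<in> ball e \<kappa>\<close> have "(norm (z - e))\<^sup>2 < \<kappa>\<^sup>2"
      by (intro power_strict_mono) (auto simp: dist_norm norm_minus_commute)
    ultimately show False using flat_pos[of "q 1 z"] by (simp add: b_def q)
  qed
  then have c: "c > 0" using bnn by (simp add: c_def less_le)
  define d where "d = DIM(real^'n)"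
  define k where "k s x = (1 / (c * s ^ d)) * flat 0 (q (1 / s) x)" for s x
  have kb: "k s x = (1 / (c * s ^ d)) * b (x /\<^sub>R s)" for s x
    by (simp add: k_def b_def q inverse_eq_divide)
  define A where "A = (LINT z|lborel. norm (grad b z)) / c + 1"
  have gb: "integrable lborel (grad b)"
    by (rule integrable_continuous_compact_support[OF continuous_grad[OF Cb[of 1, unfolded One_nat_def]] compact_cball[of e \<kappa>]])
       (rule grad_zero_off_support[OF closed_cball b0])
  show ?thesis
  proof
    show "A > 0" using c by (simp add: A_def add_nonneg_pos)
    show "C_k j (k s)" for s j
      unfolding k_def by (intro C_k_mult C_k_const Cflat)
    fix s :: real assume s: "s > 0"
    show "0 \<le> k s z" for z using c s bnn by (simp add: kb)
    show "k s z = 0" if "z \<notin> (\<lambda>w. s *\<^sub>R w) ` cball e \<kappa>" for z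
    proof -
      have "z /\<^sub>R s \<notin> cball e \<kappa>" 
        using that s by (metis image_eqI less_numeral_extra(3) divideR_right)
      then show ?thesis by (simp add: kb b0)
    qed
    have "(LINT z|lborel. k s z) = (1 / (c * s ^ d)) * (LINT z|lborel. b (z /\<^sub>R s))"
      by (simp add: kb[abs_def])
    also have "\<dots> = 1"
      using integral_lborel_scale[OF borel_measurable_integrable[OF bi, simplified] s] c s
      by (simp add: c_def d_def)
    finally show "(LINT z|lborel. k s z) = 1" .
    have gk: "grad (k s) z = (1 / (c * s ^ d)) *\<^sub>R grad b (z /\<^sub>R s) /\<^sub>R s" for z
    proof (rule grad_eqI)
      have "((\<lambda>x. x /\<^sub>R s) has_derivative (\<lambda>h. h /\<^sub>R s)) (at z)"
        by (auto intro!: derivative_eq_intros)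
      from has_derivative_compose[OF this has_derivative_grad[OF C_k_differentiable[OF Cb]]]
      have "((\<lambda>x. b (x /\<^sub>R s)) has_derivative (\<lambda>h. grad b (z /\<^sub>R s) \<bullet> (h /\<^sub>R s))) (at z)" .
      from has_derivative_mult_right[OF this, of "1 / (c * s ^ d)"]
      show "(k s has_derivative (\<lambda>h. ((1 / (c * s ^ d)) *\<^sub>R grad b (z /\<^sub>R s) /\<^sub>R s) \<bullet> h)) (at z)"
        by (simp add: kb[abs_def] mult.assoc mult.left_commute)
    qed
    have "(LINT z|lborel. norm (grad (k s) z))
        = (1 / (c * s ^ d)) / s * (LINT z|lborel. norm (grad b (z /\<^sub>R s)))"
      using c s by (simp add: gk norm_mult divide_inverse)
    also have "\<dots> = ((LINT z|lborel. norm (grad b z)) / c) / s"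
      using integral_lborel_scale[of "\<lambda>z. norm (grad b z)" s] borel_measurable_integrable[OF gb] c s
      by (simp add: d_def)
    also have "\<dots> \<le> A / s" using s by (simp add: A_def add_divide_distrib)
    finally show "(LINT z|lborel. norm (grad (k s) z)) \<le> A / s" .
  qed
qed

section \<open>Convolution with compactly supported kernels\<close>

definition conv :: "('a::euclidean_space \<Rightarrow> real) \<Rightarrow> ('a \<Rightarrow> 'b::{banach, second_countable_topology}) \<Rightarrow> 'a \<Rightarrow> 'b" where
  "conv k f x = (LINT y|lborel. k (x - y) *\<^sub>R f y)"

lemma lborel_distr_reflect: "distr lborel borel (\<lambda>y. x - y) = (lborel :: 'a::euclidean_space measure)"
  using lborel_affine[of "-1" x] by (simp add: density_1)

lemma integral_lborel_reflect:
  fixes F :: "'a::euclidean_space \<Rightarrow> 'b::{banach, second_countable_topology}"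
  assumes "F \<in> borel_measurable borel"
  shows "(LINT y|lborel. F (x - y)) = (LINT y|lborel. F y)"
proof -
  have "(LINT y|lborel. F y) = (LINT y|distr lborel borel (\<lambda>y. x - y). F y)"
    by (simp add: lborel_distr_reflect)
  also have "\<dots> = (LINT y|lborel. F (x - y))"
    by (rule integral_distr) (use assms in auto)
  finally show ?thesis by simp
qed

lemma nn_integral_lborel_reflect:
  fixes F :: "'a::euclidean_space \<Rightarrow> ennreal"
  assumes "F \<in> borel_measurable borel"
  shows "(\<integral>\<^sup>+y. F (x - y) \<partial>lborel) = (\<integral>\<^sup>+y. F y \<partial>lborel)"
proof -
  have "(\<integral>\<^sup>+y. F y \<partial>lborel) = (\<integral>\<^sup>+y. F y \<partial>distr lborel borel (\<lambda>y. x - y))"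
    by (simp add: lborel_distr_reflect)
  also have "\<dots> = (\<integral>\<^sup>+y. F (x - y) \<partial>lborel)"
    by (rule nn_integral_distr) (use assms in auto)
  finally show ?thesis by simp
qed

lemma nn_integral_lborel_translate:
  fixes F :: "'a::euclidean_space \<Rightarrow> ennreal"
  assumes [measurable]: "F \<in> borel_measurable borel"
  shows "(\<integral>\<^sup>+y. F (y - h) \<partial>lborel) = (\<integral>\<^sup>+y. F y \<partial>lborel)"
proof -
  have "(\<integral>\<^sup>+y. F y \<partial>lborel) = (\<integral>\<^sup>+y. F y \<partial>distr lborel borel ((+) (- h)))"
    by (simp only: lborel_distr_plus)
  also have "\<dots> = (\<integral>\<^sup>+y. F (y - h) \<partial>lborel)"
    by (subst nn_integral_distr) auto
  finally show ?thesis by simp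
qed

lemma integrable_lborel_reflect:
  fixes F :: "'a::euclidean_space \<Rightarrow> 'b::{banach, second_countable_topology}"
  assumes "integrable lborel F"
  shows "integrable lborel (\<lambda>y. F (x - y))"
proof -
  have "F \<in> borel_measurable borel" using borel_measurable_integrable[OF assms] by simp
  then show ?thesis using assms nn_integral_lborel_reflect[of "\<lambda>y. ennreal (norm (F y))" x]
    unfolding integrable_iff_bounded by simp
qed

text \<open>The compact set \<open>S\<close> is a parameter, and not the support itself, because convenient larger
  sets occur: images of balls under dilations, and the supports of other functions.\<close>

definition kernel_on :: "(real^'n) set \<Rightarrow> (real^'n \<Rightarrow> real) \<Rightarrow> bool" where
  "kernel_on S k \<longleftrightarrow> compact S \<and> C_k 1 k \<and> (\<forall>z. z \<notin> S \<longrightarrow> k z = 0)"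

lemma kernel_onD:
  assumes "kernel_on S k"
  shows "compact S" "C_k (Suc 0) k" "\<And>z. z \<notin> S \<Longrightarrow> k z = 0" "continuous_on UNIV k"
    "continuous_on UNIV (grad k)" "\<And>z. k differentiable (at z)" "\<And>z. z \<notin> S \<Longrightarrow> grad k z = 0"
    "k \<in> borel_measurable borel" "grad k \<in> borel_measurable borel"
proof -
  show *: "compact S" "C_k (Suc 0) k" "\<And>z. z \<notin> S \<Longrightarrow> k z = 0"
    using assms by (auto simp: kernel_on_def simp del: C_k.simps)
  show 1: "continuous_on UNIV k" "continuous_on UNIV (grad k)" and "\<And>z. k differentiable (at z)"
    using *(2) by (blast intro: continuous_C_k continuous_grad C_k_differentiable)+
  show "grad k z = 0" if "z \<notin> S" for z
    by (rule grad_zero_off_support[of S]) (use * that compact_imp_closed in auto)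
  show "k \<in> borel_measurable borel" "grad k \<in> borel_measurable borel"
    using 1 by (auto intro: borel_measurable_continuous_onI)
qed

lemma bounded_of_compact_support:
  fixes f :: "'a::euclidean_space \<Rightarrow> 'b::real_normed_vector"
  assumes "continuous_on UNIV f" "compact S" "\<And>z. z \<notin> S \<Longrightarrow> f z = 0"
  obtains B where "B > 0" "\<And>z. norm (f z) \<le> B"
proof -
  have "bounded (f ` S)"
    using assms by (meson compact_continuous_image compact_imp_bounded continuous_on_subset subset_UNIV)
  then obtain B where "B > 0" "\<forall>x\<in>f ` S. norm x \<le> B" using bounded_pos by blast
  then have "norm (f z) \<le> B" for z using assms(3) by (cases "z \<in> S") auto
  with \<open>B > 0\<close> that show ?thesis by blast
qed

lemma integrable_scaleR_bounded:
  fixes k :: "'a::euclidean_space \<Rightarrow> 'b::{banach, second_countable_topology}"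
  assumes "integrable lborel (f :: _ \<Rightarrow> real)" "k \<in> borel_measurable borel" "\<And>z. norm (k z) \<le> B"
  shows "integrable lborel (\<lambda>y. f y *\<^sub>R k (x - y))"
proof (rule Bochner_Integration.integrable_bound[where f="\<lambda>y. B * norm (f y)"])
  show "(\<lambda>y. f y *\<^sub>R k (x - y)) \<in> borel_measurable lborel"
    using assms(2) borel_measurable_integrable[OF assms(1)] by (auto intro: borel_measurable_scaleR)
  show "AE y in lborel. norm (f y *\<^sub>R k (x - y)) \<le> norm (B * norm (f y))"
  proof (rule AE_I2)
    fix y
    have "norm (k (x - y)) \<le> \<bar>B\<bar>" using assms(3)[of "x - y"] by linarith
    then show "norm (f y *\<^sub>R k (x - y)) \<le> norm (B * norm (f y))"
      by (simp add: abs_mult mult.commute[of "\<bar>B\<bar>"] mult_left_mono)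
  qed
qed (use assms in auto)

lemma integrable_conv_bounded:
  fixes f :: "'a::euclidean_space \<Rightarrow> 'b::{banach, second_countable_topology}"
  assumes "integrable lborel f" "k \<in> borel_measurable borel" "\<And>z. \<bar>k z\<bar> \<le> B"
  shows "integrable lborel (\<lambda>y. k (x - y) *\<^sub>R f y)"
proof (rule Bochner_Integration.integrable_bound[where f="\<lambda>y. B * norm (f y)"])
  show "(\<lambda>y. k (x - y) *\<^sub>R f y) \<in> borel_measurable lborel"
    using assms(2) borel_measurable_integrable[OF assms(1)] by (auto intro: borel_measurable_scaleR)
  show "AE y in lborel. norm (k (x - y) *\<^sub>R f y) \<le> norm (B * norm (f y))"
  proof (rule AE_I2)
    fix y
    have "\<bar>k (x - y)\<bar> \<le> \<bar>B\<bar>" using assms(3)[of "x - y"] by linarith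
    then show "norm (k (x - y) *\<^sub>R f y) \<le> norm (B * norm (f y))"
      by (simp add: abs_mult mult_right_mono)
  qed
qed (use assms in auto)

lemma integrable_conv:
  fixes f :: "real^'n \<Rightarrow> 'b::{banach, second_countable_topology}"
  assumes "integrable lborel f" "kernel_on S k"
  shows "integrable lborel (\<lambda>y. k (x - y) *\<^sub>R f y)"
proof -
  obtain B where "\<And>z. norm (k z) \<le> B"
    using bounded_of_compact_support[of k S] kernel_onD[OF assms(2)] by metis
  then show ?thesis
    by (intro integrable_conv_bounded[of f k B] assms) (use kernel_onD[OF assms(2)] in auto)
qed

lemma integrable_conv_grad:
  fixes f :: "real^'n \<Rightarrow> real"
  assumes "integrable lborel f" "kernel_on S k"
  shows "integrable lborel (\<lambda>y. f y *\<^sub>R grad k (x - y))"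
proof -
  obtain B where "\<And>z. norm (grad k z) \<le> B"
    using bounded_of_compact_support[of "grad k" S] kernel_onD[OF assms(2)] by metis
  then show ?thesis
    by (intro integrable_scaleR_bounded[of f "grad k" B] assms) (use kernel_onD[OF assms(2)] in auto)
qed

lemma uniformly_continuous_compact_support:
  fixes f :: "'a::euclidean_space \<Rightarrow> 'b::real_normed_vector"
  assumes f: "continuous_on UNIV f" "compact S" "\<And>z. z \<notin> S \<Longrightarrow> f z = 0"
  shows "uniformly_continuous_on UNIV f"
  unfolding uniformly_continuous_on_def
proof (intro allI impI)
  fix e :: real assume "e > 0"
  let ?T = "{x + y |x y. x \<in> S \<and> y \<in> cball 0 1}"
  have "compact ?T" by (rule compact_sums[OF f(2) compact_cball])
  then have "uniformly_continuous_on ?T f"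
    by (rule compact_uniformly_continuous[OF continuous_on_subset[OF f(1) subset_UNIV]])
  then have "\<exists>d>0. \<forall>x\<in>?T. \<forall>y\<in>?T. dist y x < d \<longrightarrow> dist (f y) (f x) < e"
    using \<open>e > 0\<close> unfolding uniformly_continuous_on_def by (elim allE impE)
  then obtain d where d: "d > 0" "\<And>x y. x \<in> ?T \<Longrightarrow> y \<in> ?T \<Longrightarrow> dist y x < d \<Longrightarrow> dist (f y) (f x) < e"
    by (elim exE conjE) blast
  have T: "x \<in> ?T \<and> y \<in> ?T" if "x \<in> S \<or> y \<in> S" "dist y x < 1" for x y
  proof -
    have "x = x + 0" "y = x + (y - x)" "y = y + 0" "x = y + (x - y)" by auto
    moreover have "y - x \<in> cball 0 1" "x - y \<in> cball 0 1" "0 \<in> cball (0::'a) 1"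
      using that(2) by (auto simp: dist_norm norm_minus_commute)
    ultimately show ?thesis using that(1) by blast
  qed
  have "dist (f y) (f x) < e" if "dist y x < min d 1" for x y
    using T[of x y] d(2)[of x y] f(3) that \<open>e > 0\<close> by (cases "x \<in> S \<or> y \<in> S") auto
  then show "\<exists>d>0. \<forall>x\<in>UNIV. \<forall>x'\<in>UNIV. dist x' x < d \<longrightarrow> dist (f x') (f x) < e"
    using d(1) by (intro exI[of _ "min d 1"]) auto
qed

lemma kernel_linearization:
  fixes k :: "real^'n \<Rightarrow> real"
  assumes "kernel_on S k" "e > 0"
  obtains d where "d > 0" "\<And>w h. norm h < d \<Longrightarrow> \<bar>k (w + h) - k w - grad k w \<bullet> h\<bar> \<le> e * norm h"
proof -
  note k = kernel_onD[OF assms(1)]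
  have "uniformly_continuous_on UNIV (grad k)"
    by (rule uniformly_continuous_compact_support[OF k(5,1,7)])
  then obtain d where d: "d > 0" "\<And>x y. dist y x < d \<Longrightarrow> dist (grad k y) (grad k x) < e"
    using \<open>e > 0\<close> unfolding uniformly_continuous_on_def by (metis UNIV_I)
  have "\<bar>k (w + h) - k w - grad k w \<bullet> h\<bar> \<le> e * norm h" if "norm h < d" for w h
  proof -
    have "norm (k (w + h) - k w - (\<lambda>v. grad k w \<bullet> v) ((w + h) - w)) \<le> norm ((w + h) - w) * e"
    proof (rule differentiable_bound_linearization[where S="ball w d" and f'="\<lambda>x v. grad k x \<bullet> v"])
      fix t :: real assume t: "t \<in> {0..1}"
      have "norm (t *\<^sub>R h) \<le> norm h" using t by (simp add: mult_left_le_one_le)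
      then show "w + t *\<^sub>R (w + h - w) \<in> ball w d" using that by (simp add: dist_norm)
    next
      show "(k has_derivative (\<lambda>v. grad k x \<bullet> v)) (at x within ball w d)" for x
        by (rule has_derivative_at_withinI[OF has_derivative_grad[OF k(6)]])
      fix x assume "x \<in> ball w d"
      then have "norm (grad k x - grad k w) \<le> e"
        using d(2)[of x w] by (simp add: dist_norm norm_minus_commute)
      then have "norm (((\<lambda>v. grad k x \<bullet> v) - (\<lambda>v. grad k w \<bullet> v)) v) \<le> e * norm v" for v
        using Cauchy_Schwarz_ineq2[of "grad k x - grad k w" v]
          mult_right_mono[of "norm (grad k x - grad k w)" e "norm v"]
        by (simp add: fun_diff_def inner_diff_left)
      then show "onorm ((\<lambda>v. grad k x \<bullet> v) - (\<lambda>v. grad k w \<bullet> v)) \<le> e"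
        by (rule onorm_le)
    qed (use d(1) in auto)
    then show ?thesis by (simp add: mult.commute)
  qed
  with d(1) that show ?thesis by blast
qed

text \<open>The linearization of the kernel is uniform, so its error stays small after integration
  against \<open>f\<close>.\<close>

lemma conv_has_derivative:
  fixes f :: "real^'n \<Rightarrow> real"
  assumes f: "integrable lborel f" and k: "kernel_on S k"
  shows "(conv k f has_derivative (\<lambda>h. (LINT y|lborel. f y *\<^sub>R grad k (x - y)) \<bullet> h)) (at x)"
proof -
  let ?v = "LINT y|lborel. f y *\<^sub>R grad k (x - y)"
  define n where "n = (LINT y|lborel. \<bar>f y\<bar>)"
  have n: "n \<ge> 0" unfolding n_def by (simp add: integral_nonneg)
  show ?thesis unfolding has_derivative_at_alt
  proof (intro conjI allI impI)
    show "bounded_linear ((\<bullet>) ?v)" by (rule bounded_linear_inner_right)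
    fix e :: real assume e: "e > 0"
    then have "e / (n + 1) > 0" using n by simp
    from kernel_linearization[OF k this] obtain d where d: "d > 0"
      "\<And>w h. norm h < d \<Longrightarrow> \<bar>k (w + h) - k w - grad k w \<bullet> h\<bar> \<le> e / (n + 1) * norm h" by blast
    show "\<exists>d>0. \<forall>y. norm (y - x) < d \<longrightarrow>
        norm (conv k f y - conv k f x - ?v \<bullet> (y - x)) \<le> e * norm (y - x)"
    proof (intro exI[of _ d] conjI allI impI)
      fix x' assume x': "norm (x' - x) < d"
      define h where "h = x' - x"
      have i1: "integrable lborel (\<lambda>y. k (x' - y) * f y)" "integrable lborel (\<lambda>y. k (x - y) * f y)"
        using integrable_conv[OF f k] by auto
      have i2: "integrable lborel (\<lambda>y. (f y *\<^sub>R grad k (x - y)) \<bullet> h)"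
        by (intro integrable_inner_left impI integrable_conv_grad[OF f k])
      have "?v \<bullet> h = (LINT y|lborel. (f y *\<^sub>R grad k (x - y)) \<bullet> h)"
        by (rule integral_inner_left[symmetric]) (rule integrable_conv_grad[OF f k])
      then have "conv k f x' - conv k f x - ?v \<bullet> h =
         (LINT y|lborel. k (x' - y) * f y - k (x - y) * f y - (f y *\<^sub>R grad k (x - y)) \<bullet> h)"
        using i1 i2 by (simp add: conv_def)
      also have "\<bar>\<dots>\<bar> \<le> (LINT y|lborel. e / (n + 1) * norm h * \<bar>f y\<bar>)"
      proof (rule order_trans[OF integral_abs_bound])
        show "(LINT y|lborel. \<bar>k (x' - y) * f y - k (x - y) * f y - (f y *\<^sub>R grad k (x - y)) \<bullet> h\<bar>)
           \<le> (LINT y|lborel. e / (n + 1) * norm h * \<bar>f y\<bar>)"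
        proof (rule integral_mono)
          show "integrable lborel (\<lambda>y. \<bar>k (x' - y) * f y - k (x - y) * f y - (f y *\<^sub>R grad k (x - y)) \<bullet> h\<bar>)"
            using i1 i2 by (intro integrable_abs Bochner_Integration.integrable_diff)
          show "integrable lborel (\<lambda>y. e / (n + 1) * norm h * \<bar>f y\<bar>)" using f by auto
          fix y
          have "\<bar>k ((x - y) + h) - k (x - y) - grad k (x - y) \<bullet> h\<bar> \<le> e / (n + 1) * norm h"
            using d(2)[of h "x - y"] x' by (simp add: h_def)
          then have "\<bar>k ((x - y) + h) - k (x - y) - grad k (x - y) \<bullet> h\<bar> * \<bar>f y\<bar> \<le> e / (n + 1) * norm h * \<bar>f y\<bar>"
            by (rule mult_right_mono) simp
          then show "\<bar>k (x' - y) * f y - k (x - y) * f y - (f y *\<^sub>R grad k (x - y)) \<bullet> h\<bar> \<le> e / (n + 1) * norm h * \<bar>f y\<bar>"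
            unfolding abs_mult[symmetric] by (simp add: h_def algebra_simps)
        qed
      qed
      also have "\<dots> = e * norm h * (n / (n + 1))" by (simp add: n_def)
      also have "\<dots> \<le> e * norm h" using n e by (intro mult_left_le) auto
      finally show "norm (conv k f x' - conv k f x - ?v \<bullet> (x' - x)) \<le> e * norm (x' - x)"
        by (simp add: h_def)
    qed (rule d(1))
  qed
qed

lemmas grad_conv = conv_has_derivative[THEN grad_eqI]

lemma grad_conv_nth:
  fixes f :: "real^'n \<Rightarrow> real"
  assumes f: "integrable lborel f" and k: "kernel_on S k"
  shows "grad (conv k f) x $ i = conv (\<lambda>z. grad k z $ i) f x"
proof -
  have "grad (conv k f) x $ i = (LINT y|lborel. f y *\<^sub>R grad k (x - y)) $ i"
    by (simp add: grad_conv[OF assms])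
  also have "\<dots> = (LINT y|lborel. (f y *\<^sub>R grad k (x - y)) $ i)"
    by (rule integral_bounded_linear[OF bounded_linear_vec_nth integrable_conv_grad[OF assms], symmetric])
  finally show ?thesis by (simp add: conv_def mult.commute)
qed

lemma conv_C_k:
  fixes f :: "real^'n \<Rightarrow> real"
  assumes f: "integrable lborel f" and S: "compact S"
  shows "(\<And>j. C_k j k) \<Longrightarrow> (\<And>z. z \<notin> S \<Longrightarrow> k z = 0) \<Longrightarrow> C_k j (conv k f)"
proof (induction j arbitrary: k)
  case 0
  then have "kernel_on S k" using S by (simp add: kernel_on_def del: C_k.simps)
  then show ?case
    using conv_has_derivative[OF f]
    by (auto intro!: continuous_at_imp_continuous_on has_derivative_continuous)
next
  case (Suc j)
  then have k: "kernel_on S k" using S by (simp add: kernel_on_def del: C_k.simps)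
  have "C_k j (conv (\<lambda>z. grad k z $ i) f)" for i
  proof (rule Suc.IH)
    show "C_k j (\<lambda>z. grad k z $ i)" for j using Suc.prems(1)[of "Suc j"] by simp
    show "grad k z $ i = 0" if "z \<notin> S" for z using kernel_onD(7)[OF k that] by simp
  qed
  moreover have "conv k f differentiable_on UNIV"
    using conv_has_derivative[OF f k] by (auto simp: differentiable_on_def differentiable_def)
  ultimately show ?case by (simp add: grad_conv_nth[OF f k])
qed

text \<open>The convolution of \<open>w\<close> with the indicator of a large ball is constant near the origin, and
  its gradient there is the integral of the gradient of \<open>w\<close>.\<close>

lemma integral_grad_zero:
  fixes w :: "real^'n \<Rightarrow> real"
  assumes w: "kernel_on S w"
  shows "(LINT y|lborel. grad w y) = 0"
proof -
  note k = kernel_onD[OF w]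
  obtain r where r: "r > 0" "S \<subseteq> ball 0 r"
    using bounded_subset_ballD[OF compact_imp_bounded[OF k(1)], of 0] by auto
  define f where "f = (indicator (cball 0 (r + 1)) :: real^'n \<Rightarrow> real)"
  have f: "integrable lborel f"
    unfolding f_def by (rule integrable_real_indicator) (use emeasure_lborel_cball_finite in \<open>auto simp: less_top[symmetric]\<close>)
  have loc: "y \<in> cball 0 (r + 1)" if "x \<in> ball 0 1" "x - y \<in> S" for x y :: "real^'n"
  proof -
    have "norm (x - y) < r" using r(2) that by auto
    then have "norm y \<le> norm x + r" using norm_triangle_ineq4[of x "x - y"] by simp
    then show ?thesis using that(1) by simp
  qed
  have "conv w f x = (LINT y|lborel. w y)" if "x \<in> ball 0 1" for x
  proof -
    have "conv w f x = (LINT y|lborel. w (x - y))"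
      unfolding conv_def using loc[OF that] k(3)
      by (intro Bochner_Integration.integral_cong) (auto simp: f_def indicator_def)
    then show ?thesis using integral_lborel_reflect k(8) by metis
  qed
  note const = this
  have "(conv w f has_derivative (\<lambda>h. 0)) (at 0)"
    by (rule has_derivative_transform_within_open[where s="ball 0 1", OF has_derivative_const open_ball _ const[symmetric]])
      simp_all
  then have "grad (conv w f) 0 = 0" by (intro grad_eqI) simp
  then have "(LINT y|lborel. f y *\<^sub>R grad w (0 - y)) = 0" by (simp add: grad_conv[OF f w])
  also have "(LINT y|lborel. f y *\<^sub>R grad w (0 - y)) = (LINT y|lborel. grad w (0 - y))"
    using loc[of 0] k(7) by (intro Bochner_Integration.integral_cong) (auto simp: f_def indicator_def)
  also have "\<dots> = (LINT y|lborel. grad w y)" by (rule integral_lborel_reflect[OF k(9)])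
  finally show ?thesis .
qed

lemma kernel_on_mult:
  assumes "kernel_on S u" "C_k 1 v"
  shows "kernel_on S (\<lambda>x. u x * v x)"
  using assms unfolding kernel_on_def by (auto intro: C_k_mult simp del: C_k.simps)

text \<open>The gradient of the compactly supported product \<open>u v\<close> has integral zero.\<close>

lemma integration_by_parts:
  fixes u v :: "real^'n \<Rightarrow> real"
  assumes u: "kernel_on S u" and v: "C_k 1 v"
  shows "(LINT y|lborel. u y * grad v y $ i) = - (LINT y|lborel. grad u y $ i * v y)"
proof -
  note k = kernel_onD[OF u]
  note v' = v[unfolded One_nat_def]
  have g: "grad (\<lambda>y. u y * v y) y = u y *\<^sub>R grad v y + v y *\<^sub>R grad u y" for y
    by (rule grad_mult[OF k(6) C_k_differentiable[OF v']])
  have i1: "integrable lborel (\<lambda>y. u y *\<^sub>R grad v y)"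
    by (rule integrable_continuous_compact_support[OF _ k(1)])
       (auto intro!: continuous_intros k(4) continuous_grad v' simp: k(3))
  have i2: "integrable lborel (\<lambda>y. v y *\<^sub>R grad u y)"
    by (rule integrable_continuous_compact_support[OF _ k(1)])
       (auto intro!: continuous_intros k(5) continuous_C_k[OF v] simp: k(7))
  have "0 = (LINT y|lborel. grad (\<lambda>y. u y * v y) y) $ i"
    by (simp add: integral_grad_zero[OF kernel_on_mult[OF u v]])
  also have "\<dots> = (LINT y|lborel. u y *\<^sub>R grad v y) $ i + (LINT y|lborel. v y *\<^sub>R grad u y) $ i"
    using i1 i2 by (simp add: g)
  also have "\<dots> = (LINT y|lborel. u y * grad v y $ i) + (LINT y|lborel. grad u y $ i * v y)"
    using integral_bounded_linear[OF bounded_linear_vec_nth i1, of i, symmetric]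
      integral_bounded_linear[OF bounded_linear_vec_nth i2, of i, symmetric] by (simp add: mult.commute)
  finally show ?thesis by simp
qed

lemma kernel_on_integrable:
  assumes "kernel_on S u"
  shows "integrable lborel u" "integrable lborel (grad u)"
  using kernel_onD[OF assms] by (blast intro: integrable_continuous_compact_support)+

lemma C_k_reflect:
  fixes k :: "real^'n \<Rightarrow> real"
  assumes "C_k j k"
  shows "C_k j (\<lambda>y. k (x - y))"
proof -
  have "C_k j k \<Longrightarrow> C_k j (\<lambda>y. c * k (x - y))" for c
  proof (induction j arbitrary: k c)
    case 0 then show ?case by (auto intro!: continuous_intros intro: continuous_on_compose2)
  next
    case (Suc j)
    have "((\<lambda>y. c * k (x - y)) has_derivative (\<lambda>h. (- c *\<^sub>R grad k (x - y)) \<bullet> h)) (at y)" for y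
    proof -
      have "((\<lambda>y. x - y) has_derivative (\<lambda>h. - h)) (at y)" by (auto intro!: derivative_eq_intros)
      from has_derivative_compose[OF this has_derivative_grad[OF C_k_differentiable[OF Suc.prems]]]
      have "((\<lambda>y. k (x - y)) has_derivative (\<lambda>h. grad k (x - y) \<bullet> (- h))) (at y)" .
      from has_derivative_mult_right[OF this, of c] show ?thesis by simp
    qed
    then have *: "grad (\<lambda>y. c * k (x - y)) y = - c *\<^sub>R grad k (x - y)"
      "(\<lambda>y. c * k (x - y)) differentiable (at y)" for y
      by (auto intro: grad_eqI simp: differentiable_def)
    have "C_k j (\<lambda>y. (- c) * grad k (x - y) $ i)" for i
      by (rule Suc.IH) (use Suc.prems in simp)
    moreover have "(\<lambda>y. c * k (x - y)) differentiable_on UNIV"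
      using *(2) unfolding differentiable_on_def by blast
    ultimately show ?case by (simp add: *(1))
  qed
  from this[OF assms, of 1] show ?thesis by simp
qed

lemma grad_reflect:
  fixes k :: "real^'n \<Rightarrow> real"
  assumes "C_k (Suc 0) k"
  shows "grad (\<lambda>y. k (x - y)) y = - grad k (x - y)"
proof (rule grad_eqI)
  have "((\<lambda>y. x - y) has_derivative (\<lambda>h. - h)) (at y)" by (auto intro!: derivative_eq_intros)
  from has_derivative_compose[OF this has_derivative_grad[OF C_k_differentiable[OF assms]]]
  show "((\<lambda>y. k (x - y)) has_derivative (\<lambda>h. - grad k (x - y) \<bullet> h)) (at y)" by simp
qed

lemma grad_conv_C1:
  fixes u :: "real^'n \<Rightarrow> real"
  assumes u: "kernel_on T u" and k: "kernel_on S k"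
  shows "grad (conv k u) x = conv k (grad u) x"
proof (rule vec_eq_iff[THEN iffD2], rule allI)
  fix i
  note k' = kernel_onD[OF k]
  have "grad (conv k u) x $ i = (LINT y|lborel. grad k (x - y) $ i * u y)"
    by (simp add: grad_conv_nth[OF kernel_on_integrable(1)[OF u] k] conv_def)
  also have "\<dots> = - (LINT y|lborel. u y * grad (\<lambda>y. k (x - y)) y $ i)"
    by (simp add: grad_reflect[OF k'(2)] mult.commute)
  also have "\<dots> = (LINT y|lborel. grad u y $ i * k (x - y))"
    by (subst integration_by_parts[OF u]) (auto intro: C_k_reflect k'(2) simp del: C_k.simps)
  also have "\<dots> = (LINT y|lborel. (k (x - y) *\<^sub>R grad u y) $ i)" by (simp add: mult.commute)
  also have "\<dots> = conv k (grad u) x $ i"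
    unfolding conv_def
    by (rule integral_bounded_linear[OF bounded_linear_vec_nth integrable_conv[OF kernel_on_integrable(2)[OF u] k]])
  finally show "grad (conv k u) x $ i = conv k (grad u) x $ i" .
qed

section \<open>Convergence of mollifications in \<open>L\<^sup>1\<close>\<close>

lemma integral_lborel_translate:
  fixes F :: "'a::euclidean_space \<Rightarrow> 'b::{banach, second_countable_topology}"
  assumes "F \<in> borel_measurable borel"
  shows "(LINT y|lborel. F (y - h)) = (LINT y|lborel. F y)"
proof -
  have "(LINT y|lborel. F y) = (LINT y|distr lborel borel ((+) (- h)). F y)"
    by (simp only: lborel_distr_plus)
  also have "\<dots> = (LINT y|lborel. F (y - h))"
    by (subst integral_distr) (use assms in auto)
  finally show ?thesis by simp
qed

lemma integrable_lborel_translate: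
  fixes F :: "'a::euclidean_space \<Rightarrow> 'b::{banach, second_countable_topology}"
  assumes "integrable lborel F"
  shows "integrable lborel (\<lambda>y. F (y - h))"
proof -
  have "F \<in> borel_measurable borel" using borel_measurable_integrable[OF assms] by simp
  then show ?thesis using assms nn_integral_lborel_translate[of "\<lambda>y. ennreal (norm (F y))" h]
    unfolding integrable_iff_bounded by simp
qed

definition translation_modulus :: "('a::euclidean_space \<Rightarrow> 'b::{banach, second_countable_topology}) \<Rightarrow> 'a \<Rightarrow> real" where
  "translation_modulus f h = (LINT x|lborel. norm (f (x - h) - f x))"

lemma translation_modulus_triangle:
  fixes f g :: "'a::euclidean_space \<Rightarrow> 'b::{banach, second_countable_topology}"
  assumes f: "integrable lborel f" and g: "integrable lborel g"
  shows "translation_modulus f h \<le> translation_modulus g h + 2 * (LINT x|lborel. norm (f x - g x))"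
proof -
  have i: "integrable lborel (\<lambda>x. f (x - h))" "integrable lborel (\<lambda>x. g (x - h))"
    using f g by (auto intro: integrable_lborel_translate)
  have "(\<lambda>x. norm (f x - g x)) \<in> borel_measurable borel"
    using borel_measurable_integrable[OF f] borel_measurable_integrable[OF g] by simp
  from integral_lborel_translate[OF this, of h]
  have eq: "(LINT x|lborel. norm (f (x - h) - g (x - h))) = (LINT x|lborel. norm (f x - g x))" .
  have "translation_modulus f h \<le> (LINT x|lborel. norm (g (x - h) - g x) + (norm (f (x - h) - g (x - h)) + norm (f x - g x)))"
    unfolding translation_modulus_def
  proof (rule integral_mono)
    fix x
    have "f (x - h) - f x = (g (x - h) - g x) + ((f (x - h) - g (x - h)) - (f x - g x))" by simp
    also have "norm \<dots> \<le> norm (g (x - h) - g x) + (norm (f (x - h) - g (x - h)) + norm (f x - g x))"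
      by (intro order_trans[OF norm_triangle_ineq] add_left_mono norm_triangle_ineq4)
    finally show "norm (f (x - h) - f x) \<le> norm (g (x - h) - g x) + (norm (f (x - h) - g (x - h)) + norm (f x - g x))" .
  qed (use i f g in auto)
  also have "\<dots> = translation_modulus g h + 2 * (LINT x|lborel. norm (f x - g x))"
    using i f g by (simp add: translation_modulus_def eq)
  finally show ?thesis .
qed

lemma translation_modulus_nonneg: "0 \<le> translation_modulus f h"
  by (simp add: translation_modulus_def integral_nonneg)

text \<open>For the indicator of an open set of finite measure the integrals of \<open>f (x - h)\<close> and
  \<open>f x\<close> agree, so that it is enough to control the negative part of the difference, which
  converges pointwise.\<close>

lemma translation_modulus_open:
  fixes U :: "'a::euclidean_space set"
  assumes U: "open U" "emeasure lborel U < \<infinity>" and h: "h \<longlonglongrightarrow> 0"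
  shows "(\<lambda>n. translation_modulus (indicator U :: 'a \<Rightarrow> real) (h n)) \<longlonglongrightarrow> 0"
proof -
  let ?I = "indicator U :: 'a \<Rightarrow> real"
  have i: "integrable lborel ?I" using U by (intro integrable_real_indicator) auto
  have it: "integrable lborel (\<lambda>x. ?I (x - h n))" for n by (rule integrable_lborel_translate[OF i])
  have ip: "integrable lborel (\<lambda>x. max 0 (?I x - ?I (x - h n)))" for n
    using i it by auto
  have eq: "translation_modulus ?I (h n) = 2 * (LINT x|lborel. max 0 (?I x - ?I (x - h n)))" for n
  proof -
    have "translation_modulus ?I (h n) =
      (LINT x|lborel. (?I (x - h n) - ?I x) + 2 * max 0 (?I x - ?I (x - h n)))"
      unfolding translation_modulus_def
      by (intro Bochner_Integration.integral_cong) (auto simp: max_def)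
    also have "\<dots> = (LINT x|lborel. ?I (x - h n)) - (LINT x|lborel. ?I x) + 2 * (LINT x|lborel. max 0 (?I x - ?I (x - h n)))"
      using i it ip by simp
    finally show ?thesis using integral_lborel_translate[of ?I "h n"] U by simp
  qed
  have "(\<lambda>n. LINT x|lborel. max 0 (?I x - ?I (x - h n))) \<longlonglongrightarrow> (LINT x::'a|lborel. (0::real))"
  proof (rule integral_dominated_convergence[where w="?I"])
    show "AE x in lborel. (\<lambda>n. max 0 (?I x - ?I (x - h n))) \<longlonglongrightarrow> 0"
    proof (rule AE_I2)
      fix x
      have "eventually (\<lambda>n. max 0 (?I x - ?I (x - h n)) = 0) sequentially"
      proof (cases "x \<in> U")
        case True
        have "(\<lambda>n. x - h n) \<longlonglongrightarrow> x - 0" by (intro tendsto_intros h)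
        then have "eventually (\<lambda>n. x - h n \<in> U) sequentially"
          using topological_tendstoD[OF _ U(1)] True by fastforce
        then show ?thesis by eventually_elim (auto simp: indicator_def)
      qed auto
      then show "(\<lambda>n. max 0 (?I x - ?I (x - h n))) \<longlonglongrightarrow> 0"
        by (rule tendsto_eventually)
    qed
    show "AE x in lborel. norm (max 0 (?I x - ?I (x - h n))) \<le> ?I x" for n
      by (auto simp: indicator_def)
  qed (use i ip in auto)
  then show ?thesis unfolding eq using tendsto_mult_left[of _ 0 sequentially 2] by simp
qed

text \<open>The modulus is stable under approximation in \<open>L\<^sup>1\<close>, since translations preserve the norm.\<close>

lemma translation_modulus_approx:
  fixes f :: "'a::euclidean_space \<Rightarrow> 'b::{banach, second_countable_topology}"
  assumes f: "integrable lborel f"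
    and "\<And>e. e > 0 \<Longrightarrow> \<exists>g. integrable lborel g \<and> (\<lambda>n. translation_modulus g (h n)) \<longlonglongrightarrow> 0 \<and>
            (LINT x|lborel. norm (f x - g x)) < e"
  shows "(\<lambda>n. translation_modulus f (h n)) \<longlonglongrightarrow> 0"
proof (rule LIMSEQ_I)
  fix e :: real assume "e > 0"
  then obtain g where g: "integrable lborel g" "(\<lambda>n. translation_modulus g (h n)) \<longlonglongrightarrow> 0"
    "(LINT x|lborel. norm (f x - g x)) < e / 4"
    using assms(2)[of "e / 4"] by auto
  obtain N where N: "\<And>n. n \<ge> N \<Longrightarrow> translation_modulus g (h n) < e / 2"
    using LIMSEQ_D[OF g(2), of "e / 2"] \<open>e > 0\<close> by (auto simp: translation_modulus_nonneg)
  have "norm (translation_modulus f (h n) - 0) < e" if "n \<ge> N" for n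
    using translation_modulus_triangle[OF f g(1), of "h n"] N[OF that] g(3) translation_modulus_nonneg[of f "h n"]
    by simp
  then show "\<exists>N. \<forall>n\<ge>N. norm (translation_modulus f (h n) - 0) < e" by blast
qed

lemma translation_modulus_scaleR:
  fixes f :: "'a::euclidean_space \<Rightarrow> real"
  shows "translation_modulus (\<lambda>x. f x *\<^sub>R c) h = norm c * translation_modulus f h"
proof -
  have "norm (f (x - h) *\<^sub>R c - f x *\<^sub>R c) = norm c * norm (f (x - h) - f x)" for x
    unfolding scaleR_left_diff_distrib[symmetric] by simp
  then show ?thesis by (simp add: translation_modulus_def)
qed

text \<open>By approximation it suffices to treat indicators of sets of finite measure, and by outer
  regularity those of open sets.\<close>

lemma translation_modulus_tendsto_0:
  fixes f :: "'a::euclidean_space \<Rightarrow> 'b::{banach, second_countable_topology}"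
  assumes f: "integrable lborel f" and h: "h \<longlonglongrightarrow> 0"
  shows "(\<lambda>n. translation_modulus f (h n)) \<longlonglongrightarrow> 0"
  using f
proof (induction rule: integrable_induct)
  case (base A c)
  let ?I = "indicator A :: 'a \<Rightarrow> real"
  have i: "integrable lborel ?I" using base by (intro integrable_real_indicator) auto
  have "(\<lambda>n. translation_modulus ?I (h n)) \<longlonglongrightarrow> 0"
  proof (rule translation_modulus_approx[OF i])
    fix e :: real assume "e > 0"
    have "A \<in> sets borel" using base by simp
    then obtain U where U: "open U" "A \<subseteq> U" "emeasure lborel (U - A) < ennreal e"
      using outer_regular_lborel[of A e] \<open>e > 0\<close> by blast
    have fin: "emeasure lborel U < \<infinity>"
    proof -
      have "emeasure lborel (A \<union> (U - A)) \<le> emeasure lborel A + emeasure lborel (U - A)"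
        using U base by (intro emeasure_subadditive) auto
      also have "\<dots> < \<infinity>" using U(3) base(2) by (auto simp: less_top[symmetric] top_unique)
      finally show ?thesis using U(2) by (simp add: Un_absorb1)
    qed
    have "(LINT x|lborel. norm (?I x - indicator U x)) = (LINT x|lborel. indicator (U - A) x)"
      using U(2) by (intro Bochner_Integration.integral_cong) (auto simp: indicator_def)
    also have "\<dots> = measure lborel (U - A)" by simp
    also have "\<dots> < e"
    proof -
      have "emeasure lborel (U - A) \<noteq> top" using U(3) by (metis ennreal_less_top less_trans less_irrefl)
      then show ?thesis
        using U(3) \<open>e > 0\<close> by (simp add: emeasure_eq_ennreal_measure ennreal_less_iff)
    qed
    finally have *: "(LINT x|lborel. norm (?I x - indicator U x)) < e" .
    have "integrable lborel (indicator U :: 'a \<Rightarrow> real)" using U fin by (intro integrable_real_indicator) auto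
    with * translation_modulus_open[OF U(1) fin h]
    show "\<exists>g. integrable lborel g \<and> (\<lambda>n. translation_modulus g (h n)) \<longlonglongrightarrow> 0 \<and>
            (LINT x|lborel. norm (?I x - g x)) < e" by blast
  qed
  then show ?case unfolding translation_modulus_scaleR using tendsto_mult_left[of _ 0 sequentially "norm c"] by simp
next
  case (add f g)
  have "translation_modulus (\<lambda>x. f x + g x) (h n) \<le> translation_modulus f (h n) + translation_modulus g (h n)" for n
  proof -
    have "translation_modulus (\<lambda>x. f x + g x) (h n) \<le>
      (LINT x|lborel. norm (f (x - h n) - f x) + norm (g (x - h n) - g x))"
      unfolding translation_modulus_def
    proof (rule integral_mono)
      fix x
      show "norm (f (x - h n) + g (x - h n) - (f x + g x)) \<le> norm (f (x - h n) - f x) + norm (g (x - h n) - g x)"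
        by (rule norm_diff_triangle_ineq)
    qed (intro integrable_norm Bochner_Integration.integrable_add Bochner_Integration.integrable_diff
          integrable_lborel_translate add(1,2))+
    also have "\<dots> = translation_modulus f (h n) + translation_modulus g (h n)"
      using add integrable_lborel_translate[OF add(1)] integrable_lborel_translate[OF add(2)]
      by (simp add: translation_modulus_def)
    finally show ?thesis .
  qed
  moreover have "(\<lambda>n. translation_modulus f (h n) + translation_modulus g (h n)) \<longlonglongrightarrow> 0"
    using tendsto_add[OF add(3,4)] by simp
  ultimately show ?case
    by (rule tendsto_sandwich[OF always_eventually[OF allI[OF translation_modulus_nonneg]]
          always_eventually[OF allI] tendsto_const[of 0]])
next
  case (lim f s)
  show ?case
  proof (rule translation_modulus_approx[OF lim(4)])
    fix e :: real assume "e > 0"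
    have "(\<lambda>i. LINT x|lborel. norm (f x - s i x)) \<longlonglongrightarrow> (LINT x::'a|lborel. (0::real))"
    proof (rule integral_dominated_convergence[where w="\<lambda>x. 3 * norm (f x)"])
      show "AE x in lborel. (\<lambda>i. norm (f x - s i x)) \<longlonglongrightarrow> 0"
        using lim(2) by (intro AE_I2 tendsto_norm_zero) (auto intro!: tendsto_eq_intros)
      show "AE x in lborel. norm (norm (f x - s i x)) \<le> 3 * norm (f x)" for i
      proof (rule AE_I2)
        fix x :: 'a assume "x \<in> space lborel"
        then have "norm (s i x) \<le> 2 * norm (f x)" by (rule lim(3))
        then show "norm (norm (f x - s i x)) \<le> 3 * norm (f x)"
          using norm_triangle_ineq4[of "f x" "s i x"] by simp
      qed
    qed (use lim(1,4) in auto)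
    then have "(\<lambda>i. LINT x|lborel. norm (f x - s i x)) \<longlonglongrightarrow> 0" by simp
    from order_tendstoD(2)[OF this \<open>e > 0\<close>] obtain i where "(LINT x|lborel. norm (f x - s i x)) < e"
      unfolding eventually_sequentially by blast
    with lim(1)[of i] lim(5)[of i] show "\<exists>g. integrable lborel g \<and> (\<lambda>n. translation_modulus g (h n)) \<longlonglongrightarrow> 0 \<and>
            (LINT x|lborel. norm (f x - g x)) < e" by blast
  qed
qed

lemma translation_modulus_small:
  fixes f :: "'a::euclidean_space \<Rightarrow> 'b::{banach, second_countable_topology}"
  assumes f: "integrable lborel f" and e: "e > 0"
  obtains d where "d > 0" "\<And>h. norm h < d \<Longrightarrow> translation_modulus f h < e"
proof (rule ccontr)
  assume "\<not> thesis"
  then have "\<exists>h. norm h < inverse (real (Suc n)) \<and> translation_modulus f h \<ge> e" for n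
    using that[of "inverse (real (Suc n))"] by (meson inverse_positive_iff_positive not_less of_nat_0_less_iff zero_less_Suc)
  then obtain h where h: "\<And>n. norm (h n) < inverse (real (Suc n))" "\<And>n. translation_modulus f (h n) \<ge> e"
    by metis
  have "h \<longlonglongrightarrow> 0"
    by (rule Lim_null_comparison[OF _ LIMSEQ_inverse_real_of_nat]) (intro always_eventually allI less_imp_le h(1))
  from order_tendstoD(2)[OF translation_modulus_tendsto_0[OF f this] e]
  obtain n where "translation_modulus f (h n) < e"
    unfolding eventually_sequentially by blast
  then show False using h(2)[of n] by simp
qed

lemma conv_eq:
  fixes f :: "'a::euclidean_space \<Rightarrow> 'b::{banach, second_countable_topology}"
  assumes "k \<in> borel_measurable borel" "f \<in> borel_measurable borel"
  shows "conv k f x = (LINT z|lborel. k z *\<^sub>R f (x - z))"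
  using integral_lborel_reflect[of "\<lambda>y. k y *\<^sub>R f (x - y)" x] assms by (simp add: conv_def)

lemma measurable_conv:
  fixes f :: "'a::euclidean_space \<Rightarrow> 'b::{banach, second_countable_topology}"
  assumes [measurable]: "k \<in> borel_measurable borel" "f \<in> borel_measurable borel"
  shows "conv k f \<in> borel_measurable borel"
  unfolding conv_def by measurable

lemma norm_integral_le_nn_integral:
  fixes f :: "'a \<Rightarrow> 'b::{banach, second_countable_topology}"
  shows "ennreal (norm (integral\<^sup>L M f)) \<le> (\<integral>\<^sup>+x. norm (f x) \<partial>M)"
  by (cases "integrable M f") (simp_all add: integral_norm_bound_ennreal not_integrable_integral_eq)

text \<open>Tonelli and the translation invariance of the measure.\<close>

lemma nn_integral_conv_le:
  fixes f :: "'a::euclidean_space \<Rightarrow> 'b::{banach, second_countable_topology}"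
  assumes [measurable]: "k \<in> borel_measurable borel" "f \<in> borel_measurable borel"
  shows "(\<integral>\<^sup>+x. norm (conv k f x) \<partial>lborel) \<le> (\<integral>\<^sup>+z. ennreal \<bar>k z\<bar> \<partial>lborel) * (\<integral>\<^sup>+x. norm (f x) \<partial>lborel)"
proof -
  have "(\<integral>\<^sup>+x. norm (conv k f x) \<partial>lborel) \<le> (\<integral>\<^sup>+x. \<integral>\<^sup>+z. ennreal (norm (k z *\<^sub>R f (x - z))) \<partial>lborel \<partial>lborel)"
    by (intro nn_integral_mono) (simp only: conv_eq[OF assms] norm_integral_le_nn_integral)
  also have "\<dots> = (\<integral>\<^sup>+z. \<integral>\<^sup>+x. ennreal (norm (k z *\<^sub>R f (x - z))) \<partial>lborel \<partial>lborel)"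
    by (intro lborel_pair.Fubini') measurable
  also have "\<dots> = (\<integral>\<^sup>+z. ennreal \<bar>k z\<bar> * (\<integral>\<^sup>+x. norm (f x) \<partial>lborel) \<partial>lborel)"
  proof (intro nn_integral_cong)
    fix z
    have "(\<integral>\<^sup>+x. ennreal (norm (k z *\<^sub>R f (x - z))) \<partial>lborel) = ennreal \<bar>k z\<bar> * (\<integral>\<^sup>+x. norm (f (x - z)) \<partial>lborel)"
      by (simp add: ennreal_mult nn_integral_cmult)
    also have "(\<integral>\<^sup>+x. ennreal (norm (f (x - z))) \<partial>lborel) = (\<integral>\<^sup>+x. norm (f x) \<partial>lborel)"
      by (rule nn_integral_lborel_translate[where F="\<lambda>x. ennreal (norm (f x))"]) measurable
    finally show "(\<integral>\<^sup>+x. ennreal (norm (k z *\<^sub>R f (x - z))) \<partial>lborel) = ennreal \<bar>k z\<bar> * (\<integral>\<^sup>+x. norm (f x) \<partial>lborel)" .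
  qed
  also have "\<dots> = (\<integral>\<^sup>+z. ennreal \<bar>k z\<bar> \<partial>lborel) * (\<integral>\<^sup>+x. norm (f x) \<partial>lborel)"
    by (rule nn_integral_multc) measurable
  finally show ?thesis .
qed

lemma integrable_conv_Young:
  fixes f :: "'a::euclidean_space \<Rightarrow> 'b::{banach, second_countable_topology}"
  assumes k: "integrable lborel k" and f: "integrable lborel f"
  shows "integrable lborel (conv k f)"
proof -
  have m: "k \<in> borel_measurable borel" "f \<in> borel_measurable borel"
    using k f by (auto dest: borel_measurable_integrable)
  have "(\<integral>\<^sup>+z. ennreal \<bar>k z\<bar> \<partial>lborel) * (\<integral>\<^sup>+x. norm (f x) \<partial>lborel) < \<infinity>"
    using k f unfolding integrable_iff_bounded by (simp add: ennreal_mult_less_top)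
  then show ?thesis
    using nn_integral_conv_le[OF m] measurable_conv[OF m] unfolding integrable_iff_bounded by simp
qed

definition mollifier_on :: "(real^'n) set \<Rightarrow> (real^'n \<Rightarrow> real) \<Rightarrow> bool" where
  "mollifier_on S k \<longleftrightarrow> kernel_on S k \<and> (\<forall>z. 0 \<le> k z) \<and> (LINT z|lborel. k z) = 1"

text \<open>The difference \<open>conv k f - f\<close> is an average of translation differences of \<open>f\<close>, over
  translations within the support of \<open>k\<close>.\<close>

lemma conv_mollifier_L1_small:
  fixes f :: "real^'n \<Rightarrow> 'b::{banach, second_countable_topology}"
  assumes f: "integrable lborel f" and e: "e > 0"
  obtains r where "r > 0" "\<And>k S. mollifier_on S k \<Longrightarrow> S \<subseteq> ball 0 r \<Longrightarrow>
     (LINT x|lborel. norm (conv k f x - f x)) \<le> e"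
proof -
  obtain r where r: "r > 0" "\<And>h. norm h < r \<Longrightarrow> translation_modulus f h < e"
    using translation_modulus_small[OF f e] by blast
  have [measurable]: "f \<in> borel_measurable borel" using borel_measurable_integrable[OF f] by simp
  show ?thesis
  proof (rule that[OF r(1)])
    fix k and S :: "(real^'n) set" assume k: "mollifier_on S k" and S: "S \<subseteq> ball 0 r"
    then have kS: "kernel_on S k" and k0: "\<And>z. 0 \<le> k z" and k1: "(LINT z|lborel. k z) = 1"
      by (auto simp: mollifier_on_def)
    have [measurable]: "k \<in> borel_measurable borel" by (rule kernel_onD(8)[OF kS])
    have ki: "integrable lborel k" by (rule kernel_on_integrable(1)[OF kS])
    have "norm (conv k f x - f x) \<le> (\<integral>\<^sup>+z. ennreal (k z * norm (f (x - z) - f x)) \<partial>lborel)" for x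
    proof -
      have i: "integrable lborel (\<lambda>z. k z *\<^sub>R f (x - z))"
        using integrable_lborel_reflect[OF integrable_conv[OF f kS, of x], of x] by simp
      have "conv k f x - f x = (LINT z|lborel. k z *\<^sub>R f (x - z)) - (LINT z|lborel. k z *\<^sub>R f x)"
        using ki k1 by (simp add: conv_eq)
      also have "\<dots> = (LINT z|lborel. k z *\<^sub>R (f (x - z) - f x))"
        using ki i by (simp add: scaleR_diff_right)
      finally have "ennreal (norm (conv k f x - f x)) \<le> (\<integral>\<^sup>+z. norm (k z *\<^sub>R (f (x - z) - f x)) \<partial>lborel)"
        by (simp only: norm_integral_le_nn_integral)
      then show ?thesis using k0 by simp
    qed
    then have "(\<integral>\<^sup>+x. norm (conv k f x - f x) \<partial>lborel) \<le> (\<integral>\<^sup>+x. \<integral>\<^sup>+z. ennreal (k z * norm (f (x - z) - f x)) \<partial>lborel \<partial>lborel)"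
      by (intro nn_integral_mono) simp
    also have "\<dots> = (\<integral>\<^sup>+z. \<integral>\<^sup>+x. ennreal (k z * norm (f (x - z) - f x)) \<partial>lborel \<partial>lborel)"
      by (intro lborel_pair.Fubini') measurable
    also have "\<dots> \<le> (\<integral>\<^sup>+z. ennreal (k z) * ennreal e \<partial>lborel)"
    proof (intro nn_integral_mono)
      fix z
      show "(\<integral>\<^sup>+x. ennreal (k z * norm (f (x - z) - f x)) \<partial>lborel) \<le> ennreal (k z) * ennreal e"
      proof (cases "z \<in> S")
        case True
        have "(\<integral>\<^sup>+x. ennreal (k z * norm (f (x - z) - f x)) \<partial>lborel)
            = ennreal (k z) * (\<integral>\<^sup>+x. ennreal (norm (f (x - z) - f x)) \<partial>lborel)"
          using k0 by (simp add: ennreal_mult nn_integral_cmult)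
        also have "(\<integral>\<^sup>+x. ennreal (norm (f (x - z) - f x)) \<partial>lborel) = ennreal (translation_modulus f z)"
          unfolding translation_modulus_def
          by (rule nn_integral_eq_integral) (use f integrable_lborel_translate[OF f] in auto)
        also have "\<dots> \<le> ennreal e"
          using r(2)[of z] True S by (intro ennreal_leI less_imp_le) auto
        finally show ?thesis by (simp add: mult_left_mono)
      next
        case False
        then show ?thesis using kernel_onD(3)[OF kS] by simp
      qed
    qed
    also have "\<dots> = ennreal e"
      using nn_integral_eq_integral[OF ki] k0 k1 by (simp add: nn_integral_multc)
    finally have *: "(\<integral>\<^sup>+x. norm (conv k f x - f x) \<partial>lborel) \<le> ennreal e" .
    have "integrable lborel (\<lambda>x. norm (conv k f x - f x))"
      using integrable_conv_Young[OF ki f] f by auto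
    then have "ennreal (LINT x|lborel. norm (conv k f x - f x)) \<le> ennreal e"
      using * by (subst nn_integral_eq_integral[symmetric]) auto
    then show "(LINT x|lborel. norm (conv k f x - f x)) \<le> e"
      using e by (simp add: integral_nonneg)
  qed
qed

lemma conv_mollifier_L1_tendsto:
  fixes f :: "real^'n \<Rightarrow> 'b::{banach, second_countable_topology}"
  assumes f: "integrable lborel f"
    and k: "\<And>n. mollifier_on (S n) (k n)" "\<And>n. S n \<subseteq> cball 0 (r n)" "r \<longlonglongrightarrow> 0"
  shows "(\<lambda>n. LINT x|lborel. norm (conv (k n) f x - f x)) \<longlonglongrightarrow> 0"
proof (rule LIMSEQ_I)
  fix e :: real assume e: "e > 0"
  then obtain d where d: "d > 0" "\<And>k S. mollifier_on S k \<Longrightarrow> S \<subseteq> ball 0 d \<Longrightarrow>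
     (LINT x|lborel. norm (conv k f x - f x)) \<le> e / 2"
    using conv_mollifier_L1_small[OF f, of "e / 2"] by auto
  obtain N where N: "\<And>n. n \<ge> N \<Longrightarrow> \<bar>r n\<bar> < d"
    using LIMSEQ_D[OF k(3) d(1)] by auto
  have "norm ((LINT x|lborel. norm (conv (k n) f x - f x)) - 0) < e" if "n \<ge> N" for n
  proof -
    have "S n \<subseteq> ball 0 d" using k(2)[of n] N[OF that] by (auto simp: subset_iff)
    from d(2)[OF k(1) this] have "(LINT x|lborel. norm (conv (k n) f x - f x)) \<le> e / 2" .
    then show ?thesis using e by (simp add: integral_nonneg)
  qed
  then show "\<exists>N. \<forall>n\<ge>N. norm ((LINT x|lborel. norm (conv (k n) f x - f x)) - 0) < e" by blast
qed

text \<open>Dominated convergence with dominating functions that vary but converge in \<open>L\<^sup>1\<close>: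
  below the limit \<open>D\<close> the usual theorem applies, and what exceeds \<open>D\<close> is at most \<open>\<bar>D\<^sub>n - D\<bar>\<close>.\<close>

lemma generalized_dominated_convergence_0:
  fixes F D' :: "nat \<Rightarrow> 'a \<Rightarrow> real"
  assumes [measurable]: "\<And>n. F n \<in> borel_measurable M"
    and D: "integrable M D" "\<And>n. integrable M (D' n)" "(\<lambda>n. LINT x|M. norm (D' n x - D x)) \<longlonglongrightarrow> 0"
    and F: "\<And>n. AE x in M. 0 \<le> F n x \<and> F n x \<le> D' n x" "AE x in M. (\<lambda>n. F n x) \<longlonglongrightarrow> 0"
  shows "(\<lambda>n. LINT x|M. F n x) \<longlonglongrightarrow> 0"
proof -
  have [measurable]: "D \<in> borel_measurable M" using D(1) by auto
  have Fi: "integrable M (F n)" for n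
    using F(1)[of n]
    by (intro Bochner_Integration.integrable_bound[OF D(2)[of n]]) (auto elim: eventually_mono)
  have mi: "integrable M (\<lambda>x. min (F n x) \<bar>D x\<bar>)" for n
    using Fi D(1) by auto
  have "(\<lambda>n. LINT x|M. min (F n x) \<bar>D x\<bar>) \<longlonglongrightarrow> (LINT x|M. (0::real))"
  proof (rule integral_dominated_convergence[where w="\<lambda>x. \<bar>D x\<bar>"])
    show "AE x in M. (\<lambda>n. min (F n x) \<bar>D x\<bar>) \<longlonglongrightarrow> 0"
      using F(2)
    proof eventually_elim
      case (elim x)
      have "(\<lambda>n. min (F n x) \<bar>D x\<bar>) \<longlonglongrightarrow> min 0 \<bar>D x\<bar>" by (intro tendsto_intros elim)
      then show ?case by simp
    qed
    show "AE x in M. norm (min (F n x) \<bar>D x\<bar>) \<le> \<bar>D x\<bar>" for n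
      using F(1)[of n] by eventually_elim (auto simp: min_def)
  qed (use D mi in auto)
  then have lim: "(\<lambda>n. (LINT x|M. min (F n x) \<bar>D x\<bar>) + (LINT x|M. norm (D' n x - D x))) \<longlonglongrightarrow> 0"
    using tendsto_add[OF _ D(3), of _ 0] by simp
  have le: "(LINT x|M. F n x) \<le> (LINT x|M. min (F n x) \<bar>D x\<bar>) + (LINT x|M. norm (D' n x - D x))" for n
  proof -
    have "(LINT x|M. F n x) \<le> (LINT x|M. min (F n x) \<bar>D x\<bar> + norm (D' n x - D x))"
    proof (rule integral_mono_AE)
      show "AE x in M. F n x \<le> min (F n x) \<bar>D x\<bar> + norm (D' n x - D x)"
        using F(1)[of n] by eventually_elim (auto simp: min_def)
    qed (use Fi mi D(1,2) in auto)
    then show ?thesis using mi D(1,2) by simp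
  qed
  have nonneg: "0 \<le> (LINT x|M. F n x)" for n
    using F(1)[of n] by (intro integral_nonneg_AE) (auto elim: eventually_mono)
  show ?thesis
    by (rule tendsto_sandwich[OF always_eventually[OF allI[OF nonneg]] always_eventually[OF allI[OF le]]
          tendsto_const lim])
qed

section \<open>Weak gradients and functions vanishing on the boundary\<close>

text \<open>Measurability on products and the translation of measures are simplest for Borel functions,
  so representatives with respect to the Lebesgue measure are replaced by Borel ones.\<close>

lemma borel_representative_real:
  fixes h :: "'a::euclidean_space \<Rightarrow> real"
  assumes "integrable lebesgue h"
  obtains h' where "integrable lborel h'" "AE x in lebesgue. h x = h' x"
proof -
  obtain h' where h': "h' \<in> borel_measurable lborel" "AE x in lborel. h x = h' x"
    using completion_ex_borel_measurable_real[OF borel_measurable_integrable[OF assms]] by blast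
  have ae: "AE x in lebesgue. h x = h' x" by (rule AE_completion[OF h'(2)])
  have "integrable lebesgue h'"
    using assms integrable_cong_AE[OF borel_measurable_integrable[OF assms] measurable_completion[OF h'(1)] ae]
    by blast
  then have "integrable lborel h'" using integrable_completion[OF h'(1)] by simp
  with ae that show ?thesis by blast
qed

lemma borel_representative_vec:
  fixes h :: "real^'n \<Rightarrow> real^'n"
  assumes "integrable lebesgue h"
  obtains h' where "integrable lborel h'" "AE x in lebesgue. h x = h' x"
proof -
  have "\<exists>h'. integrable lborel h' \<and> (AE x in lebesgue. h x $ i = h' x)" for i
    using borel_representative_real[OF integrable_bounded_linear[OF bounded_linear_vec_nth assms, of i]] by blast
  then obtain h' where h': "\<And>i. integrable lborel (h' i)" "\<And>i. AE x in lebesgue. h x $ i = h' i x"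
    by metis
  define H where "H x = (\<Sum>i\<in>UNIV. h' i x *\<^sub>R axis i (1::real))" for x
  have "integrable lborel H"
    unfolding H_def by (intro Bochner_Integration.integrable_sum integrable_scaleR_left impI h'(1))
  moreover have "AE x in lebesgue. \<forall>i. h x $ i = h' i x"
    using h'(2) by (simp add: AE_all_countable)
  then have "AE x in lebesgue. h x = H x"
  proof eventually_elim
    case (elim x)
    have "h x = (\<Sum>i\<in>UNIV. h x $ i *\<^sub>R axis i 1)"
      by (simp add: basis_expansion scalar_mult_eq_scaleR[symmetric])
    then show ?case using elim by (simp add: H_def)
  qed
  ultimately show ?thesis using that by blast
qed

lemma integral_lebesgue_eq_lborel:
  fixes f h :: "'a::euclidean_space \<Rightarrow> real"
  assumes h: "h \<in> borel_measurable borel" and ae: "AE x in lebesgue. f x = h x"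
  shows "(LINT x|lebesgue. f x) = (LINT x|lborel. h x)"
proof -
  have hm: "h \<in> borel_measurable lebesgue" using h by (simp add: measurable_completion)
  have "f \<in> borel_measurable lebesgue"
    by (rule borel_measurable_AE[OF hm]) (use ae in eventually_elim, simp)
  then have "(LINT x|lebesgue. f x) = (LINT x|lebesgue. h x)"
    by (rule integral_cong_AE[OF _ hm ae])
  also have "\<dots> = (LINT x|lborel. h x)" by (rule integral_completion) (use h in simp)
  finally show ?thesis .
qed

lemma AE_lborel_if_lebesgue:
  "(AE x in lebesgue. P x) \<Longrightarrow> (AE x in lborel. P x)"
proof -
  assume "AE x in lebesgue. P x"
  then obtain N N' where "{x. \<not> P x} \<subseteq> N" "N' \<in> null_sets lborel" "N \<subseteq> N'"
    by (auto simp: eventually_ae_filter null_sets_completion_iff2)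
  then show "AE x in lborel. P x"
    by (intro AE_I'[of N']) auto
qed

definition locally_integrable :: "'a::euclidean_space set \<Rightarrow> ('a \<Rightarrow> 'b::euclidean_space) \<Rightarrow> bool" where
  "locally_integrable \<Omega> f \<longleftrightarrow> (\<forall>K. compact K \<and> K \<subseteq> \<Omega> \<longrightarrow> f absolutely_integrable_on K)"

lemma locally_integrable_mult:
  fixes f :: "'a::euclidean_space \<Rightarrow> real"
  assumes f: "locally_integrable \<Omega> f" and w: "continuous_on UNIV w" "compact K" "K \<subseteq> \<Omega>" "\<And>x. x \<notin> K \<Longrightarrow> w x = 0"
  shows "set_integrable lebesgue \<Omega> (\<lambda>x. f x * w x)"
proof -
  obtain B where B: "\<And>z. norm (w z) \<le> B" using bounded_of_compact_support[OF w(1,2,4)] by blast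
  have fK: "integrable lebesgue (\<lambda>x. indicator K x *\<^sub>R f x)"
    using f w(2,3) by (simp add: locally_integrable_def set_integrable_def)
  have wm: "w \<in> borel_measurable lebesgue"
    using borel_measurable_continuous_onI[OF w(1)] by (simp add: measurable_completion)
  have "integrable lebesgue (\<lambda>x. (indicator K x *\<^sub>R f x) * w x)"
  proof (rule Bochner_Integration.integrable_bound[where f="\<lambda>x. B * norm (indicator K x *\<^sub>R f x)"])
    show "(\<lambda>x. (indicator K x *\<^sub>R f x) * w x) \<in> borel_measurable lebesgue"
      using borel_measurable_integrable[OF fK] wm by (rule borel_measurable_times)
    show "AE x in lebesgue. norm ((indicator K x *\<^sub>R f x) * w x) \<le> norm (B * norm (indicator K x *\<^sub>R f x))"
    proof (rule AE_I2)
      fix x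
      have "\<bar>w x\<bar> \<le> \<bar>B\<bar>" using B[of x] by simp
      then show "norm ((indicator K x *\<^sub>R f x) * w x) \<le> norm (B * norm (indicator K x *\<^sub>R f x))"
        unfolding norm_mult by (subst mult.commute) (simp add: mult_right_mono)
    qed
  qed (use fK in auto)
  also have "(\<lambda>x. (indicator K x *\<^sub>R f x) * w x) = (\<lambda>x. indicator \<Omega> x *\<^sub>R (f x * w x))"
    using w(3,4) by (auto simp: indicator_def fun_eq_iff)
  finally show ?thesis by (simp add: set_integrable_def)
qed

lemma locally_integrable_nth:
  fixes g :: "real^'n \<Rightarrow> real^'n"
  assumes "locally_integrable \<Omega> g"
  shows "locally_integrable \<Omega> (\<lambda>x. g x $ i)"
  unfolding locally_integrable_def
proof (intro allI impI)
  fix K assume "compact K \<and> K \<subseteq> \<Omega>"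
  then have "integrable lebesgue (\<lambda>x. indicator K x *\<^sub>R g x)"
    using assms by (simp add: locally_integrable_def set_integrable_def)
  from integrable_bounded_linear[OF bounded_linear_vec_nth this]
  show "(\<lambda>x. g x $ i) absolutely_integrable_on K" by (simp add: set_integrable_def)
qed

lemma Cc_infinityD:
  assumes "u \<in> Cc_infinity \<Omega>"
  shows "kernel_on (closure {x. u x \<noteq> 0}) u" "closure {x. u x \<noteq> 0} \<subseteq> \<Omega>" "C_k k u"
    "compact (closure {x. u x \<noteq> 0})"
  using assms closure_subset[of "{x. u x \<noteq> 0}"] by (auto simp: Cc_infinity_def kernel_on_def simp del: C_k.simps)

lemma Cc_infinityI:
  assumes "\<And>k. C_k k u" "compact S" "S \<subseteq> \<Omega>" "\<And>x. x \<notin> S \<Longrightarrow> u x = 0"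
  shows "u \<in> Cc_infinity \<Omega>"
proof -
  have "closure {x. u x \<noteq> 0} \<subseteq> S"
    using assms(2,4) by (intro closure_minimal compact_imp_closed) auto
  moreover have "compact (S \<inter> closure {x. u x \<noteq> 0})"
    using assms(2) by (rule compact_Int_closed) simp
  ultimately have "compact (closure {x. u x \<noteq> 0})" "closure {x. u x \<noteq> 0} \<subseteq> \<Omega>"
    using assms(3) by (simp_all add: Int_absorb1) 
  then show ?thesis using assms(1) by (simp add: Cc_infinity_def del: C_k.simps)
qed

lemma smooth_mollifier_exists:
  assumes "r > 0"
  obtains k :: "real^'n \<Rightarrow> real" and S where "mollifier_on S k" "S \<subseteq> ball 0 r" "\<And>j. C_k j k"
proof -
  obtain k :: "real \<Rightarrow> real^'n \<Rightarrow> real" where k: "\<And>s j. C_k j (k s)" "\<And>s z. s > 0 \<Longrightarrow> 0 \<le> k s z"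
    "\<And>s z. s > 0 \<Longrightarrow> z \<notin> (\<lambda>w. s *\<^sub>R w) ` cball 0 1 \<Longrightarrow> k s z = 0"
    "\<And>s. s > 0 \<Longrightarrow> (LINT z|lborel. k s z) = 1"
    by (rule directed_kernels[of 1 "0 :: real^'n"]) (simp, rule that)
  let ?S = "(\<lambda>w. (r/2) *\<^sub>R w) ` cball (0::real^'n) 1"
  have "mollifier_on ?S (k (r/2))"
    using assms k by (auto simp: mollifier_on_def kernel_on_def compact_scaling simp del: C_k.simps)
  moreover have "?S \<subseteq> ball 0 r"
  proof
    fix z assume "z \<in> ?S"
    then obtain w where w: "z = (r/2) *\<^sub>R w" "w \<in> cball 0 1" by (rule imageE)
    then have "norm w \<le> 1" by simp
    have "r / 2 * norm w \<le> r / 2 * 1" using \<open>norm w \<le> 1\<close> assms by (intro mult_left_mono) auto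
    then show "z \<in> ball 0 r" using w assms by simp
  qed
  ultimately show ?thesis using that k(1) by blast
qed

text \<open>Near \<open>z\<close> the reflected and translated mollifiers are test functions on \<open>\<Omega>\<close>, so the
  mollifications of \<open>f\<close> vanish there, and so does their limit in \<open>L\<^sup>1\<close>.\<close>

lemma vanishes_near_point:
  fixes f :: "real^'n \<Rightarrow> real"
  assumes f: "locally_integrable \<Omega> f"
    and zero: "\<And>u. u \<in> Cc_infinity \<Omega> \<Longrightarrow> (LINT x:\<Omega>|lebesgue. f x * u x) = 0"
    and r: "r > 0" "cball z (2 * r) \<subseteq> \<Omega>"
  shows "AE x in lebesgue. x \<in> ball z r \<longrightarrow> f x = 0"
proof -
  let ?B = "cball z (2 * r)"
  have fi: "integrable lebesgue (\<lambda>x. indicator ?B x *\<^sub>R f x)"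
    using f r(2) by (simp add: locally_integrable_def set_integrable_def)
  then obtain F where F: "integrable lborel F" "AE x in lebesgue. indicator ?B x *\<^sub>R f x = F x"
    using borel_representative_real by blast
  have Fm: "F \<in> borel_measurable borel" using borel_measurable_integrable[OF F(1)] by simp
  have conv0: "conv k F x = 0" if k: "mollifier_on S k" "S \<subseteq> ball 0 r" "\<And>j. C_k j k" and x: "x \<in> ball z r" for k S x
  proof -
    have kS: "kernel_on S k" using k(1) by (simp add: mollifier_on_def)
    let ?u = "\<lambda>y. k (x - y)"
    have u0: "?u y = 0" if "y \<notin> (\<lambda>w. x - w) ` S" for y
    proof -
      have "x - y \<notin> S" using that image_eqI[of y "\<lambda>w. x - w" "x - y" S] by auto
      then show ?thesis by (rule kernel_onD(3)[OF kS])
    qed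
    have sub: "(\<lambda>w. x - w) ` S \<subseteq> ?B"
    proof
      fix y assume "y \<in> (\<lambda>w. x - w) ` S"
      then obtain w where w: "y = x - w" "norm w < r" using k(2) by auto
      from w(1) have "z - y = (z - x) + w" by simp
      then have "norm (z - y) \<le> norm (z - x) + norm w" by (simp only: norm_triangle_ineq)
      then show "y \<in> ?B" using x w(2) by (simp add: dist_norm)
    qed
    have "?u \<in> Cc_infinity \<Omega>"
    proof (rule Cc_infinityI[where S="(\<lambda>w. x - w) ` S"])
      show "compact ((\<lambda>w. x - w) ` S)"
        by (intro compact_continuous_image continuous_intros kernel_onD(1)[OF kS])
      show "(\<lambda>w. x - w) ` S \<subseteq> \<Omega>" using sub r(2) by blast
    qed (auto intro: C_k_reflect k(3) u0)
    then have "0 = (LINT y:\<Omega>|lebesgue. f y * ?u y)" using zero by simp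
    also have "\<dots> = (LINT y|lebesgue. k (x - y) * (indicator ?B y *\<^sub>R f y))"
      unfolding set_lebesgue_integral_def
    proof (rule Bochner_Integration.integral_cong[OF refl])
      fix y
      show "indicator \<Omega> y *\<^sub>R (f y * k (x - y)) = k (x - y) * (indicator ?B y *\<^sub>R f y)"
      proof (cases "y \<in> ?B")
        case True then show ?thesis using r(2) by (auto simp: indicator_def)
      next
        case False
        then have "y \<notin> (\<lambda>w. x - w) ` S" using sub by blast
        from u0[OF this] show ?thesis by simp
      qed
    qed
    also have "\<dots> = (LINT y|lborel. k (x - y) * F y)"
    proof (rule integral_lebesgue_eq_lborel)
      show "(\<lambda>y. k (x - y) * F y) \<in> borel_measurable borel"
        using Fm kernel_onD(8)[OF kS] by measurable
      show "AE y in lebesgue. k (x - y) * (indicator ?B y *\<^sub>R f y) = k (x - y) * F y"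
        using F(2) by eventually_elim simp
    qed
    finally show ?thesis by (simp add: conv_def)
  qed
  have small: "(LINT x|lborel. indicator (ball z r) x * \<bar>F x\<bar>) \<le> e" if e: "e > 0" for e
  proof -
    obtain d where d: "d > 0" "\<And>k S. mollifier_on S k \<Longrightarrow> S \<subseteq> ball 0 d \<Longrightarrow>
       (LINT x|lborel. norm (conv k F x - F x)) \<le> e"
      using conv_mollifier_L1_small[OF F(1) e] by blast
    have "min d r > 0" using d(1) r(1) by simp
    then obtain k :: "real^'n \<Rightarrow> real" and S where k: "mollifier_on S k" "S \<subseteq> ball 0 (min d r)" "\<And>j. C_k j k"
      by (rule smooth_mollifier_exists) (rule that)
    have sub: "S \<subseteq> ball 0 d" "S \<subseteq> ball 0 r" using k(2) by auto
    have ki: "integrable lborel k" using k(1) by (auto simp: mollifier_on_def intro: kernel_on_integrable)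
    have "(LINT x|lborel. indicator (ball z r) x * \<bar>F x\<bar>) \<le> (LINT x|lborel. norm (conv k F x - F x))"
    proof (rule integral_mono)
      show "integrable lborel (\<lambda>x. indicator (ball z r) x * \<bar>F x\<bar>)"
        using integrable_mult_indicator[of "ball z r" lborel "\<lambda>x. \<bar>F x\<bar>"] F(1) by simp
      show "integrable lborel (\<lambda>x. norm (conv k F x - F x))"
        using integrable_conv_Young[OF ki F(1)] F(1) by auto
      show "indicator (ball z r) x * \<bar>F x\<bar> \<le> norm (conv k F x - F x)" for x
        using conv0[OF k(1) sub(2) k(3), of x] by (simp add: indicator_def)
    qed
    also have "\<dots> \<le> e" by (rule d(2)[OF k(1) sub(1)])
    finally show ?thesis .
  qed
  have "(LINT x|lborel. indicator (ball z r) x * \<bar>F x\<bar>) = 0"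
  proof (rule antisym)
    show "(LINT x|lborel. indicator (ball z r) x * \<bar>F x\<bar>) \<le> 0"
      by (rule field_le_epsilon) (use small in simp)
  qed (simp add: integral_nonneg)
  moreover have "integrable lborel (\<lambda>x. indicator (ball z r) x * \<bar>F x\<bar>)"
    using integrable_mult_indicator[of "ball z r" lborel "\<lambda>x. \<bar>F x\<bar>"] F(1) by simp
  ultimately have "AE x in lborel. indicator (ball z r) x * \<bar>F x\<bar> = 0"
    by (subst (asm) integral_nonneg_eq_0_iff_AE) auto
  then have "AE x in lebesgue. indicator (ball z r) x * \<bar>F x\<bar> = 0" by (rule AE_completion)
  with F(2) show ?thesis
  proof eventually_elim
    case (elim x)
    show ?case
    proof
      assume x: "x \<in> ball z r"
      then have "x \<in> ?B" using r(1) by auto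
      with elim x show "f x = 0" by (simp add: indicator_def)
    qed
  qed
qed

text \<open>The fundamental lemma of the calculus of variations: countably many of the balls of the
  previous lemma cover \<open>\<Omega>\<close>.\<close>

lemma vanishes_if_orthogonal_to_test_functions:
  fixes f :: "real^'n \<Rightarrow> real"
  assumes "open \<Omega>" and f: "locally_integrable \<Omega> f"
    and zero: "\<And>u. u \<in> Cc_infinity \<Omega> \<Longrightarrow> (LINT x:\<Omega>|lebesgue. f x * u x) = 0"
  shows "AE x in lebesgue. x \<in> \<Omega> \<longrightarrow> f x = 0"
proof -
  let ?F = "{ball z r | z r. r > 0 \<and> cball z (2 * r) \<subseteq> \<Omega>}"
  obtain F' where F': "F' \<subseteq> ?F" "countable F'" "\<Union>F' = \<Union>?F"
    by (rule Lindelof[of ?F]) auto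
  have cover: "\<Omega> \<subseteq> \<Union>?F"
  proof
    fix x assume "x \<in> \<Omega>"
    then obtain e where "e > 0" "cball x e \<subseteq> \<Omega>"
      using open_contains_cball \<open>open \<Omega>\<close> by blast
    then have "ball x (e/2) \<in> ?F" "x \<in> ball x (e/2)"
      by (auto intro!: exI[of _ x] exI[of _ "e/2"])
    then show "x \<in> \<Union>?F" by blast
  qed
  have "AE x in lebesgue. \<forall>b\<in>F'. x \<in> b \<longrightarrow> f x = 0"
    unfolding AE_ball_countable[OF F'(2)]
  proof
    fix b assume "b \<in> F'"
    then obtain z r where b: "b = ball z r" "r > 0" "cball z (2 * r) \<subseteq> \<Omega>" using F'(1) by blast
    show "AE x in lebesgue. x \<in> b \<longrightarrow> f x = 0"
      unfolding b(1) by (rule vanishes_near_point[OF f zero b(2,3)])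
  qed
  then show ?thesis
  proof eventually_elim
    case (elim x)
    show ?case
    proof
      assume "x \<in> \<Omega>"
      then have "x \<in> \<Union>F'" unfolding F'(3) by (rule subsetD[OF cover])
      then show "f x = 0" using elim by (elim UnionE) (drule (1) bspec, erule (1) mp)
    qed
  qed
qed

lemma has_weak_gradientD:
  assumes "has_weak_gradient \<Omega> f g"
  shows "locally_integrable \<Omega> f" "locally_integrable \<Omega> g"
    "\<And>u i. u \<in> Cc_infinity \<Omega> \<Longrightarrow>
        (LINT x:\<Omega>|lebesgue. f x * grad u x $ i) = - (LINT x:\<Omega>|lebesgue. g x $ i * u x)"
  using assms by (auto simp: has_weak_gradient_def locally_integrable_def)

lemma set_integrable_times_test:
  fixes f :: "real^'n \<Rightarrow> real"
  assumes "locally_integrable \<Omega> f" "u \<in> Cc_infinity \<Omega>"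
  shows "set_integrable lebesgue \<Omega> (\<lambda>x. f x * u x)"
    "set_integrable lebesgue \<Omega> (\<lambda>x. f x * grad u x $ i)"
proof -
  note u = Cc_infinityD[OF assms(2)] and k = kernel_onD[OF Cc_infinityD(1)[OF assms(2)]]
  show "set_integrable lebesgue \<Omega> (\<lambda>x. f x * u x)"
    by (rule locally_integrable_mult[OF assms(1) k(4,1) u(2) k(3)])
  show "set_integrable lebesgue \<Omega> (\<lambda>x. f x * grad u x $ i)"
    by (rule locally_integrable_mult[OF assms(1) _ k(1) u(2)])
      (auto intro!: continuous_intros k(5) simp: k(7))
qed

lemma weak_gradient_unique:
  assumes "open \<Omega>" and g: "has_weak_gradient \<Omega> f g" "has_weak_gradient \<Omega> f g'"
  shows "AE x in lebesgue. x \<in> \<Omega> \<longrightarrow> g x = g' x"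
proof -
  have "AE x in lebesgue. x \<in> \<Omega> \<longrightarrow> g x $ i - g' x $ i = 0" for i
  proof (rule vanishes_if_orthogonal_to_test_functions[OF \<open>open \<Omega>\<close>])
    note l = locally_integrable_nth[OF has_weak_gradientD(2)[OF g(1)], of i]
      locally_integrable_nth[OF has_weak_gradientD(2)[OF g(2)], of i]
    show "locally_integrable \<Omega> (\<lambda>x. g x $ i - g' x $ i)"
      using l unfolding locally_integrable_def by (auto intro: set_integral_diff(1))
    fix u assume u: "u \<in> Cc_infinity \<Omega>"
    have "(LINT x:\<Omega>|lebesgue. (g x $ i - g' x $ i) * u x) =
      (LINT x:\<Omega>|lebesgue. g x $ i * u x) - (LINT x:\<Omega>|lebesgue. g' x $ i * u x)"
      unfolding left_diff_distrib
      by (intro set_integral_diff(2) set_integrable_times_test(1) l u)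
    also have "\<dots> = 0"
      using has_weak_gradientD(3)[OF g(1) u, of i] has_weak_gradientD(3)[OF g(2) u, of i] by simp
    finally show "(LINT x:\<Omega>|lebesgue. (g x $ i - g' x $ i) * u x) = 0" .
  qed
  then have "AE x in lebesgue. \<forall>i. x \<in> \<Omega> \<longrightarrow> g x $ i - g' x $ i = 0"
    by (subst AE_all_countable) blast
  then show ?thesis by eventually_elim (simp add: vec_eq_iff)
qed

lemma continuous_locally_integrable:
  fixes f :: "'a::euclidean_space \<Rightarrow> 'b::euclidean_space"
  assumes "continuous_on UNIV f"
  shows "locally_integrable \<Omega> f"
  unfolding locally_integrable_def
proof (intro allI impI)
  fix K assume "compact K \<and> K \<subseteq> \<Omega>"
  then have *: "integrable lborel (\<lambda>x. indicator K x *\<^sub>R f x)"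
    using assms by (intro borel_integrable_compact) (auto intro: continuous_on_subset)
  then show "f absolutely_integrable_on K"
    using integrable_completion[OF borel_measurable_integrable[OF *]] * by (simp add: set_integrable_def)
qed

text \<open>Together with uniqueness this identifies the weak gradient that enters the norm of
  \<open>v - f\<close>, although it is only chosen by its defining property.\<close>

lemma has_weak_gradient_diff_test:
  fixes f :: "real^'n \<Rightarrow> real"
  assumes g: "has_weak_gradient \<Omega> f g" and v: "v \<in> Cc_infinity \<Omega>"
  shows "has_weak_gradient \<Omega> (\<lambda>x. v x - f x) (\<lambda>x. grad v x - g x)"
proof -
  note kv = kernel_onD[OF Cc_infinityD(1)[OF v]]
  have lv: "locally_integrable \<Omega> v" "locally_integrable \<Omega> (grad v)"
    using kv(4,5) by (auto intro: continuous_locally_integrable)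
  note lf = has_weak_gradientD(1,2)[OF g]
  have "locally_integrable \<Omega> (\<lambda>x. v x - f x)" "locally_integrable \<Omega> (\<lambda>x. grad v x - g x)"
    using lv lf unfolding locally_integrable_def by (auto intro: set_integral_diff(1))
  moreover have "(LINT x:\<Omega>|lebesgue. (v x - f x) * grad u x $ i) = - (LINT x:\<Omega>|lebesgue. (grad v x - g x) $ i * u x)"
    if u: "u \<in> Cc_infinity \<Omega>" for u i
  proof -
    note ku = kernel_onD[OF Cc_infinityD(1)[OF u]] and su = Cc_infinityD(2)[OF u]
    have off: "u x = 0" "grad u x = 0" if "x \<notin> \<Omega>" for x
      using ku(3)[of x] ku(7)[of x] su that by blast+
    have full: "(LINT x:\<Omega>|lebesgue. h x) = (LINT x|lborel. h x)"
      if "continuous_on UNIV h" "\<And>x. x \<notin> \<Omega> \<Longrightarrow> h x = 0" for h :: "real^'n \<Rightarrow> real"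
    proof -
      have "(LINT x:\<Omega>|lebesgue. h x) = (LINT x|lebesgue. h x)"
        unfolding set_lebesgue_integral_def using that(2)
        by (intro Bochner_Integration.integral_cong) (auto simp: indicator_def)
      also have "\<dots> = (LINT x|lborel. h x)"
        using that(1) by (intro integral_completion) (auto intro: borel_measurable_continuous_onI)
      finally show ?thesis .
    qed
    have "(LINT x:\<Omega>|lebesgue. v x * grad u x $ i) = (LINT x|lborel. v x * grad u x $ i)"
      by (rule full) (intro continuous_intros kv(4) ku(5), simp add: off)
    also have "\<dots> = - (LINT x|lborel. grad v x $ i * u x)"
      by (rule integration_by_parts[OF Cc_infinityD(1)[OF v]]) (rule Cc_infinityD(3)[OF u])
    also have "(LINT x|lborel. grad v x $ i * u x) = (LINT x:\<Omega>|lebesgue. grad v x $ i * u x)"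
      by (rule full[symmetric]) (intro continuous_intros kv(5) ku(4), simp add: off)
    finally have 1: "(LINT x:\<Omega>|lebesgue. v x * grad u x $ i) = - (LINT x:\<Omega>|lebesgue. grad v x $ i * u x)" .
    have "(LINT x:\<Omega>|lebesgue. (v x - f x) * grad u x $ i)
       = (LINT x:\<Omega>|lebesgue. v x * grad u x $ i) - (LINT x:\<Omega>|lebesgue. f x * grad u x $ i)"
      unfolding left_diff_distrib
      by (intro set_integral_diff(2) set_integrable_times_test(2) lv lf u)
    moreover have "(LINT x:\<Omega>|lebesgue. (grad v x - g x) $ i * u x)
       = (LINT x:\<Omega>|lebesgue. grad v x $ i * u x) - (LINT x:\<Omega>|lebesgue. g x $ i * u x)"
      unfolding left_diff_distrib vector_minus_component
      by (intro set_integral_diff(2) set_integrable_times_test(1) locally_integrable_nth lv lf u)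
    ultimately show ?thesis using 1 has_weak_gradientD(3)[OF g u, of i] by simp
  qed
  ultimately show ?thesis unfolding has_weak_gradient_def locally_integrable_def by blast
qed

text \<open>The working form of \<open>W\<^sup>1\<^sup>,\<^sup>1\<^sub>0\<close>: Borel representatives on the whole space, extended by
  zero, that are limits of continuously differentiable functions with compact support in
  \<open>\<Omega>\<close> together with their gradients. All rules of calculus below are obtained from the
  approximants.\<close>

definition sobolev0 :: "(real^'n) set \<Rightarrow> (real^'n \<Rightarrow> real) \<Rightarrow> (real^'n \<Rightarrow> real^'n) \<Rightarrow> bool" where
  "sobolev0 \<Omega> f G \<longleftrightarrow> integrable lborel f \<and> integrable lborel G \<and>
     (\<forall>x. x \<notin> \<Omega> \<longrightarrow> f x = 0 \<and> G x = 0) \<and>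
     (\<exists>u. (\<forall>k. \<exists>S\<subseteq>\<Omega>. kernel_on S (u k)) \<and>
        (\<lambda>k. LINT x|lborel. norm (u k x - f x)) \<longlonglongrightarrow> 0 \<and>
        (\<lambda>k. LINT x|lborel. norm (grad (u k) x - G x)) \<longlonglongrightarrow> 0)"

lemma W11_0_sobolev0:
  fixes \<phi> :: "real^'n \<Rightarrow> real"
  assumes \<Omega>: "open \<Omega>" and \<phi>: "\<phi> \<in> W11_0 \<Omega>"
  obtains f G where "sobolev0 \<Omega> f G" "AE x in lebesgue. x \<in> \<Omega> \<longrightarrow> \<phi> x = f x"
    "AE x in lebesgue. x \<in> \<Omega> \<longrightarrow> weak_grad \<Omega> \<phi> x = G x"
proof -
  let ?g = "weak_grad \<Omega> \<phi>"
  obtain u where u: "\<And>k. u k \<in> Cc_infinity \<Omega>" "(\<lambda>k. W11_norm \<Omega> (\<lambda>x. u k x - \<phi> x)) \<longlonglongrightarrow> 0"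
    and W: "\<phi> \<in> W11 \<Omega>"
    using \<phi> by (auto simp: W11_0_def)
  have \<phi>i: "\<phi> absolutely_integrable_on \<Omega>" and gi: "?g absolutely_integrable_on \<Omega>"
    and wg: "has_weak_gradient \<Omega> \<phi> ?g"
    using W someI_ex[of "has_weak_gradient \<Omega> \<phi>"] by (auto simp: W11_def weak_grad_def)
  obtain f0 where f0: "integrable lborel f0" "AE x in lebesgue. indicator \<Omega> x *\<^sub>R \<phi> x = f0 x"
    using \<phi>i borel_representative_real unfolding set_integrable_def by blast
  obtain G0 where G0: "integrable lborel G0" "AE x in lebesgue. indicator \<Omega> x *\<^sub>R ?g x = G0 x"
    using gi borel_representative_vec unfolding set_integrable_def by blast
  define f where "f x = indicator \<Omega> x *\<^sub>R f0 x" for x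
  define G where "G x = indicator \<Omega> x *\<^sub>R G0 x" for x
  have fi: "integrable lborel f" and Gi: "integrable lborel G"
    unfolding f_def G_def using \<Omega> by (intro integrable_mult_indicator f0(1) G0(1); simp)+
  have zero: "f x = 0" "G x = 0" if "x \<notin> \<Omega>" for x using that by (auto simp: f_def G_def)
  have aef: "AE x in lebesgue. x \<in> \<Omega> \<longrightarrow> \<phi> x = f x" 
    using f0(2) by eventually_elim (auto simp: f_def)
  have aeG: "AE x in lebesgue. x \<in> \<Omega> \<longrightarrow> ?g x = G x" 
    using G0(2) by eventually_elim (auto simp: G_def)
  let ?a = "\<lambda>k. LINT x|lborel. norm (u k x - f x)" and ?b = "\<lambda>k. LINT x|lborel. norm (grad (u k) x - G x)"
  have norm: "W11_norm \<Omega> (\<lambda>x. u k x - \<phi> x) = ?a k + ?b k" for k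
  proof -
    note ku = kernel_onD[OF Cc_infinityD(1)[OF u(1)[of k]]] and su = Cc_infinityD(2)[OF u(1)[of k]]
    have wd: "has_weak_gradient \<Omega> (\<lambda>x. u k x - \<phi> x) (\<lambda>x. grad (u k) x - ?g x)"
      by (rule has_weak_gradient_diff_test[OF wg u(1)])
    then have "has_weak_gradient \<Omega> (\<lambda>x. u k x - \<phi> x) (weak_grad \<Omega> (\<lambda>x. u k x - \<phi> x))"
      unfolding weak_grad_def[of \<Omega> "\<lambda>x. u k x - \<phi> x"] by (rule someI[of "has_weak_gradient \<Omega> (\<lambda>x. u k x - \<phi> x)"])
    from weak_gradient_unique[OF \<Omega> this wd]
    have ae: "AE x in lebesgue. x \<in> \<Omega> \<longrightarrow> weak_grad \<Omega> (\<lambda>x. u k x - \<phi> x) x = grad (u k) x - ?g x" .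
    have wdl: "locally_integrable \<Omega> (weak_grad \<Omega> (\<lambda>x. u k x - \<phi> x))"
      by (rule has_weak_gradientD(2)) fact
    have off: "u k x = 0" "grad (u k) x = 0" if "x \<notin> \<Omega>" for x
      using ku(3)[of x] ku(7)[of x] su that by blast+
    have mf: "(\<lambda>x. norm (u k x - f x)) \<in> borel_measurable borel"
      using ku(8) borel_measurable_integrable[OF fi] by simp
    have mG: "(\<lambda>x. norm (grad (u k) x - G x)) \<in> borel_measurable borel"
      using ku(9) borel_measurable_integrable[OF Gi] by simp
    have "(LINT x:\<Omega>|lebesgue. \<bar>u k x - \<phi> x\<bar>) = ?a k"
      unfolding set_lebesgue_integral_def
    proof (rule integral_lebesgue_eq_lborel[OF mf])
      show "AE x in lebesgue. indicator \<Omega> x *\<^sub>R \<bar>u k x - \<phi> x\<bar> = norm (u k x - f x)"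
        using aef by eventually_elim (use off zero in \<open>auto simp: indicator_def\<close>)
    qed
    note 1 = this
    have "(LINT x:\<Omega>|lebesgue. norm (weak_grad \<Omega> (\<lambda>x. u k x - \<phi> x) x)) = ?b k" (is "?l = _")
      unfolding set_lebesgue_integral_def
    proof (rule integral_lebesgue_eq_lborel[OF mG])
      show "AE x in lebesgue. indicator \<Omega> x *\<^sub>R norm (weak_grad \<Omega> (\<lambda>x. u k x - \<phi> x) x) = norm (grad (u k) x - G x)"
        using aeG ae by eventually_elim (use off zero in \<open>auto simp: indicator_def\<close>)
    qed
    with 1 show ?thesis by (simp add: W11_norm_def set_lebesgue_integral_def)
  qed
  have a0: "0 \<le> ?a k" and b0: "0 \<le> ?b k" for k by (simp_all add: integral_nonneg)
  have ab: "(\<lambda>k. ?a k + ?b k) \<longlonglongrightarrow> 0" using u(2) by (simp only: norm)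
  have "norm (?a k) \<le> norm (?a k + ?b k) * 1" "norm (?b k) \<le> norm (?a k + ?b k) * 1" for k
    using a0[of k] b0[of k] by simp_all
  from tendsto_0_le[OF ab always_eventually[OF allI[OF this(1)]]]
    tendsto_0_le[OF ab always_eventually[OF allI[OF this(2)]]]
  have "?a \<longlonglongrightarrow> 0" "?b \<longlonglongrightarrow> 0" .
  moreover have "\<exists>S\<subseteq>\<Omega>. kernel_on S (u k)" for k
    using Cc_infinityD(1,2)[OF u(1)[of k]] by blast
  ultimately have "sobolev0 \<Omega> f G"
    unfolding sobolev0_def using fi Gi zero by blast
  with aef aeG that show ?thesis by blast
qed

section \<open>Calculus of functions vanishing on the boundary\<close>

lemma sobolev0D:
  assumes "sobolev0 \<Omega> f G"
  shows "integrable lborel f" "integrable lborel G" "\<And>x. x \<notin> \<Omega> \<Longrightarrow> f x = 0" "\<And>x. x \<notin> \<Omega> \<Longrightarrow> G x = 0"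
    "f \<in> borel_measurable borel" "G \<in> borel_measurable borel"
proof -
  show 1: "integrable lborel f" "integrable lborel G" "\<And>x. x \<notin> \<Omega> \<Longrightarrow> f x = 0" "\<And>x. x \<notin> \<Omega> \<Longrightarrow> G x = 0"
    using assms by (simp_all add: sobolev0_def)
  show "f \<in> borel_measurable borel" "G \<in> borel_measurable borel"
    using borel_measurable_integrable[OF 1(1)] borel_measurable_integrable[OF 1(2)] by simp_all
qed

lemma tendsto_0_squeeze:
  fixes a b :: "nat \<Rightarrow> real"
  assumes "b \<longlonglongrightarrow> 0" "\<And>n. 0 \<le> a n" "\<And>n. a n \<le> b n"
  shows "a \<longlonglongrightarrow> 0"
  by (rule tendsto_sandwich[OF always_eventually[OF allI[OF assms(2)]] always_eventually[OF allI[OF assms(3)]]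
        tendsto_const assms(1)])

lemma sobolev0I:
  assumes "integrable lborel f" "integrable lborel G" "\<And>x. x \<notin> \<Omega> \<Longrightarrow> f x = 0" "\<And>x. x \<notin> \<Omega> \<Longrightarrow> G x = 0"
    and "\<And>n. S n \<subseteq> \<Omega>" "\<And>n. kernel_on (S n) (u n)"
    and "a \<longlonglongrightarrow> 0" "\<And>n. (LINT x|lborel. norm (u n x - f x)) \<le> a n"
    and "b \<longlonglongrightarrow> 0" "\<And>n. (LINT x|lborel. norm (grad (u n) x - G x)) \<le> b n"
  shows "sobolev0 \<Omega> f G"
  unfolding sobolev0_def
proof (intro conjI allI impI exI[of _ u])
  show "(\<lambda>k. LINT x|lborel. norm (u k x - f x)) \<longlonglongrightarrow> 0"
    by (rule tendsto_0_squeeze[OF assms(7) _ assms(8)]) (simp add: integral_nonneg)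
  show "(\<lambda>k. LINT x|lborel. norm (grad (u k) x - G x)) \<longlonglongrightarrow> 0"
    by (rule tendsto_0_squeeze[OF assms(9) _ assms(10)]) (simp add: integral_nonneg)
  show "\<exists>S\<subseteq>\<Omega>. kernel_on S (u k)" for k using assms(5,6) by blast
qed (fact assms)+

lemma sobolev0_approx:
  fixes f :: "real^'n \<Rightarrow> real"
  assumes "sobolev0 \<Omega> f G"
  obtains S u where "\<And>n::nat. S n \<subseteq> \<Omega>" "\<And>n. kernel_on (S n) (u n)"
    "(\<lambda>n. LINT x|lborel. norm (u n x - f x)) \<longlonglongrightarrow> 0"
    "(\<lambda>n. LINT x|lborel. norm (grad (u n) x - G x)) \<longlonglongrightarrow> 0"
    "AE x in lborel. (\<lambda>n. u n x) \<longlonglongrightarrow> f x"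
proof -
  obtain v where v: "\<forall>k. \<exists>S\<subseteq>\<Omega>. kernel_on S (v k)" "(\<lambda>k. LINT x|lborel. norm (v k x - f x)) \<longlonglongrightarrow> 0"
      "(\<lambda>k. LINT x|lborel. norm (grad (v k) x - G x)) \<longlonglongrightarrow> 0"
    using assms by (auto simp: sobolev0_def)
  from v(1) obtain S where S: "\<And>k. S k \<subseteq> \<Omega>" "\<And>k. kernel_on (S k) (v k)" by metis
  have "integrable lborel (\<lambda>x. v n x - f x)" for n
    by (intro Bochner_Integration.integrable_diff kernel_on_integrable(1)[OF S(2)] sobolev0D(1)[OF assms])
  from tendsto_L1_AE_subseq[OF this v(2)] obtain r where r: "strict_mono r" "AE x in lborel. (\<lambda>n. v (r n) x - f x) \<longlonglongrightarrow> 0"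
    by blast
  show ?thesis
  proof (rule that[where S="\<lambda>n. S (r n)" and u="\<lambda>n. v (r n)"])
    show "(\<lambda>n. LINT x|lborel. norm (v (r n) x - f x)) \<longlonglongrightarrow> 0"
      using LIMSEQ_subseq_LIMSEQ[OF v(2) r(1)] by (simp add: comp_def)
    show "(\<lambda>n. LINT x|lborel. norm (grad (v (r n)) x - G x)) \<longlonglongrightarrow> 0"
      using LIMSEQ_subseq_LIMSEQ[OF v(3) r(1)] by (simp add: comp_def)
    show "AE x in lborel. (\<lambda>n. v (r n) x) \<longlonglongrightarrow> f x"
      using r(2) by eventually_elim (simp add: LIM_zero_iff)
  qed (rule S)+
qed

lemma integrable_scaleR_bounded_function:
  fixes G :: "'a::euclidean_space \<Rightarrow> 'b::{banach, second_countable_topology}"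
  assumes "integrable lborel G" "w \<in> borel_measurable borel" "\<And>x. \<bar>w x\<bar> \<le> B"
  shows "integrable lborel (\<lambda>x. w x *\<^sub>R G x)"
proof (rule Bochner_Integration.integrable_bound[where f="\<lambda>x. B * norm (G x)"])
  show "(\<lambda>x. w x *\<^sub>R G x) \<in> borel_measurable lborel"
    using assms(2) borel_measurable_integrable[OF assms(1)] by (auto intro: borel_measurable_scaleR)
  show "AE x in lborel. norm (w x *\<^sub>R G x) \<le> norm (B * norm (G x))"
  proof (rule AE_I2)
    fix x
    have "\<bar>w x\<bar> \<le> \<bar>B\<bar>" using assms(3)[of x] by linarith
    then show "norm (w x *\<^sub>R G x) \<le> norm (B * norm (G x))" by (simp add: abs_mult mult_right_mono)
  qed
qed (use assms(1) in auto)

lemma C_k_1I: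
  assumes "\<And>x. (f has_derivative (\<lambda>h. g x \<bullet> h)) (at x)" "continuous_on UNIV g"
  shows "C_k 1 (f :: real^'n \<Rightarrow> real)" "grad f = g"
proof -
  show "grad f = g" using grad_eqI[OF assms(1)] by (rule ext)
  then show "C_k 1 f"
    using assms by (auto simp: differentiable_on_def differentiable_def intro!: continuous_intros)
qed

lemma lipschitz_of_bounded_deriv:
  fixes h :: "real \<Rightarrow> real"
  assumes "\<And>t. (h has_real_derivative h' t) (at t)" "\<And>t. \<bar>h' t\<bar> \<le> B"
  shows "\<bar>h s - h t\<bar> \<le> B * \<bar>s - t\<bar>"
  using field_differentiable_bound[of UNIV h h' B s t] assms by (simp add: has_field_derivative_at_within)

text \<open>The chain rule for the approximants passes to the limit: the Lipschitz bound controls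
  \<open>h (u n) - h f\<close>, and the derivatives \<open>h' (u n)\<close> converge boundedly along a subsequence on which
  \<open>u n\<close> converges almost everywhere.\<close>

lemma sobolev0_chain:
  fixes f :: "real^'n \<Rightarrow> real"
  assumes W: "sobolev0 \<Omega> f G"
    and h: "\<And>t. (h has_real_derivative h' t) (at t)" "continuous_on UNIV h'" "\<And>t. \<bar>h' t\<bar> \<le> B" "h 0 = 0"
  shows "sobolev0 \<Omega> (\<lambda>x. h (f x)) (\<lambda>x. h' (f x) *\<^sub>R G x)"
proof -
  note fG = sobolev0D[OF W]
  have hm: "h \<in> borel_measurable borel" "h' \<in> borel_measurable borel"
    using h(1,2) by (auto intro!: borel_measurable_continuous_onI continuous_at_imp_continuous_on DERIV_isCont)
  have B: "B \<ge> 0" using h(3)[of 0] by linarith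
  have lip: "\<bar>h s - h t\<bar> \<le> B * \<bar>s - t\<bar>" for s t by (rule lipschitz_of_bounded_deriv[OF h(1,3)])
  obtain S u where u: "\<And>n::nat. S n \<subseteq> \<Omega>" "\<And>n. kernel_on (S n) (u n)"
    "(\<lambda>n. LINT x|lborel. norm (u n x - f x)) \<longlonglongrightarrow> 0"
    "(\<lambda>n. LINT x|lborel. norm (grad (u n) x - G x)) \<longlonglongrightarrow> 0"
    "AE x in lborel. (\<lambda>n. u n x) \<longlonglongrightarrow> f x"
    by (rule sobolev0_approx[OF W]) (rule that)
  have hu: "C_k 1 (\<lambda>x. h (u n x))" "grad (\<lambda>x. h (u n x)) = (\<lambda>x. h' (u n x) *\<^sub>R grad (u n) x)" for n
  proof -
    note k = kernel_onD[OF u(2)[of n]]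
    have 1: "((\<lambda>x. h (u n x)) has_derivative (\<lambda>v. (h' (u n x) *\<^sub>R grad (u n) x) \<bullet> v)) (at x)" for x
      by (rule has_derivative_compose_real[OF h(1) k(6)])
    have 2: "continuous_on UNIV (\<lambda>x. h' (u n x) *\<^sub>R grad (u n) x)"
      by (intro continuous_intros k(5) continuous_on_compose2[OF h(2) k(4)]) simp
    show "C_k 1 (\<lambda>x. h (u n x))" "grad (\<lambda>x. h (u n x)) = (\<lambda>x. h' (u n x) *\<^sub>R grad (u n) x)"
      using C_k_1I[OF 1 2] by blast+
  qed
  have um: "u n \<in> borel_measurable borel" "grad (u n) \<in> borel_measurable borel" for n
    using kernel_onD(8,9)[OF u(2)] .
  have ui: "integrable lborel (u n)" "integrable lborel (grad (u n))" for n
    using kernel_on_integrable[OF u(2)] .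
  have hfm: "(\<lambda>x. h' (f x)) \<in> borel_measurable borel" "(\<lambda>x. h (f x)) \<in> borel_measurable borel"
    "(\<lambda>x. h' (u n x)) \<in> borel_measurable borel" "(\<lambda>x. h (u n x)) \<in> borel_measurable borel" for n
    using hm fG(5) um(1) by (auto intro: measurable_compose)
  have hfi: "integrable lborel (\<lambda>x. h (f x))"
  proof (rule Bochner_Integration.integrable_bound[where f="\<lambda>x. B * f x"])
    show "AE x in lborel. norm (h (f x)) \<le> norm (B * f x)"
      using lip[of "f _" 0] h(4) B by (auto simp: abs_mult)
  qed (use fG(1) hfm(2) in auto)
  have hGi: "integrable lborel (\<lambda>x. h' (f x) *\<^sub>R G x)"
    by (rule integrable_scaleR_bounded_function[OF fG(2) hfm(1) h(3)])
  let ?c = "\<lambda>n. LINT x|lborel. norm ((h' (u n x) - h' (f x)) *\<^sub>R G x)"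
  have dom: "norm ((h' (u n x) - h' (f x)) *\<^sub>R G x) \<le> 2 * B * norm (G x)" for n x
  proof -
    have "\<bar>h' (u n x) - h' (f x)\<bar> \<le> 2 * B" using h(3)[of "u n x"] h(3)[of "f x"] by linarith
    then show ?thesis by (simp add: mult_right_mono)
  qed
  have dm: "(\<lambda>x. (h' (u n x) - h' (f x)) *\<^sub>R G x) \<in> borel_measurable borel" for n
    using hfm fG(6) by (intro borel_measurable_scaleR borel_measurable_diff)
  have di: "integrable lborel (\<lambda>x. norm ((h' (u n x) - h' (f x)) *\<^sub>R G x))" for n
  proof (rule integrable_norm, rule Bochner_Integration.integrable_bound[where f="\<lambda>x. 2 * B * norm (G x)"])
    show "(\<lambda>x. (h' (u n x) - h' (f x)) *\<^sub>R G x) \<in> borel_measurable lborel" using dm by simp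
    show "AE x in lborel. norm ((h' (u n x) - h' (f x)) *\<^sub>R G x) \<le> norm (2 * B * norm (G x))"
      by (intro AE_I2 order_trans[OF dom]) simp
  qed (use fG(2) in auto)
  have "?c \<longlonglongrightarrow> (LINT x::real^'n|lborel. (0::real))"
  proof (rule integral_dominated_convergence[where w="\<lambda>x. 2 * B * norm (G x)"])
    show "AE x in lborel. (\<lambda>n. norm ((h' (u n x) - h' (f x)) *\<^sub>R G x)) \<longlonglongrightarrow> 0"
      using u(5)
    proof eventually_elim
      case (elim x)
      have "(\<lambda>n. h' (u n x)) \<longlonglongrightarrow> h' (f x)"
        using h(2) elim by (intro isCont_tendsto_compose[of _ h']) (auto simp: continuous_on_eq_continuous_at)
      then have "(\<lambda>n. norm ((h' (u n x) - h' (f x)) *\<^sub>R G x)) \<longlonglongrightarrow> norm ((h' (f x) - h' (f x)) *\<^sub>R G x)"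
        by (intro tendsto_intros)
      then show ?case by simp
    qed
    show "AE x in lborel. norm (norm ((h' (u n x) - h' (f x)) *\<^sub>R G x)) \<le> 2 * B * norm (G x)" for n
      using dom by simp
  qed (use fG(2) di in auto)
  then have c0: "?c \<longlonglongrightarrow> 0" by simp
  show ?thesis
  proof (rule sobolev0I[where S=S and u="\<lambda>n x. h (u n x)" and a="\<lambda>n. B * (LINT x|lborel. norm (u n x - f x))"
        and b="\<lambda>n. B * (LINT x|lborel. norm (grad (u n) x - G x)) + ?c n"])
    show "kernel_on (S n) (\<lambda>x. h (u n x))" for n
      using hu(1)[of n] kernel_onD(1,3)[OF u(2)[of n]] h(4) by (simp add: kernel_on_def del: C_k.simps)
    show "(\<lambda>n. B * (LINT x|lborel. norm (u n x - f x))) \<longlonglongrightarrow> 0"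
      using tendsto_mult_left[OF u(3), of B] by simp
    show "(\<lambda>n. B * (LINT x|lborel. norm (grad (u n) x - G x)) + ?c n) \<longlonglongrightarrow> 0"
      using tendsto_add[OF tendsto_mult_left[OF u(4), of B] c0] by simp
    fix n
    have hui: "integrable lborel (\<lambda>x. h (u n x))"
    proof (rule Bochner_Integration.integrable_bound[where f="\<lambda>x. B * u n x"])
      show "AE x in lborel. norm (h (u n x)) \<le> norm (B * u n x)"
        using lip[of "u n _" 0] h(4) B by (auto simp: abs_mult)
    qed (use ui(1) hfm(4) in auto)
    have "(LINT x|lborel. norm (h (u n x) - h (f x))) \<le> (LINT x|lborel. B * norm (u n x - f x))"
      using lip by (intro integral_mono) (use hui hfi ui(1)[of n] fG(1) in auto)
    then show "(LINT x|lborel. norm (h (u n x) - h (f x))) \<le> B * (LINT x|lborel. norm (u n x - f x))" by simp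
    have i1: "integrable lborel (\<lambda>x. norm (h' (u n x) *\<^sub>R grad (u n) x - h' (f x) *\<^sub>R G x))"
      using integrable_scaleR_bounded_function[OF ui(2)[of n] hfm(3)[of n] h(3)] hGi by auto
    have i2: "integrable lborel (\<lambda>x. B * norm (grad (u n) x - G x))" using ui(2)[of n] fG(2) by auto
    have "(LINT x|lborel. norm (h' (u n x) *\<^sub>R grad (u n) x - h' (f x) *\<^sub>R G x))
       \<le> (LINT x|lborel. B * norm (grad (u n) x - G x) + norm ((h' (u n x) - h' (f x)) *\<^sub>R G x))"
    proof (rule integral_mono[OF i1 Bochner_Integration.integrable_add[OF i2 di]])
      fix x
      have "h' (u n x) *\<^sub>R grad (u n) x - h' (f x) *\<^sub>R G x = h' (u n x) *\<^sub>R (grad (u n) x - G x) + (h' (u n x) - h' (f x)) *\<^sub>R G x"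
        by (simp add: algebra_simps)
      also have "norm \<dots> \<le> norm (h' (u n x) *\<^sub>R (grad (u n) x - G x)) + norm ((h' (u n x) - h' (f x)) *\<^sub>R G x)"
        by (rule norm_triangle_ineq)
      also have "norm (h' (u n x) *\<^sub>R (grad (u n) x - G x)) \<le> B * norm (grad (u n) x - G x)"
        using h(3)[of "u n x"] by (simp add: mult_right_mono)
      finally show "norm (h' (u n x) *\<^sub>R grad (u n) x - h' (f x) *\<^sub>R G x)
        \<le> B * norm (grad (u n) x - G x) + norm ((h' (u n x) - h' (f x)) *\<^sub>R G x)" by simp
    qed
    also have "\<dots> = B * (LINT x|lborel. norm (grad (u n) x - G x)) + ?c n"
      using Bochner_Integration.integral_add[OF i2 di[of n]] by simp
    finally show "(LINT x|lborel. norm (grad (\<lambda>x. h (u n x)) x - h' (f x) *\<^sub>R G x))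
      \<le> B * (LINT x|lborel. norm (grad (u n) x - G x)) + ?c n" by (simp only: hu(2))
  qed (use hfi hGi fG(3,4) h(4) u(1) in auto)
qed

lemma sobolev0_mult:
  fixes f \<theta> :: "real^'n \<Rightarrow> real"
  assumes W: "sobolev0 \<Omega> f G"
    and \<theta>: "C_k 1 \<theta>" "\<And>x. \<bar>\<theta> x\<bar> \<le> T" "\<And>x. norm (grad \<theta> x) \<le> D"
  shows "sobolev0 \<Omega> (\<lambda>x. \<theta> x * f x) (\<lambda>x. \<theta> x *\<^sub>R G x + f x *\<^sub>R grad \<theta> x)"
proof -
  note fG = sobolev0D[OF W]
  note \<theta>' = \<theta>(1)[unfolded One_nat_def]
  have \<theta>m: "\<theta> \<in> borel_measurable borel" "grad \<theta> \<in> borel_measurable borel"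
    using continuous_C_k[OF \<theta>(1)] continuous_grad[OF \<theta>'] by (auto intro: borel_measurable_continuous_onI)
  have gint: "integrable lborel (\<lambda>x. w x *\<^sub>R grad \<theta> x)" if "integrable lborel w" for w :: "real^'n \<Rightarrow> real"
  proof (rule Bochner_Integration.integrable_bound[where f="\<lambda>x. D * w x"])
    show "(\<lambda>x. w x *\<^sub>R grad \<theta> x) \<in> borel_measurable lborel"
      using borel_measurable_integrable[OF that] \<theta>m by (intro borel_measurable_scaleR) auto
    show "AE x in lborel. norm (w x *\<^sub>R grad \<theta> x) \<le> norm (D * w x)"
    proof (rule AE_I2)
      fix x
      have "norm (grad \<theta> x) \<le> \<bar>D\<bar>" using \<theta>(3)[of x] by linarith
      then show "norm (w x *\<^sub>R grad \<theta> x) \<le> norm (D * w x)"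
        by (simp add: abs_mult mult.commute[of "\<bar>D\<bar>"] mult_left_mono)
    qed
  qed (use that in auto)
  have tint: "integrable lborel (\<lambda>x. \<theta> x *\<^sub>R w x)" if "integrable lborel w" for w :: "real^'n \<Rightarrow> 'b::{banach, second_countable_topology}"
    by (rule integrable_scaleR_bounded_function[OF that \<theta>m(1) \<theta>(2)])
  obtain S u where u: "\<And>n::nat. S n \<subseteq> \<Omega>" "\<And>n. kernel_on (S n) (u n)"
    "(\<lambda>n. LINT x|lborel. norm (u n x - f x)) \<longlonglongrightarrow> 0"
    "(\<lambda>n. LINT x|lborel. norm (grad (u n) x - G x)) \<longlonglongrightarrow> 0"
    "AE x in lborel. (\<lambda>n. u n x) \<longlonglongrightarrow> f x"
    by (rule sobolev0_approx[OF W]) (rule that)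
  have ui: "integrable lborel (u n)" "integrable lborel (grad (u n))" for n
    using kernel_on_integrable[OF u(2)] .
  let ?a = "\<lambda>n. LINT x|lborel. norm (u n x - f x)" and ?b = "\<lambda>n. LINT x|lborel. norm (grad (u n) x - G x)"
  have i1: "integrable lborel (\<lambda>x. norm (u n x - f x))" "integrable lborel (\<lambda>x. norm (grad (u n) x - G x))" for n
    using ui[of n] fG(1,2) by auto
  have fi: "integrable lborel (\<lambda>x. \<theta> x * f x)" using tint[OF fG(1)] by simp
  have Gi: "integrable lborel (\<lambda>x. \<theta> x *\<^sub>R G x + f x *\<^sub>R grad \<theta> x)"
    using tint[OF fG(2)] gint[OF fG(1)] by auto
  show ?thesis
  proof (rule sobolev0I[where S=S and u="\<lambda>n x. u n x * \<theta> x" and a="\<lambda>n. T * ?a n" and b="\<lambda>n. T * ?b n + D * ?a n"])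
    show "kernel_on (S n) (\<lambda>x. u n x * \<theta> x)" for n by (rule kernel_on_mult[OF u(2) \<theta>(1)])
    show "(\<lambda>n. T * ?a n) \<longlonglongrightarrow> 0" using tendsto_mult_left[OF u(3), of T] by simp
    show "(\<lambda>n. T * ?b n + D * ?a n) \<longlonglongrightarrow> 0"
      using tendsto_add[OF tendsto_mult_left[OF u(4), of T] tendsto_mult_left[OF u(3), of D]] by simp
    fix n
    have gu: "grad (\<lambda>x. u n x * \<theta> x) x = u n x *\<^sub>R grad \<theta> x + \<theta> x *\<^sub>R grad (u n) x" for x
      by (rule grad_mult[OF kernel_onD(6)[OF u(2)] C_k_differentiable[OF \<theta>']])
    have "(LINT x|lborel. norm (u n x * \<theta> x - \<theta> x * f x)) \<le> (LINT x|lborel. T * norm (u n x - f x))"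
    proof (rule integral_mono)
      show "integrable lborel (\<lambda>x. norm (u n x * \<theta> x - \<theta> x * f x))"
        using tint[OF ui(1)[of n]] fi by (simp add: mult.commute)
      fix x
      have "u n x * \<theta> x - \<theta> x * f x = \<theta> x * (u n x - f x)" by (simp add: algebra_simps)
      then show "norm (u n x * \<theta> x - \<theta> x * f x) \<le> T * norm (u n x - f x)"
        using \<theta>(2)[of x] by (simp add: abs_mult mult_right_mono)
    qed (use i1 in auto)
    then show "(LINT x|lborel. norm (u n x * \<theta> x - \<theta> x * f x)) \<le> T * ?a n" by simp
    have "(LINT x|lborel. norm (grad (\<lambda>x. u n x * \<theta> x) x - (\<theta> x *\<^sub>R G x + f x *\<^sub>R grad \<theta> x)))
      \<le> (LINT x|lborel. T * norm (grad (u n) x - G x) + D * norm (u n x - f x))"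
      unfolding gu
    proof (rule integral_mono)
      show "integrable lborel (\<lambda>x. norm (u n x *\<^sub>R grad \<theta> x + \<theta> x *\<^sub>R grad (u n) x - (\<theta> x *\<^sub>R G x + f x *\<^sub>R grad \<theta> x)))"
        by (intro integrable_norm Bochner_Integration.integrable_diff Bochner_Integration.integrable_add tint gint ui fG(1,2))
      fix x
      have "u n x *\<^sub>R grad \<theta> x + \<theta> x *\<^sub>R grad (u n) x - (\<theta> x *\<^sub>R G x + f x *\<^sub>R grad \<theta> x)
        = \<theta> x *\<^sub>R (grad (u n) x - G x) + (u n x - f x) *\<^sub>R grad \<theta> x" by (simp add: algebra_simps)
      also have "norm \<dots> \<le> norm (\<theta> x *\<^sub>R (grad (u n) x - G x)) + norm ((u n x - f x) *\<^sub>R grad \<theta> x)"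
        by (rule norm_triangle_ineq)
      also have "\<dots> \<le> T * norm (grad (u n) x - G x) + D * norm (u n x - f x)"
        unfolding norm_scaleR mult.commute[of "\<bar>u n x - f x\<bar>"] real_norm_def
        by (intro add_mono mult_right_mono \<theta>) auto
      finally show "norm (u n x *\<^sub>R grad \<theta> x + \<theta> x *\<^sub>R grad (u n) x - (\<theta> x *\<^sub>R G x + f x *\<^sub>R grad \<theta> x))
        \<le> T * norm (grad (u n) x - G x) + D * norm (u n x - f x)" .
    qed (use i1 in auto)
    also have "\<dots> = T * ?b n + D * ?a n" using i1 by simp
    finally show "(LINT x|lborel. norm (grad (\<lambda>x. u n x * \<theta> x) x - (\<theta> x *\<^sub>R G x + f x *\<^sub>R grad \<theta> x)))
      \<le> T * ?b n + D * ?a n" .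
  qed (use fi Gi fG(3,4) u(1) in auto)
qed

lemma integral_norm_bound_scaled:
  fixes g :: "'a::euclidean_space \<Rightarrow> 'b::{banach, second_countable_topology}"
  assumes "integrable lborel g" "integrable lborel w" "\<And>y. norm (g y) \<le> w y"
  shows "norm (LINT y|lborel. g y) \<le> (LINT y|lborel. w y)"
  by (rule order_trans[OF integral_norm_bound integral_mono]) (use assms in auto)

text \<open>This holds on the whole space, across the boundary of \<open>\<Omega>\<close>: it is here that vanishing
  boundary values enter.\<close>

lemma sobolev0_grad_conv:
  fixes f :: "real^'n \<Rightarrow> real"
  assumes W: "sobolev0 \<Omega> f G" and k: "kernel_on S k"
  shows "grad (conv k f) x = conv k G x"
proof -
  note fG = sobolev0D[OF W] and k' = kernel_onD[OF k]
  obtain T u where u: "\<And>n::nat. T n \<subseteq> \<Omega>" "\<And>n. kernel_on (T n) (u n)"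
    "(\<lambda>n. LINT x|lborel. norm (u n x - f x)) \<longlonglongrightarrow> 0"
    "(\<lambda>n. LINT x|lborel. norm (grad (u n) x - G x)) \<longlonglongrightarrow> 0"
    "AE x in lborel. (\<lambda>n. u n x) \<longlonglongrightarrow> f x"
    by (rule sobolev0_approx[OF W]) (rule that)
  have ui: "integrable lborel (u n)" "integrable lborel (grad (u n))" for n
    using kernel_on_integrable[OF u(2)] .
  obtain B where B: "\<And>z. norm (k z) \<le> B" by (rule bounded_of_compact_support[OF k'(4,1,3)]) (assumption, rule that)
  obtain B' where B': "\<And>z. norm (grad k z) \<le> B'" by (rule bounded_of_compact_support[OF k'(5,1,7)]) (assumption, rule that)
  have 1: "norm (grad (conv k (u n)) x - grad (conv k f) x) \<le> B' * (LINT y|lborel. norm (u n y - f y))" for n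
  proof -
    have "grad (conv k (u n)) x - grad (conv k f) x = (LINT y|lborel. u n y *\<^sub>R grad k (x - y) - f y *\<^sub>R grad k (x - y))"
      using integrable_conv_grad[OF ui(1) k] integrable_conv_grad[OF fG(1) k]
      by (simp add: grad_conv[OF ui(1) k] grad_conv[OF fG(1) k])
    also have "norm \<dots> \<le> (LINT y|lborel. B' * norm (u n y - f y))"
    proof (rule integral_norm_bound_scaled)
      show "integrable lborel (\<lambda>y. u n y *\<^sub>R grad k (x - y) - f y *\<^sub>R grad k (x - y))"
        by (intro Bochner_Integration.integrable_diff integrable_conv_grad[OF _ k] ui fG)
      show "norm (u n y *\<^sub>R grad k (x - y) - f y *\<^sub>R grad k (x - y)) \<le> B' * norm (u n y - f y)" for y
        unfolding scaleR_left_diff_distrib[symmetric] norm_scaleR real_norm_def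
        by (subst mult.commute) (intro mult_right_mono B' abs_ge_zero)
    qed (use ui(1)[of n] fG(1) in auto)
    finally show ?thesis by simp
  qed
  have 2: "norm (conv k (grad (u n)) x - conv k G x) \<le> B * (LINT y|lborel. norm (grad (u n) y - G y))" for n
  proof -
    have "conv k (grad (u n)) x - conv k G x = (LINT y|lborel. k (x - y) *\<^sub>R grad (u n) y - k (x - y) *\<^sub>R G y)"
      using integrable_conv[OF ui(2) k] integrable_conv[OF fG(2) k] by (simp add: conv_def)
    also have "norm \<dots> \<le> (LINT y|lborel. B * norm (grad (u n) y - G y))"
    proof (rule integral_norm_bound_scaled)
      show "integrable lborel (\<lambda>y. k (x - y) *\<^sub>R grad (u n) y - k (x - y) *\<^sub>R G y)"
        by (intro Bochner_Integration.integrable_diff integrable_conv[OF _ k] ui fG)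
      show "norm (k (x - y) *\<^sub>R grad (u n) y - k (x - y) *\<^sub>R G y) \<le> B * norm (grad (u n) y - G y)" for y
        unfolding scaleR_right_diff_distrib[symmetric] norm_scaleR
        using B[of "x - y"] by (intro mult_right_mono) auto
    qed (use ui(2)[of n] fG(2) in auto)
    finally show ?thesis by simp
  qed
  have "(\<lambda>n. grad (conv k (u n)) x) \<longlonglongrightarrow> grad (conv k f) x"
    by (rule LIM_zero_cancel, rule tendsto_norm_zero_cancel,
        rule tendsto_0_squeeze[OF _ norm_ge_zero 1]) (use tendsto_mult_left[OF u(3), of B'] in simp)
  moreover have "(\<lambda>n. conv k (grad (u n)) x) \<longlonglongrightarrow> conv k G x"
    by (rule LIM_zero_cancel, rule tendsto_norm_zero_cancel,
        rule tendsto_0_squeeze[OF _ norm_ge_zero 2]) (use tendsto_mult_left[OF u(4), of B] in simp)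
  ultimately show ?thesis
    unfolding grad_conv_C1[OF u(2) k] by (rule LIMSEQ_unique)
qed

lemma sobolev0_cong:
  fixes f f' :: "real^'n \<Rightarrow> real"
  assumes W: "sobolev0 \<Omega> f G" and f': "f' \<in> borel_measurable borel" "AE x in lborel. f x = f' x" "\<And>x. x \<notin> \<Omega> \<Longrightarrow> f' x = 0"
  shows "sobolev0 \<Omega> f' G"
proof -
  note fG = sobolev0D[OF W]
  obtain S u where u: "\<And>n::nat. S n \<subseteq> \<Omega>" "\<And>n. kernel_on (S n) (u n)"
    "(\<lambda>n. LINT x|lborel. norm (u n x - f x)) \<longlonglongrightarrow> 0"
    "(\<lambda>n. LINT x|lborel. norm (grad (u n) x - G x)) \<longlonglongrightarrow> 0"
    "AE x in lborel. (\<lambda>n. u n x) \<longlonglongrightarrow> f x"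
    by (rule sobolev0_approx[OF W]) (rule that)
  have fm: "f \<in> borel_measurable lborel" "f' \<in> borel_measurable lborel" using fG(5) f'(1) by simp_all
  have fi: "integrable lborel f'" using integrable_cong_AE[OF fm f'(2)] fG(1) by blast
  have eq: "(LINT x|lborel. norm (u n x - f' x)) = (LINT x|lborel. norm (u n x - f x))" for n
  proof (rule integral_cong_AE)
    show "AE x in lborel. norm (u n x - f' x) = norm (u n x - f x)" using f'(2) by eventually_elim simp
  qed (use fm kernel_onD(8)[OF u(2)[of n]] in simp_all)
  show ?thesis
    by (rule sobolev0I[OF fi fG(2) f'(3) fG(4) u(1,2,3) _ u(4) order_refl]) (assumption, assumption, rule eq[THEN eq_refl])
qed

section \<open>Lipschitz domains: inward cones and cutoffs\<close>

lemma projection_along: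
  fixes e :: "'a::euclidean_space"
  assumes "norm e = 1"
  shows "(v - (v \<bullet> e) *\<^sub>R e) \<bullet> e = 0" "norm (v - (v \<bullet> e) *\<^sub>R e) \<le> norm v"
proof -
  have ee: "e \<bullet> e = 1" using assms by (simp add: norm_eq_1)
  show "(v - (v \<bullet> e) *\<^sub>R e) \<bullet> e = 0" by (simp add: inner_diff_left ee)
  have "(norm (v - (v \<bullet> e) *\<^sub>R e))\<^sup>2 = (norm v)\<^sup>2 - (v \<bullet> e)\<^sup>2"
    unfolding power2_norm_eq_inner
    by (simp add: inner_diff_left inner_diff_right ee inner_commute power2_eq_square)
  then have "(norm (v - (v \<bullet> e) *\<^sub>R e))\<^sup>2 \<le> (norm v)\<^sup>2" by simp
  then show "norm (v - (v \<bullet> e) *\<^sub>R e) \<le> norm v" by (rule power2_le_imp_le) simp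
qed

text \<open>Up to the boundary, \<open>\<Omega>\<close> contains a small cone around one direction \<open>e\<close>, the same for all base
  points near \<open>z\<close>. At a boundary point \<open>e\<close> is the axis of the chart, and a step \<open>s w\<close> with
  \<open>\<bar>w - e\<bar> \<le> \<kappa>\<close> raises the last coordinate by at least \<open>s (1 - \<kappa>)\<close> and the graph by at most \<open>s L \<kappa>\<close>.\<close>

lemma inward_cone:
  fixes \<Omega> :: "'a::euclidean_space set"
  assumes \<Omega>: "bounded_Lipschitz_domain \<Omega>" and z: "z \<in> closure \<Omega>"
  obtains r e \<kappa> s0 where "r > 0" "norm e = 1" "0 < \<kappa>" "\<kappa> \<le> 1" "s0 > 0"
    "\<And>y w s. y \<in> closure \<Omega> \<Longrightarrow> dist z y \<le> r \<Longrightarrow> dist e w \<le> \<kappa> \<Longrightarrow> 0 < s \<Longrightarrow> s \<le> s0 \<Longrightarrow> y + s *\<^sub>R w \<in> \<Omega>"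
proof -
  have near: "dist z (y + s *\<^sub>R w) < R"
    if "dist z y \<le> R / 2" "norm e = 1" "dist e w \<le> \<kappa>" "\<kappa> \<le> 1" "0 < s" "s \<le> R / 8" for y w e :: 'a and s R \<kappa> :: real
  proof -
    have "norm w \<le> 2" using that norm_triangle_ineq2[of w e] by (simp add: dist_norm norm_minus_commute)
    then have "norm (s *\<^sub>R w) \<le> R / 8 * 2"
      unfolding norm_scaleR using that by (intro mult_mono) auto
    then show ?thesis
      using that dist_triangle[of z "y + s *\<^sub>R w" y] by (simp add: dist_norm)
  qed
  show ?thesis
  proof (cases "z \<in> \<Omega>")
    case True
    have "open \<Omega>" using \<Omega> by (simp add: bounded_Lipschitz_domain_def)
    then obtain R where R: "R > 0" "ball z R \<subseteq> \<Omega>" using True open_contains_ball by blast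
    obtain e :: 'a where e: "norm e = 1" using norm_Basis SOME_Basis by blast
    show ?thesis
      by (rule that[of "R / 2" e 1 "R / 8"]) (use R(1) e in simp_all, rule subsetD[OF R(2)], simp add: near[OF _ e])
  next
    case False
    then have "z \<in> frontier \<Omega>" using z interior_subset by (auto simp: frontier_def)
    then obtain R e L g where R: "R > 0" and e: "norm e = 1" and g: "L-lipschitz_on {y. y \<bullet> e = 0} g"
      and chart: "\<Omega> \<inter> ball z R = {x \<in> ball z R. g (x - (x \<bullet> e) *\<^sub>R e) < x \<bullet> e}"
      using \<Omega> unfolding bounded_Lipschitz_domain_def by blast
    have L: "L \<ge> 0" using g by (rule lipschitz_on_nonneg)
    define P where "P v = v - (v \<bullet> e) *\<^sub>R e" for v
    have Pd: "P a - P b = P (a - b)" for a b by (simp add: P_def inner_diff_left algebra_simps)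
    have Pn: "norm (P v) \<le> norm v" for v unfolding P_def by (rule projection_along(2)[OF e])
    have gl: "g (P a) \<le> g (P b) + L * norm (P (a - b))" for a b
    proof -
      have "dist (g (P a)) (g (P b)) \<le> L * dist (P a) (P b)"
        by (rule lipschitz_onD[OF g]) (simp_all add: P_def projection_along(1)[OF e])
      then show ?thesis by (simp add: dist_norm Pd abs_le_iff)
    qed
    \<comment> \<open>Any \<open>\<kappa> < 1 / (L + 1)\<close> makes the gain \<open>1 - \<kappa>\<close> exceed the loss \<open>L \<kappa>\<close>.\<close>
    define \<kappa> where "\<kappa> = 1 / (L + 2)"
    have \<kappa>: "0 < \<kappa>" "\<kappa> \<le> 1" "1 - \<kappa> - L * \<kappa> > 0" using L by (simp_all add: \<kappa>_def field_simps)
    show ?thesis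
    proof (rule that[of "R / 2" e \<kappa> "R / 8"])
      fix y w s assume y: "y \<in> closure \<Omega>" "dist z y \<le> R / 2" and w: "dist e w \<le> \<kappa>" and s: "0 < s" "s \<le> R / 8"
      have yw: "y + s *\<^sub>R w \<in> ball z R" using near[OF y(2) e w \<kappa>(2) s] by simp
      define d where "d = min (R / 2) (s * (1 - \<kappa> - L * \<kappa>) / (2 * (L + 1)))"
      have d: "d > 0" using R s \<kappa> L by (simp add: d_def)
      have dL: "(L + 1) * d < s * (1 - \<kappa> - L * \<kappa>)"
      proof -
        have "(L + 1) * d \<le> (L + 1) * (s * (1 - \<kappa> - L * \<kappa>) / (2 * (L + 1)))"
          using L by (intro mult_left_mono) (auto simp: d_def)
        also have "\<dots> = s * (1 - \<kappa> - L * \<kappa>) / 2" using L by (simp add: field_simps)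
        also have "\<dots> < s * (1 - \<kappa> - L * \<kappa>)" using mult_pos_pos[OF s(1) \<kappa>(3)] by linarith
        finally show ?thesis .
      qed
      obtain x where x: "x \<in> \<Omega>" "dist x y < d" using y(1) d closure_approachable by blast
      have "dist z x < R" using x(2) y(2) dist_triangle[of z x y] by (simp add: d_def dist_commute)
      then have "x \<in> \<Omega> \<inter> ball z R" using x(1) by simp
      then have "g (P x) < x \<bullet> e" unfolding chart P_def by simp
      also have "x \<bullet> e \<le> y \<bullet> e + norm (x - y)"
        using norm_cauchy_schwarz[of "x - y" e] e by (simp add: inner_diff_left)
      finally have gx: "g (P x) < y \<bullet> e + norm (x - y)" .
      have xy: "norm (x - y) < d" "norm (y - x) < d" using x(2) by (simp_all add: dist_norm norm_minus_commute)
      have "g (P (y + s *\<^sub>R w)) \<le> g (P x) + L * norm (P (y + s *\<^sub>R w - x))" by (rule gl)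
      also have "norm (P (y + s *\<^sub>R w - x)) \<le> d + s * \<kappa>"
      proof -
        have "P (y + s *\<^sub>R w - x) = P (y - x) + s *\<^sub>R P (w - e)"
          using e by (simp add: P_def inner_diff_left inner_add_left norm_eq_1 algebra_simps)
        also have "norm \<dots> \<le> norm (y - x) + s * norm (w - e)"
          using s Pn by (intro norm_triangle_le add_mono) (auto simp: mult_left_mono)
        also have "\<dots> \<le> d + s * \<kappa>"
          using xy w s by (intro add_mono mult_left_mono) (auto simp: dist_norm norm_minus_commute)
        finally show ?thesis .
      qed
      finally have "g (P (y + s *\<^sub>R w)) < y \<bullet> e + d + L * (d + s * \<kappa>)"
        using gx xy L by (smt (verit) mult_left_mono)
      also have "\<dots> = y \<bullet> e + (L + 1) * d + s * L * \<kappa>" by (simp add: algebra_simps)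
      also have "\<dots> < y \<bullet> e + s * (1 - \<kappa>)" using dL by (simp add: algebra_simps)
      also have "\<dots> \<le> (y + s *\<^sub>R w) \<bullet> e"
      proof -
        have "w \<bullet> e = 1 - (e - w) \<bullet> e" using e by (simp add: inner_diff_left norm_eq_1)
        moreover have "(e - w) \<bullet> e \<le> \<kappa>"
          using norm_cauchy_schwarz[of "e - w" e] w e by (simp add: dist_norm)
        ultimately have "1 - \<kappa> \<le> w \<bullet> e" by simp
        then show ?thesis using s by (simp add: inner_add_left)
      qed
      finally have "y + s *\<^sub>R w \<in> {x \<in> ball z R. g (x - (x \<bullet> e) *\<^sub>R e) < x \<bullet> e}"
        using yw by (simp add: P_def)
      then show "y + s *\<^sub>R w \<in> \<Omega>" unfolding chart[symmetric] by simp
    qed (use R e \<kappa> in simp_all)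
  qed
qed

lemma C_k_1_divide:
  fixes b D :: "real^'n \<Rightarrow> real"
  assumes b: "C_k 1 b" and D: "C_k 1 D" "\<And>x. D x > 0"
  shows "C_k 1 (\<lambda>x. b x / D x)"
proof -
  note D' = D(1)[unfolded One_nat_def]
  have 1: "((\<lambda>x. inverse (D x)) has_derivative (\<lambda>v. ((- (inverse (D x) ^ Suc (Suc 0))) *\<^sub>R grad D x) \<bullet> v)) (at x)" for x
    by (rule has_derivative_compose_real[OF _ C_k_differentiable[OF D']])
      (rule DERIV_inverse, use D(2)[of x] in simp)
  have 2: "continuous_on UNIV (\<lambda>x. (- (inverse (D x) ^ Suc (Suc 0))) *\<^sub>R grad D x)"
    by (intro continuous_intros continuous_C_k[OF D(1)] continuous_grad[OF D']) (use D(2) in \<open>auto simp: less_imp_neq[symmetric]\<close>)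
  have "C_k 1 (\<lambda>x. b x * inverse (D x))" by (rule C_k_mult[OF b C_k_1I(1)[OF 1 2]])
  then show ?thesis by (simp add: divide_inverse del: C_k.simps)
qed

text \<open>A partition of unity with a family of mollifiers for each of its members. The mollifiers
  are directed: they average over points displaced along an inward cone, so that convolution moves
  supports away from the boundary while mollifying at the same scale \<open>s\<close>. Pushing a function
  inwards by a translation first would need a distance larger than \<open>s\<close>, and would spoil estimates
  that compare several scales.\<close>

locale cutoff_system =
  fixes \<Omega> :: "(real^'n) set" and Z :: "(real^'n) set" and \<theta> :: "real^'n \<Rightarrow> real^'n \<Rightarrow> real"
    and S :: "real^'n \<Rightarrow> real \<Rightarrow> (real^'n) set" and k :: "real^'n \<Rightarrow> real \<Rightarrow> real^'n \<Rightarrow> real"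
    and A D s0 :: real
  assumes open_domain: "open \<Omega>" and finite_Z: "finite Z" and Z_nonempty: "Z \<noteq> {}"
    and A_pos: "A > 0" and s0_pos: "s0 > 0"
    and \<theta>_C1: "\<And>z. z \<in> Z \<Longrightarrow> C_k 1 (\<theta> z)"
    and \<theta>_nonneg: "\<And>z x. z \<in> Z \<Longrightarrow> 0 \<le> \<theta> z x" and \<theta>_le_1: "\<And>z x. z \<in> Z \<Longrightarrow> \<theta> z x \<le> 1"
    and grad_\<theta>: "\<And>z x. z \<in> Z \<Longrightarrow> norm (grad (\<theta> z) x) \<le> D"
    and sum_\<theta>: "\<And>x. x \<in> \<Omega> \<Longrightarrow> (\<Sum>z\<in>Z. \<theta> z x) = 1"
    and k_mollifier: "\<And>z s. z \<in> Z \<Longrightarrow> s > 0 \<Longrightarrow> mollifier_on (S z s) (k z s)"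
    and k_support: "\<And>z s. z \<in> Z \<Longrightarrow> s > 0 \<Longrightarrow> S z s \<subseteq> cball 0 (2 * s)"
    and k_grad: "\<And>z s. z \<in> Z \<Longrightarrow> s > 0 \<Longrightarrow> (LINT x|lborel. norm (grad (k z s) x)) \<le> A / s"
    and conv_test: "\<And>z s f. z \<in> Z \<Longrightarrow> 0 < s \<Longrightarrow> s \<le> s0 \<Longrightarrow> integrable lborel f \<Longrightarrow>
        (\<And>x. f x \<noteq> 0 \<Longrightarrow> x \<in> \<Omega> \<and> \<theta> z x \<noteq> 0) \<Longrightarrow> conv (k z s) f \<in> Cc_infinity \<Omega>"

lemma conv_directed_test_function:
  fixes f :: "real^'n \<Rightarrow> real"
  assumes f: "integrable lborel f" "\<And>x. f x \<noteq> 0 \<Longrightarrow> x \<in> T" and T: "compact T"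
    and k: "kernel_on S k" "\<And>j. C_k j k"
    and sub: "\<And>y v. y \<in> T \<Longrightarrow> v \<in> S \<Longrightarrow> y + v \<in> \<Omega>"
  shows "conv k f \<in> Cc_infinity \<Omega>"
proof (rule Cc_infinityI[where S="{y + v | y v. y \<in> T \<and> v \<in> S}"])
  note k' = kernel_onD[OF k(1)]
  show "C_k j (conv k f)" for j by (rule conv_C_k[OF f(1) k'(1) k(2) k'(3)])
  show "compact {y + v | y v. y \<in> T \<and> v \<in> S}" by (rule compact_sums[OF T k'(1)])
  show "{y + v | y v. y \<in> T \<and> v \<in> S} \<subseteq> \<Omega>" using sub by blast
  fix x assume x: "x \<notin> {y + v | y v. y \<in> T \<and> v \<in> S}"
  have "k (x - y) *\<^sub>R f y = 0" for y
  proof (rule ccontr)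
    assume "k (x - y) *\<^sub>R f y \<noteq> 0"
    then have "x - y \<in> S" "y \<in> T" using k'(3)[of "x - y"] f(2)[of y] by auto
    moreover have "x = y + (x - y)" by simp
    ultimately show False using x by blast
  qed
  then have "(\<lambda>y. k (x - y) *\<^sub>R f y) = (\<lambda>y. 0)" by (rule ext)
  then show "conv k f x = 0" by (simp only: conv_def Bochner_Integration.integral_zero)
qed

lemma bounded_Lipschitz_domain_cutoff_system:
  fixes \<Omega> :: "(real^'n) set"
  assumes \<Omega>: "bounded_Lipschitz_domain \<Omega>"
  shows "\<exists>Z \<theta> S k A D s0. cutoff_system \<Omega> Z \<theta> S k A D s0"
proof -
  have op: "open \<Omega>" and ne: "\<Omega> \<noteq> {}" and cpt: "compact (closure \<Omega>)"
    using \<Omega> by (auto simp: bounded_Lipschitz_domain_def compact_closure)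
  define cone where "cone z r e \<kappa> t \<longleftrightarrow> r > 0 \<and> norm e = 1 \<and> 0 < \<kappa> \<and> \<kappa> \<le> 1 \<and> t > 0 \<and>
    (\<forall>y\<in>closure \<Omega>. \<forall>w s. dist z y \<le> r \<longrightarrow> dist e w \<le> \<kappa> \<longrightarrow> 0 < s \<longrightarrow> s \<le> t \<longrightarrow> y + s *\<^sub>R w \<in> \<Omega>)"
    for z r e \<kappa> t
  have "\<exists>r e \<kappa> t. cone z r e \<kappa> t" if z: "z \<in> closure \<Omega>" for z
  proof (rule inward_cone[OF \<Omega> z])
    fix r \<kappa> t :: real and e :: "real^'n"
    assume "r > 0" "norm e = 1" "0 < \<kappa>" "\<kappa> \<le> 1" "t > 0"
      and "\<And>y w s. y \<in> closure \<Omega> \<Longrightarrow> dist z y \<le> r \<Longrightarrow> dist e w \<le> \<kappa> \<Longrightarrow> 0 < s \<Longrightarrow> s \<le> t \<Longrightarrow> y + s *\<^sub>R w \<in> \<Omega>"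
    then have "cone z r e \<kappa> t" by (simp add: cone_def)
    then show ?thesis by blast
  qed
  then obtain r e \<kappa> t where cone: "\<And>z. z \<in> closure \<Omega> \<Longrightarrow> cone z (r z) (e z) (\<kappa> z) (t z)" by metis
  have r: "r z > 0" if "z \<in> closure \<Omega>" for z using cone[OF that] by (simp add: cone_def)
  obtain Z where Z: "Z \<subseteq> closure \<Omega>" "finite Z" "closure \<Omega> \<subseteq> (\<Union>z\<in>Z. ball z (r z))"
  proof (rule compactE_image[OF cpt, of "closure \<Omega>" "\<lambda>z. ball z (r z)"])
    show "closure \<Omega> \<subseteq> (\<Union>z\<in>closure \<Omega>. ball z (r z))" using r by force
  qed (auto intro: that)
  have Zne: "Z \<noteq> {}" using Z(3) ne closure_subset[of \<Omega>] by auto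
  define q where "q z x = (r z)\<^sup>2 + (-1) * (\<Sum>i\<in>UNIV. (1 * x $ i + - z $ i) * (1 * x $ i + - z $ i))" for z and x :: "real^'n"
  have q: "q z x = (r z)\<^sup>2 - (norm (x - z))\<^sup>2" for z x
    unfolding q_def power2_norm_eq_inner by (simp add: inner_vec_def)
  have Cq: "C_k j (q z)" for j z
    unfolding q_def by (intro C_k_add C_k_mult C_k_sum C_k_const C_k_coordinate)
  define b where "b z x = flat 0 (q z x)" for z x
  have Cb: "C_k j (b z)" for j z
    unfolding b_def by (rule C_k_compose_real[where F=flat and j=0 and q="q z"]) (rule flat_has_derivative Cq)+
  have b_nn: "0 \<le> b z x" for z x by (simp add: b_def flat_nonneg)
  have b_pos: "0 < b z x" if "x \<in> ball z (r z)" for z x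
  proof -
    have "norm (x - z) < r z" using that by (simp add: dist_norm norm_minus_commute)
    then have "(norm (x - z))\<^sup>2 < (r z)\<^sup>2" by (intro power_strict_mono) auto
    then show ?thesis by (simp add: b_def q flat_pos)
  qed
  have b_0: "b z x = 0" if "z \<in> Z" "x \<notin> cball z (r z)" for z x
  proof -
    have "r z \<le> norm (x - z)" using that by (simp add: dist_norm norm_minus_commute)
    then have "(r z)\<^sup>2 \<le> (norm (x - z))\<^sup>2" using r[of z] that Z(1) by (intro power_mono) auto
    then show ?thesis by (simp add: b_def q flat_eq_0)
  qed
  define B where "B x = (\<Sum>z\<in>Z. b z x)" for x
  have CB: "C_k j B" for j unfolding B_def[abs_def] by (intro C_k_sum Cb)
  have B_nn: "0 \<le> B x" for x by (simp add: B_def sum_nonneg b_nn)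
  have b_le: "b z x \<le> B x" if "z \<in> Z" for z x
    unfolding B_def by (rule member_le_sum[OF that]) (auto simp: b_nn Z)
  have "\<exists>m\<in>closure \<Omega>. \<forall>x\<in>closure \<Omega>. B m \<le> B x"
    by (rule continuous_attains_inf[OF cpt]) (use ne continuous_C_k[OF CB[of 0]] in \<open>auto intro: continuous_on_subset\<close>)
  then obtain x0 where x0: "x0 \<in> closure \<Omega>" "\<And>x. x \<in> closure \<Omega> \<Longrightarrow> B x0 \<le> B x" by blast
  define m where "m = B x0"
  have m: "m > 0"
  proof -
    obtain z where "z \<in> Z" "x0 \<in> ball z (r z)" using x0(1) Z(3) by blast
    then show ?thesis using b_pos[of x0 z] b_le[of z x0] by (simp add: m_def)
  qed
  \<comment> \<open>The denominator agrees with the sum \<open>B\<close> of the bumps on \<open>\<Omega>\<close> and stays positive elsewhere.\<close>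
  define E where "E x = B x + flat 0 (m + (-1) * B x)" for x
  have CE: "C_k j E" for j
    unfolding E_def
    by (intro C_k_add CB C_k_compose_real[where F=flat and j=0 and q="\<lambda>x. m + (-1) * B x"] flat_has_derivative
        C_k_const C_k_mult)
  have E_pos: "E x > 0" for x
    using B_nn[of x] flat_pos[of "m - B x"] flat_nonneg[of "m - B x"] m by (cases "B x = 0") (auto simp: E_def)
  have E_eq: "E x = B x" if "x \<in> closure \<Omega>" for x
    using x0(2)[OF that] by (simp add: E_def m_def flat_eq_0)
  have B_le_E: "B x \<le> E x" for x by (simp add: E_def flat_nonneg)
  define \<theta> where "\<theta> z x = b z x / E x" for z x
  have C\<theta>: "C_k 1 (\<theta> z)" for z
    unfolding \<theta>_def by (rule C_k_1_divide[OF Cb CE E_pos])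
  have \<theta>0: "\<theta> z x = 0" if "z \<in> Z" "x \<notin> cball z (r z)" for z x using b_0[OF that] by (simp add: \<theta>_def)
  have "\<exists>Dz. \<forall>x. norm (grad (\<theta> z) x) \<le> Dz" if "z \<in> Z" for z
  proof -
    have "kernel_on (cball z (r z)) (\<theta> z)" using C\<theta> \<theta>0[OF that] by (simp add: kernel_on_def del: C_k.simps)
    note k = kernel_onD[OF this]
    show ?thesis by (rule bounded_of_compact_support[OF k(5,1,7)]) (assumption, blast)
  qed
  then obtain Dz where Dz: "\<And>z x. z \<in> Z \<Longrightarrow> norm (grad (\<theta> z) x) \<le> Dz z" by metis
  define D where "D = (\<Sum>z\<in>Z. \<bar>Dz z\<bar>)"
  have D: "norm (grad (\<theta> z) x) \<le> D" if "z \<in> Z" for z x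
    using Dz[OF that, of x] member_le_sum[OF that, of "\<lambda>z. \<bar>Dz z\<bar>"] Z(2) by (auto simp: D_def)
  define kern where "kern z k A \<longleftrightarrow> A > 0 \<and> (\<forall>s j. C_k j (k s)) \<and> (\<forall>s>0. \<forall>x. 0 \<le> k s x) \<and>
     (\<forall>s>0. \<forall>x. x \<notin> (\<lambda>w. s *\<^sub>R w) ` cball (e z) (\<kappa> z) \<longrightarrow> k s x = 0) \<and>
     (\<forall>s>0. (LINT x|lborel. k s x) = 1) \<and> (\<forall>s>0. (LINT x|lborel. norm (grad (k s) x)) \<le> A / s)"
    for z and k :: "real \<Rightarrow> real^'n \<Rightarrow> real" and A
  have "\<exists>k A. kern z k A" if "z \<in> Z" for z
  proof -
    have "\<kappa> z > 0" using cone[of z] that Z(1) by (auto simp: cone_def)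
    then show ?thesis by (rule directed_kernels[of "\<kappa> z" "e z"]) (unfold kern_def, blast)
  qed
  then obtain k Az where kern: "\<And>z. z \<in> Z \<Longrightarrow> kern z (k z) (Az z)" by metis
  define A where "A = (\<Sum>z\<in>Z. Az z)"
  have Az: "Az z > 0" if "z \<in> Z" for z using kern[OF that] by (simp add: kern_def)
  have Az_le: "Az z \<le> A" if "z \<in> Z" for z
    unfolding A_def by (rule member_le_sum[OF that]) (use Az Z(2) in \<open>auto intro: less_imp_le\<close>)
  define s0 where "s0 = Min (t ` Z)"
  have t: "t z > 0" if "z \<in> Z" for z using cone[of z] that Z(1) by (auto simp: cone_def)
  have s0: "s0 > 0" "\<And>z. z \<in> Z \<Longrightarrow> s0 \<le> t z"
    using t Z(2) Zne by (auto simp: s0_def)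
  define S where "S z s = (\<lambda>w. s *\<^sub>R w) ` cball (e z) (\<kappa> z)" for z and s :: real
  have kS: "kernel_on (S z s) (k z s)" if "z \<in> Z" "s > 0" for z s
    using kern[OF that(1)] that(2) by (auto simp: kern_def kernel_on_def S_def compact_scaling simp del: C_k.simps)
  have "cutoff_system \<Omega> Z \<theta> S k A D s0"
  proof
    show "open \<Omega>" "finite Z" "Z \<noteq> {}" "s0 > 0" using op Z(2) Zne s0(1) by auto
    show "A > 0" unfolding A_def using Az Z(2) Zne by (intro sum_pos) auto
    show "(\<Sum>z\<in>Z. \<theta> z x) = 1" if "x \<in> \<Omega>" for x
    proof -
      have "x \<in> closure \<Omega>" using that closure_subset by blast
      then show ?thesis using E_eq[of x] E_pos[of x]
        by (simp add: \<theta>_def sum_divide_distrib[symmetric] B_def[symmetric])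
    qed
    fix z x assume z: "z \<in> Z"
    show "C_k 1 (\<theta> z)" by (rule C\<theta>)
    show "0 \<le> \<theta> z x" using b_nn E_pos by (simp add: \<theta>_def less_imp_le)
    show "\<theta> z x \<le> 1" using b_le[OF z, of x] B_le_E[of x] E_pos[of x] by (simp add: \<theta>_def)
    show "norm (grad (\<theta> z) x) \<le> D" by (rule D[OF z])
  next
    fix z and s :: real assume z: "z \<in> Z" and s: "s > 0"
    show "mollifier_on (S z s) (k z s)"
      using kS[OF z s] kern[OF z] s by (simp add: mollifier_on_def kern_def)
    show "(LINT x|lborel. norm (grad (k z s) x)) \<le> A / s"
    proof -
      have "(LINT x|lborel. norm (grad (k z s) x)) \<le> Az z / s" using kern[OF z] s by (simp add: kern_def)
      also have "\<dots> \<le> A / s" using Az_le[OF z] s by (simp add: divide_right_mono)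
      finally show ?thesis .
    qed
    have ez: "norm (e z) = 1" "\<kappa> z \<le> 1" using cone[of z] z Z(1) by (auto simp: cone_def)
    show "S z s \<subseteq> cball 0 (2 * s)"
    proof
      fix v assume "v \<in> S z s"
      then obtain w where w: "v = s *\<^sub>R w" "w \<in> cball (e z) (\<kappa> z)" unfolding S_def by (rule imageE)
      have "norm w \<le> 2"
        using w(2) ez norm_triangle_ineq2[of w "e z"] by (simp add: dist_norm norm_minus_commute)
      then have "s * norm w \<le> s * 2" using s by (intro mult_left_mono) auto
      then show "v \<in> cball 0 (2 * s)" using w(1) s by simp
    qed
  next
    fix z s and f :: "real^'n \<Rightarrow> real"
    assume z: "z \<in> Z" and s: "0 < s" "s \<le> s0" and f: "integrable lborel f" "\<And>x. f x \<noteq> 0 \<Longrightarrow> x \<in> \<Omega> \<and> \<theta> z x \<noteq> 0"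
    show "conv (k z s) f \<in> Cc_infinity \<Omega>"
    proof (rule conv_directed_test_function[OF f(1), where T="closure \<Omega> \<inter> cball z (r z)" and S="S z s"])
      show "x \<in> closure \<Omega> \<inter> cball z (r z)" if "f x \<noteq> 0" for x
        using f(2)[OF that] \<theta>0[OF z, of x] closure_subset[of \<Omega>] by blast
      show "compact (closure \<Omega> \<inter> cball z (r z))" using cpt by (intro compact_Int) auto
      show "kernel_on (S z s) (k z s)" by (rule kS[OF z s(1)])
      show "C_k j (k z s)" for j using kern[OF z] by (simp add: kern_def)
      fix y v assume y: "y \<in> closure \<Omega> \<inter> cball z (r z)" and "v \<in> S z s"
      then obtain w where w: "v = s *\<^sub>R w" "w \<in> cball (e z) (\<kappa> z)" unfolding S_def by (elim imageE)
      have "cone z (r z) (e z) (\<kappa> z) (t z)" using cone z Z(1) by blast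
      then show "y + v \<in> \<Omega>"
        using y w s s0(2)[OF z] unfolding cone_def by auto
    qed
  qed
  then show ?thesis by blast
qed

section \<open>Boundary values of Hoelder continuous functions\<close>

lemma pos_part_square_has_derivative:
  "((\<lambda>t::real. (max 0 t)\<^sup>2) has_real_derivative 2 * max 0 t) (at t)"
proof -
  consider "t > 0" | "t < 0" | "t = 0" by linarith
  then show ?thesis
  proof cases
    case 1
    have "((\<lambda>t. t\<^sup>2) has_real_derivative 2 * max 0 t) (at t)"
      using 1 by (auto intro!: derivative_eq_intros)
    then show ?thesis
      by (rule has_field_derivative_transform_within_open[where S="{0<..}"]) (use 1 in auto)
  next
    case 2
    have "((\<lambda>t. 0) has_real_derivative 2 * max 0 t) (at t)" using 2 by simp
    then show ?thesis
      by (rule has_field_derivative_transform_within_open[where S="{..<0}"]) (use 2 in auto)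
  next
    case 3
    have "((\<lambda>h::real. (max 0 h)\<^sup>2 / h) \<longlongrightarrow> 0) (at 0)"
    proof (rule tendsto_0_le[where K=1])
      show "((\<lambda>h::real. h) \<longlongrightarrow> 0) (at 0)" by (rule tendsto_ident_at)
      have "norm ((max 0 h)\<^sup>2 / h) \<le> norm h * 1" for h :: real
        by (simp add: max_def power2_eq_square)
      then show "\<forall>\<^sub>F h::real in at 0. norm ((max 0 h)\<^sup>2 / h) \<le> norm h * 1" by (intro always_eventually allI)
    qed
    then show ?thesis using 3 by (simp add: DERIV_def)
  qed
qed

text \<open>If \<open>f\<close> stayed away from zero near a boundary point, a suitable function of \<open>f\<close> would be
  the indicator of \<open>\<Omega>\<close> near that point, with vanishing gradient. Its mollifications are then
  locally constant, although they equal one on the inner and zero on the outer side of the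
  boundary.\<close>

lemma sobolev0_small_near_boundary:
  fixes \<Omega> :: "(real^'n) set"
  assumes \<Omega>: "bounded_Lipschitz_domain \<Omega>" and W: "sobolev0 \<Omega> f G"
    and z: "z \<in> frontier \<Omega>" and b: "b > 0" and \<rho>: "\<rho> > 0"
  shows "\<not> (AE x in lborel. x \<in> \<Omega> \<inter> ball z \<rho> \<longrightarrow> b \<le> \<bar>f x\<bar>)"
proof
  assume big: "AE x in lborel. x \<in> \<Omega> \<inter> ball z \<rho> \<longrightarrow> b \<le> \<bar>f x\<bar>"
  have "open \<Omega>" using \<Omega> by (simp add: bounded_Lipschitz_domain_def)
  then have z_notin: "z \<notin> \<Omega>" and z_cl: "z \<in> closure \<Omega>"
    using z by (auto simp: frontier_def interior_open)
  note fG = sobolev0D[OF W]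
  \<comment> \<open>A continuously differentiable \<open>h\<close> with \<open>h 0 = 0\<close> that equals one where \<open>\<bar>t\<bar> \<ge> b\<close>.\<close>
  define p where "p t = 1 - t\<^sup>2 / b\<^sup>2" for t :: real
  define h where "h t = 1 - (max 0 (p t))\<^sup>2" for t
  define h' where "h' t = 2 * max 0 (p t) * (2 * t / b\<^sup>2)" for t
  have dh: "(h has_real_derivative h' t) (at t)" for t
  proof -
    have "(p has_real_derivative - (2 * t / b\<^sup>2)) (at t)"
    proof -
      have "((\<lambda>t::real. t\<^sup>2) has_real_derivative 2 * t) (at t)" by (auto intro!: derivative_eq_intros)
      from DERIV_diff[OF DERIV_const[of 1] DERIV_cdivide[OF this, of "b\<^sup>2"]]
      show ?thesis by (simp add: p_def[abs_def])
    qed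
    from DERIV_chain2[OF pos_part_square_has_derivative this]
    have "((\<lambda>t. (max 0 (p t))\<^sup>2) has_real_derivative 2 * max 0 (p t) * - (2 * t / b\<^sup>2)) (at t)" .
    from DERIV_diff[OF DERIV_const[of 1] this] show ?thesis by (simp add: h_def[abs_def] h'_def)
  qed
  have ch': "continuous_on UNIV h'"
    unfolding h'_def p_def by (intro continuous_intros) (use b in auto)
  have far: "p t \<le> 0" if "b \<le> \<bar>t\<bar>" for t
  proof -
    have "b\<^sup>2 \<le> t\<^sup>2" using that b by (metis abs_of_pos abs_le_square_iff)
    then show ?thesis using b by (simp add: p_def)
  qed
  have h'_bound: "\<bar>h' t\<bar> \<le> 4 / b" for t
  proof (cases "b \<le> \<bar>t\<bar>")
    case True
    then show ?thesis using far[OF True] b by (simp add: h'_def)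
  next
    case False
    have "p t \<le> 1" by (simp add: p_def)
    then have "\<bar>h' t\<bar> \<le> 2 * 1 * (2 * b / b\<^sup>2)"
      unfolding h'_def abs_mult using False b by (intro mult_mono) (auto simp: divide_right_mono)
    also have "\<dots> = 4 / b" using b by (simp add: power2_eq_square)
    finally show ?thesis .
  qed
  have h0: "h 0 = 0" by (simp add: h_def p_def)
  have h1: "h t = 1" "h' t = 0" if "b \<le> \<bar>t\<bar>" for t using far[OF that] by (simp_all add: h_def h'_def)
  have W': "sobolev0 \<Omega> (\<lambda>x. h (f x)) (\<lambda>x. h' (f x) *\<^sub>R G x)"
    by (rule sobolev0_chain[OF W dh ch' h'_bound h0])
  have hf: "AE x in lborel. x \<in> ball z \<rho> \<longrightarrow> h (f x) = indicator \<Omega> x \<and> h' (f x) *\<^sub>R G x = 0"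
    using big
  proof eventually_elim
    case (elim x)
    show ?case
    proof
      assume "x \<in> ball z \<rho>"
      then show "h (f x) = indicator \<Omega> x \<and> h' (f x) *\<^sub>R G x = 0"
        using elim h1[of "f x"] fG(3,4)[of x] h0 by (cases "x \<in> \<Omega>") simp_all
    qed
  qed
  obtain r e \<kappa> s0 where r: "r > 0" and e: "norm e = 1" and \<kappa>: "0 < \<kappa>" "\<kappa> \<le> 1" and s0: "s0 > 0"
    and cone: "\<And>y w s. y \<in> closure \<Omega> \<Longrightarrow> dist z y \<le> r \<Longrightarrow> dist e w \<le> \<kappa> \<Longrightarrow> 0 < s \<Longrightarrow> s \<le> s0 \<Longrightarrow> y + s *\<^sub>R w \<in> \<Omega>"
    by (rule inward_cone[OF \<Omega> z_cl]) (rule that)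
  define s where "s = min s0 (min (\<rho> / 4) (r / 4))"
  have s: "0 < s" "s \<le> s0" "s \<le> \<rho> / 4" "s \<le> r / 4" using s0 \<rho> r by (auto simp: s_def)
  have s\<kappa>: "0 < s * \<kappa>" "s * \<kappa> \<le> s" using s \<kappa> by (auto simp: mult_left_le)
  obtain k :: "real^'n \<Rightarrow> real" and S where k: "mollifier_on S k" "S \<subseteq> ball 0 (s * \<kappa>)" "\<And>j. C_k j k"
    by (rule smooth_mollifier_exists[OF s\<kappa>(1)]) (rule that)
  have kS: "kernel_on S k" and k1: "(LINT x|lborel. k x) = 1" using k(1) by (auto simp: mollifier_on_def)
  note kd = kernel_onD[OF kS]
  have supp: "norm v < s * \<kappa>" if "k v \<noteq> 0" for v
    using kd(3)[of v] that k(2) by (auto simp: subset_iff)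
  have in_ball: "y \<in> ball z \<rho>" if "x \<in> ball z (\<rho> / 2)" "k (x - y) \<noteq> 0" for x y
    using supp[OF that(2)] that(1) s s\<kappa> dist_triangle[of z y x] by (simp add: dist_norm)
  let ?F = "conv k (\<lambda>x. h (f x))"
  have F: "?F x = (LINT y|lborel. k (x - y) * indicator \<Omega> y)" if x: "x \<in> ball z (\<rho> / 2)" for x
    unfolding conv_def
  proof (rule integral_cong_AE)
    show "AE y in lborel. k (x - y) *\<^sub>R h (f y) = k (x - y) * indicator \<Omega> y"
      using hf
    proof eventually_elim
      case (elim y)
      then show ?case using in_ball[OF x, of y] by (cases "k (x - y) = 0") simp_all
    qed
    show "(\<lambda>y. k (x - y) *\<^sub>R h (f y)) \<in> borel_measurable lborel"
      using integrable_conv[OF sobolev0D(1)[OF W'] kS, of x] by (rule borel_measurable_integrable)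
    show "(\<lambda>y. k (x - y) * indicator \<Omega> y) \<in> borel_measurable lborel"
      using kd(8) borel_open[OF \<open>open \<Omega>\<close>] by measurable
  qed
  have grad0: "grad ?F x = 0" if x: "x \<in> ball z (\<rho> / 2)" for x
  proof -
    have "AE y in lborel. k (x - y) *\<^sub>R (h' (f y) *\<^sub>R G y) = 0"
      using hf
    proof eventually_elim
      case (elim y)
      show ?case
      proof (cases "k (x - y) = 0")
        case False
        then show ?thesis using in_ball[OF x False] elim by simp
      qed simp
    qed
    then have "conv k (\<lambda>y. h' (f y) *\<^sub>R G y) x = 0"
      unfolding conv_def by (rule integral_eq_zero_AE)
    then show ?thesis by (simp only: sobolev0_grad_conv[OF W' kS])
  qed
  have "\<exists>c. \<forall>x\<in>ball z (\<rho> / 2). ?F x = c"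
  proof (rule has_derivative_zero_constant[OF convex_ball])
    fix x assume x: "x \<in> ball z (\<rho> / 2)"
    have "?F differentiable (at x)"
      using conv_has_derivative[OF sobolev0D(1)[OF W'] kS] by (rule differentiableI)
    from has_derivative_grad[OF this] have "(?F has_derivative (\<lambda>h. 0)) (at x)"
      by (simp add: grad0[OF x])
    then show "(?F has_derivative (\<lambda>h. 0)) (at x within ball z (\<rho> / 2))"
      by (rule has_derivative_at_withinI)
  qed
  then obtain c where c: "\<And>x. x \<in> ball z (\<rho> / 2) \<Longrightarrow> ?F x = c" by blast
  have se: "norm (s *\<^sub>R e) = s" using e s by simp
  let ?p = "z + s *\<^sub>R e" and ?q = "z - s *\<^sub>R e"
  have pq: "?p \<in> ball z (\<rho> / 2)" "?q \<in> ball z (\<rho> / 2)" using s se by (simp_all add: dist_norm)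
  have w: "dist e (e - v /\<^sub>R s) \<le> \<kappa>" if "k v \<noteq> 0" for v
    using supp[OF that] s(1) by (simp add: dist_norm field_simps)
  have "?p - v \<in> \<Omega>" if "k v \<noteq> 0" for v
  proof -
    have "z + s *\<^sub>R (e - v /\<^sub>R s) \<in> \<Omega>"
      using cone[OF z_cl _ w[OF that] s(1,2)] r by simp
    then show ?thesis using s(1) by (simp add: scaleR_diff_right add_diff_eq)
  qed
  from this[of "?p - y" for y] have inside: "y \<in> \<Omega>" if "k (?p - y) \<noteq> 0" for y
    using that by simp
  have outside: "y \<notin> \<Omega>" if ky: "k (?q - y) \<noteq> 0" for y
  proof
    assume "y \<in> \<Omega>"
    then have y: "y \<in> closure \<Omega>" using closure_subset by blast
    define v where "v = ?q - y"
    have v: "k (- (- v)) \<noteq> 0" "norm v < s * \<kappa>" using ky supp by (auto simp: v_def)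
    have y_eq: "y = z - s *\<^sub>R (e + v /\<^sub>R s)" using s(1) by (simp add: v_def scaleR_add_right)
    have "dist z y \<le> r"
    proof -
      have "dist z y = norm (s *\<^sub>R e + v)" using s(1) by (simp add: y_eq dist_norm scaleR_add_right)
      also have "\<dots> \<le> s + s" using norm_triangle_ineq[of "s *\<^sub>R e" v] se v(2) s\<kappa>(2) by linarith
      finally show ?thesis using s(4) r by linarith
    qed
    moreover have "dist e (e + v /\<^sub>R s) \<le> \<kappa>" using v(2) s(1) by (simp add: dist_norm field_simps)
    ultimately have "y + s *\<^sub>R (e + v /\<^sub>R s) \<in> \<Omega>" using cone[OF y _ _ s(1,2)] by blast
    then show False using z_notin by (simp add: y_eq)
  qed
  have "?F ?p = (LINT y|lborel. k (?p - y))"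
    unfolding F[OF pq(1)]
  proof (rule Bochner_Integration.integral_cong[OF refl])
    fix y show "k (?p - y) * indicator \<Omega> y = k (?p - y)"
      using inside[of y] by (cases "k (?p - y) = 0") (simp_all add: indicator_def)
  qed
  also have "\<dots> = 1" using integral_lborel_reflect[OF kd(8), of ?p] k1 by simp
  finally have "?F ?p = 1" .
  moreover have "?F ?q = (LINT y::real^'n|lborel. 0)"
    unfolding F[OF pq(2)]
  proof (rule Bochner_Integration.integral_cong[OF refl])
    fix y show "k (?q - y) * indicator \<Omega> y = 0"
      using outside[of y] by (cases "k (?q - y) = 0") (simp_all add: indicator_def)
  qed
  ultimately show False using c[OF pq(1)] c[OF pq(2)] by simp
qed

lemma C_0_gammaD:
  assumes "h \<in> C_0_gamma \<gamma> \<Omega>"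
  obtains H where "H \<ge> 0" "\<And>x y. x \<in> \<Omega> \<Longrightarrow> y \<in> \<Omega> \<Longrightarrow> \<bar>h x - h y\<bar> \<le> H * dist x y powr \<gamma>"
proof -
  obtain B where B: "\<And>q. q \<in> {\<bar>h x - h y\<bar> / dist x y powr \<gamma> | x y. x \<in> \<Omega> \<and> y \<in> \<Omega> \<and> x \<noteq> y} \<Longrightarrow> q \<le> B"
    using assms unfolding C_0_gamma_def bdd_above_def by blast
  show ?thesis
  proof (rule that[of "\<bar>B\<bar>"])
    fix x y assume xy: "x \<in> \<Omega>" "y \<in> \<Omega>"
    show "\<bar>h x - h y\<bar> \<le> \<bar>B\<bar> * dist x y powr \<gamma>"
    proof (cases "x = y")
      case False
      then have "\<bar>h x - h y\<bar> / dist x y powr \<gamma> \<le> B" using xy by (intro B) blast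
      then have "\<bar>h x - h y\<bar> / dist x y powr \<gamma> \<le> \<bar>B\<bar>" by linarith
      then show ?thesis using False by (simp add: pos_divide_le_eq)
    qed simp
  qed simp
qed

text \<open>By \<open>sobolev0_small_near_boundary\<close> the function comes arbitrarily close to zero near each boundary point,
  and every segment leaving \<open>\<Omega>\<close> meets the boundary.\<close>

lemma Hoelder_extension_by_zero:
  fixes \<Omega> :: "(real^'n) set"
  assumes \<Omega>: "bounded_Lipschitz_domain \<Omega>" and W: "sobolev0 \<Omega> f G"
    and f: "AE x in lborel. x \<in> \<Omega> \<longrightarrow> \<phi> x = f x" and \<gamma>: "\<gamma> > 0"
    and H: "H \<ge> 0" "\<And>x y. x \<in> \<Omega> \<Longrightarrow> y \<in> \<Omega> \<Longrightarrow> \<bar>\<phi> x - \<phi> y\<bar> \<le> H * dist x y powr \<gamma>"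
  shows "\<bar>(if x \<in> \<Omega> then \<phi> x else 0) - (if y \<in> \<Omega> then \<phi> y else 0)\<bar> \<le> H * dist x y powr \<gamma>"
proof -
  have at_boundary: "\<bar>\<phi> x\<bar> \<le> H * dist x z powr \<gamma>" if x: "x \<in> \<Omega>" and z: "z \<in> frontier \<Omega>" for x z
  proof -
    have *: "\<bar>\<phi> x\<bar> \<le> b + H * (dist x z + b) powr \<gamma>" if b: "b > 0" for b
    proof -
      have "\<not> (\<forall>y\<in>\<Omega> \<inter> ball z b. b \<le> \<bar>\<phi> y\<bar>)"
      proof
        assume big: "\<forall>y\<in>\<Omega> \<inter> ball z b. b \<le> \<bar>\<phi> y\<bar>"
        have "AE x in lborel. x \<in> \<Omega> \<inter> ball z b \<longrightarrow> b \<le> \<bar>f x\<bar>"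
          using f
        proof eventually_elim
          case (elim x)
          show ?case using elim bspec[OF big, of x] by auto
        qed
        then show False using sobolev0_small_near_boundary[OF \<Omega> W z b b] by blast
      qed
      then obtain y where y: "y \<in> \<Omega>" "dist z y < b" "\<bar>\<phi> y\<bar> < b" by auto
      have "\<bar>\<phi> x\<bar> \<le> \<bar>\<phi> y\<bar> + \<bar>\<phi> x - \<phi> y\<bar>" by linarith
      also have "\<dots> \<le> b + H * dist x y powr \<gamma>" using y H(2)[OF x y(1)] by linarith
      also have "dist x y powr \<gamma> \<le> (dist x z + b) powr \<gamma>"
        using dist_triangle[of x y z] y(2) \<gamma> by (intro powr_mono2) auto
      finally show ?thesis using H(1) by (simp add: mult_left_mono)
    qed
    have pos: "\<forall>\<^sub>F b in at_right (0::real). 0 < b" by (simp add: eventually_at_filter)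
    have "((\<lambda>b. b + H * (dist x z + b) powr \<gamma>) \<longlongrightarrow> 0 + H * (dist x z + 0) powr \<gamma>) (at_right 0)"
    proof (intro tendsto_add tendsto_mult tendsto_const tendsto_ident_at tendsto_powr')
      have "\<forall>\<^sub>F b in at_right 0. 0 \<le> dist x z + b"
        using pos by eventually_elim simp
      then show "dist x z + 0 \<noteq> 0 \<or> 0 < \<gamma> \<and> (\<forall>\<^sub>F b in at_right 0. 0 \<le> dist x z + b)" using \<gamma> by blast
    qed
    then have "0 + H * (dist x z + 0) powr \<gamma> \<ge> \<bar>\<phi> x\<bar>"
    proof (rule tendsto_lowerbound)
      show "\<forall>\<^sub>F b in at_right 0. \<bar>\<phi> x\<bar> \<le> b + H * (dist x z + b) powr \<gamma>"
        using pos by eventually_elim (rule *)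
    qed simp
    then show ?thesis by simp
  qed
  have mixed: "\<bar>\<phi> x\<bar> \<le> H * dist x y powr \<gamma>" if x: "x \<in> \<Omega>" and y: "y \<notin> \<Omega>" for x y
  proof -
    have "closed_segment x y \<inter> frontier \<Omega> \<noteq> {}"
    proof (rule connected_Int_frontier)
      show "closed_segment x y \<inter> \<Omega> \<noteq> {}" using x by auto
      show "closed_segment x y - \<Omega> \<noteq> {}" using y by auto
    qed simp
    then obtain z where z: "z \<in> closed_segment x y" "z \<in> frontier \<Omega>" by blast
    have "dist x z powr \<gamma> \<le> dist x y powr \<gamma>"
      using dist_in_closed_segment[OF z(1)] \<gamma> by (intro powr_mono2) (auto simp: dist_commute)
    then show ?thesis using at_boundary[OF x z(2)] H(1) by (meson mult_left_mono order_trans)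
  qed
  show ?thesis
    using H mixed[of x y] mixed[of y x] by (auto simp: dist_commute)
qed

section \<open>Continuous weak N-functions and the balance conditions\<close>

locale continuous_N_function =
  fixes \<Omega> :: "(real^'n) set" and M :: "real^'n \<Rightarrow> real^'n \<Rightarrow> real"
  assumes \<Omega>_open: "open \<Omega>"
    and M_continuous: "continuous_on (\<Omega> \<times> UNIV) (\<lambda>(x, \<xi>). M x \<xi>)"
    and M_nonneg: "\<And>x \<xi>. x \<in> \<Omega> \<Longrightarrow> 0 \<le> M x \<xi>"
    and M_zero: "\<And>x. x \<in> \<Omega> \<Longrightarrow> M x 0 = 0"
    and M_convex: "\<And>x. x \<in> \<Omega> \<Longrightarrow> convex_on UNIV (M x)"
    and M_even: "\<And>x \<xi>. x \<in> \<Omega> \<Longrightarrow> M x (- \<xi>) = M x \<xi>"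
    and M_bounded: "\<And>T. \<exists>B. \<forall>x\<in>\<Omega>. \<forall>\<xi>. norm \<xi> \<le> T \<longrightarrow> M x \<xi> \<le> B"

lemma AE_lebesgue_on_sequence:
  fixes \<Omega> :: "'a::euclidean_space set"
  assumes "open \<Omega>" and ae: "AE x in lebesgue_on \<Omega>. Q x" and x: "x \<in> \<Omega>"
  obtains xs :: "nat \<Rightarrow> 'a" where "\<And>n. xs n \<in> \<Omega>" "\<And>n. Q (xs n)" "xs \<longlonglongrightarrow> x"
proof -
  have "AE x in lebesgue. x \<in> \<Omega> \<longrightarrow> Q x"
    using ae \<open>open \<Omega>\<close> by (simp add: AE_restrict_space_iff)
  then have ae': "AE x in lborel. x \<in> \<Omega> \<longrightarrow> Q x" by (rule AE_lborel_if_lebesgue)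
  have "\<exists>y. y \<in> \<Omega> \<and> Q y \<and> dist y x < inverse (real (Suc n))" for n
  proof -
    have "x \<in> ball x (inverse (real (Suc n))) \<inter> \<Omega>" using x by (simp only: Int_iff centre_in_ball) simp
    then have "open (ball x (inverse (real (Suc n))) \<inter> \<Omega>)" "ball x (inverse (real (Suc n))) \<inter> \<Omega> \<noteq> {}"
      using \<open>open \<Omega>\<close> by (intro open_Int open_ball, simp, blast)
    from AE_lborel_open_ex[OF ae' this] show ?thesis by (auto simp: dist_commute)
  qed
  then obtain xs where xs: "\<And>n. xs n \<in> \<Omega>" "\<And>n. Q (xs n)" "\<And>n. dist (xs n) x < inverse (real (Suc n))" by metis
  have "(\<lambda>n. dist (xs n) x) \<longlonglongrightarrow> 0"
    by (rule tendsto_0_squeeze[OF LIMSEQ_inverse_real_of_nat]) (simp_all only: zero_le_dist less_imp_le[OF xs(3)])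
  then have "xs \<longlonglongrightarrow> x" by (rule tendsto_dist_iff[THEN iffD2])
  with xs(1,2) show ?thesis by (rule that)
qed

text \<open>The defining properties are closed under limits in \<open>x\<close>. Since \<open>M\<close> is continuous, they extend
  from almost all points of \<open>\<Omega>\<close> to all of them.\<close>

lemma weak_N_function_continuous:
  fixes \<Omega> :: "(real^'n) set"
  assumes op: "open \<Omega>" and N: "weak_N_function \<Omega> M" and c: "continuous_on (\<Omega> \<times> UNIV) (\<lambda>(x, \<xi>). M x \<xi>)"
  shows "continuous_N_function \<Omega> M"
proof -
  have lim: "(\<lambda>n. M (xs n) \<xi>) \<longlonglongrightarrow> M x \<xi>" if "\<And>n. xs n \<in> \<Omega>" "xs \<longlonglongrightarrow> x" "x \<in> \<Omega>" for xs x \<xi>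
  proof -
    have "((\<lambda>p. (\<lambda>(x, \<xi>). M x \<xi>) p) \<longlongrightarrow> (\<lambda>(x, \<xi>). M x \<xi>) (x, \<xi>)) (at (x, \<xi>) within \<Omega> \<times> UNIV)"
      using c that(3) by (auto simp: continuous_on_def)
    then have "continuous (at (x, \<xi>) within \<Omega> \<times> UNIV) (\<lambda>(x, \<xi>). M x \<xi>)" by (simp add: continuous_within)
    from continuous_within_tendsto_compose'[OF this, of "\<lambda>n. (xs n, \<xi>)" sequentially]
    show ?thesis using that by (simp add: tendsto_Pair)
  qed
  show ?thesis
  proof
    show "open \<Omega>" "continuous_on (\<Omega> \<times> UNIV) (\<lambda>(x, \<xi>). M x \<xi>)" by fact+
    show nn: "0 \<le> M x \<xi>" if "x \<in> \<Omega>" for x \<xi> using N that by (simp add: weak_N_function_def)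
    have aec: "AE x in lebesgue_on \<Omega>. M x 0 = 0 \<and> convex_on UNIV (M x)"
      and aee: "AE x in lebesgue_on \<Omega>. \<forall>\<xi>. M x \<xi> = M x (- \<xi>)"
      using N by (simp_all add: weak_N_function_def)
    obtain m1 m2 :: "real \<Rightarrow> real" where m2: "convex_on {0..} m2"
      "AE x in lebesgue_on \<Omega>. \<forall>\<xi>. m1 (norm \<xi>) \<le> M x \<xi> \<and> M x \<xi> \<le> m2 (norm \<xi>)"
      using N unfolding weak_N_function_def by blast
    show "M x 0 = 0" if x: "x \<in> \<Omega>" for x
    proof -
      obtain xs where xs: "\<And>n. xs n \<in> \<Omega>" "\<And>n. M (xs n) 0 = 0 \<and> convex_on UNIV (M (xs n))" "xs \<longlonglongrightarrow> x"
        by (rule AE_lebesgue_on_sequence[OF op aec x]) (rule that)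
      have "(\<lambda>n. M (xs n) 0) \<longlonglongrightarrow> M x 0" by (rule lim[OF xs(1,3) x])
      then show ?thesis using xs(2) by (simp add: LIMSEQ_const_iff)
    qed
    show "convex_on UNIV (M x)" if x: "x \<in> \<Omega>" for x
    proof -
      obtain xs where xs: "\<And>n. xs n \<in> \<Omega>" "\<And>n. M (xs n) 0 = 0 \<and> convex_on UNIV (M (xs n))" "xs \<longlonglongrightarrow> x"
        by (rule AE_lebesgue_on_sequence[OF op aec x]) (rule that)
      show ?thesis
      proof (rule convex_onI)
        fix t and \<xi> \<eta> :: "real^'n" assume t: "0 < t" "t < (1::real)"
        show "M x ((1 - t) *\<^sub>R \<xi> + t *\<^sub>R \<eta>) \<le> (1 - t) * M x \<xi> + t * M x \<eta>"
        proof (rule LIMSEQ_le[OF lim[OF xs(1,3) x]])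
          show "(\<lambda>n. (1 - t) * M (xs n) \<xi> + t * M (xs n) \<eta>) \<longlonglongrightarrow> (1 - t) * M x \<xi> + t * M x \<eta>"
            by (intro tendsto_intros lim[OF xs(1,3) x])
          have "M (xs n) ((1 - t) *\<^sub>R \<xi> + t *\<^sub>R \<eta>) \<le> (1 - t) * M (xs n) \<xi> + t * M (xs n) \<eta>" for n
            using convex_onD[of UNIV "M (xs n)" t \<xi> \<eta>] xs(2)[of n] t by simp
          then show "\<exists>N. \<forall>n\<ge>N. M (xs n) ((1 - t) *\<^sub>R \<xi> + t *\<^sub>R \<eta>) \<le> (1 - t) * M (xs n) \<xi> + t * M (xs n) \<eta>" by blast
        qed
      qed simp
    qed
    show "M x (- \<xi>) = M x \<xi>" if x: "x \<in> \<Omega>" for x \<xi>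
    proof -
      obtain xs where xs: "\<And>n. xs n \<in> \<Omega>" "\<And>n. \<forall>\<xi>. M (xs n) \<xi> = M (xs n) (- \<xi>)" "xs \<longlonglongrightarrow> x"
        by (rule AE_lebesgue_on_sequence[OF op aee x]) (rule that)
      have "(\<lambda>n. M (xs n) \<xi>) = (\<lambda>n. M (xs n) (- \<xi>))" using xs(2) by (intro ext) blast
      with lim[OF xs(1,3) x, of "\<xi>"] lim[OF xs(1,3) x, of "- \<xi>"] show ?thesis
        using LIMSEQ_unique by metis
    qed
    show "\<exists>B. \<forall>x\<in>\<Omega>. \<forall>\<xi>. norm \<xi> \<le> T \<longrightarrow> M x \<xi> \<le> B" for T
    proof (intro exI[of _ "max (m2 0) (m2 T)"] ballI allI impI)
      fix x and \<xi> :: "real^'n" assume x: "x \<in> \<Omega>" and \<xi>: "norm \<xi> \<le> T"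
      obtain xs where xs: "\<And>n. xs n \<in> \<Omega>" "\<And>n. \<forall>\<xi>. m1 (norm \<xi>) \<le> M (xs n) \<xi> \<and> M (xs n) \<xi> \<le> m2 (norm \<xi>)" "xs \<longlonglongrightarrow> x"
        by (rule AE_lebesgue_on_sequence[OF op m2(2) x]) (rule that)
      have "M x \<xi> \<le> m2 (norm \<xi>)"
        by (rule LIMSEQ_le_const2[OF lim[OF xs(1,3) x]]) (use xs(2) in blast)
      also have "m2 (norm \<xi>) \<le> max (m2 0) (m2 T)"
      proof -
        have "T \<ge> 0" using \<xi> norm_ge_zero[of \<xi>] by linarith
        have "convex_on {0..T} m2" by (rule convex_on_subset[OF m2(1)]) auto
        from convex_on_le_max[OF this, of "norm \<xi>"] show ?thesis using \<xi> by simp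
      qed
      finally show "M x \<xi> \<le> max (m2 0) (m2 T)" .
    qed
  qed
qed

context continuous_N_function
begin

lemma M_scale_le:
  assumes "x \<in> \<Omega>" "0 \<le> a" "a \<le> 1"
  shows "M x (a *\<^sub>R \<xi>) \<le> a * M x \<xi>"
  using convex_onD[OF M_convex[OF assms(1)], of a 0 \<xi>] assms M_zero[OF assms(1)] by simp

lemma M_scale_ge:
  assumes "x \<in> \<Omega>" "1 \<le> a"
  shows "a * M x \<xi> \<le> M x (a *\<^sub>R \<xi>)"
proof -
  have "M x \<xi> \<le> inverse a * M x (a *\<^sub>R \<xi>)"
    using M_scale_le[OF assms(1), of "inverse a" "a *\<^sub>R \<xi>"] assms(2) by (simp add: inverse_le_1_iff)
  then show ?thesis using assms(2) by (simp add: field_simps)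
qed

lemma M_scale_mono:
  assumes "x \<in> \<Omega>" "0 \<le> a" "a \<le> b"
  shows "M x (a *\<^sub>R \<xi>) \<le> M x (b *\<^sub>R \<xi>)"
proof (cases "b = 0")
  case False
  then have "b > 0" using assms by simp
  have "M x (a *\<^sub>R \<xi>) = M x ((a / b) *\<^sub>R (b *\<^sub>R \<xi>))" using False by simp
  also have "\<dots> \<le> (a / b) * M x (b *\<^sub>R \<xi>)" using assms \<open>b > 0\<close> by (intro M_scale_le) auto
  also have "\<dots> \<le> 1 * M x (b *\<^sub>R \<xi>)"
    using assms \<open>b > 0\<close> by (intro mult_right_mono M_nonneg) auto
  finally show ?thesis by simp
qed (use assms in simp)

lemma M_midpoint:
  assumes "x \<in> \<Omega>"
  shows "M x (\<xi> + \<eta>) \<le> M x (2 *\<^sub>R \<xi>) / 2 + M x (2 *\<^sub>R \<eta>) / 2"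
  using convex_onD[OF M_convex[OF assms], of "1/2" "2 *\<^sub>R \<xi>" "2 *\<^sub>R \<eta>"] by simp

lemma M_average:
  assumes "x \<in> \<Omega>" "finite J" "J \<noteq> {}"
  shows "M x (\<Sum>j\<in>J. \<xi> j) \<le> (\<Sum>j\<in>J. M x (real (card J) *\<^sub>R \<xi> j)) / card J"
proof -
  have c: "card J > 0" using assms by (simp add: card_gt_0_iff)
  have "M x (\<Sum>j\<in>J. (1 / real (card J)) *\<^sub>R (real (card J) *\<^sub>R \<xi> j))
      \<le> (\<Sum>j\<in>J. (1 / real (card J)) * M x (real (card J) *\<^sub>R \<xi> j))"
    by (rule convex_on_sum[OF assms(2,3) M_convex[OF assms(1)]]) (use c in auto)
  then show ?thesis using c by (simp add: sum_divide_distrib)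
qed

lemma tendsto_M:
  assumes "\<And>n. xs n \<in> \<Omega>" "xs \<longlonglongrightarrow> x" "x \<in> \<Omega>" "\<xi>s \<longlonglongrightarrow> \<xi>"
  shows "(\<lambda>n. M (xs n) (\<xi>s n)) \<longlonglongrightarrow> M x \<xi>"
proof -
  have "continuous (at (x, \<xi>) within \<Omega> \<times> UNIV) (\<lambda>(x, \<xi>). M x \<xi>)"
    using M_continuous assms(3) by (auto simp: continuous_on_eq_continuous_within)
  from continuous_within_tendsto_compose'[OF this, of "\<lambda>n. (xs n, \<xi>s n)" sequentially]
  show ?thesis using assms by (simp add: tendsto_Pair)
qed

lemma measurable_M_compose:
  fixes V :: "real^'n \<Rightarrow> real^'n"
  assumes V: "V \<in> borel_measurable borel"
  shows "(\<lambda>x. indicator \<Omega> x * M x (V x)) \<in> borel_measurable borel"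
proof -
  have s: "\<Omega> \<times> (UNIV :: (real^'n) set) \<in> sets borel"
    by (intro borel_open open_Times \<Omega>_open open_UNIV)
  have "(\<lambda>p. indicator (\<Omega> \<times> UNIV) p *\<^sub>R (\<lambda>(x, \<xi>). M x \<xi>) p) \<in> borel_measurable borel"
    by (rule borel_measurable_continuous_on_indicator[OF s M_continuous])
  moreover have "(\<lambda>x. (x, V x)) \<in> borel_measurable borel"
    using V by (intro borel_measurable_Pair) auto
  ultimately have "(\<lambda>x. indicator (\<Omega> \<times> UNIV) (x, V x) *\<^sub>R (\<lambda>(x, \<xi>). M x \<xi>) (x, V x)) \<in> borel_measurable borel"
    by (rule measurable_compose[rotated])
  then show ?thesis by (simp add: indicator_def)
qed

end

text \<open>Both conditions say that \<open>M x \<xi>\<close> is a sum over \<open>i \<in> I\<close> of the values \<open>M x (\<bar>P i \<xi>\<bar> e\<^sub>i)\<close>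
  for linear contractions \<open>P i\<close>: the identity with a single unit vector in the isotropic case and
  the coordinate projections in the orthotropic one. Along each axis \<open>e\<^sub>i\<close> the values at nearby
  points are comparable, for arguments bounded in terms of the distance.\<close>

locale balanced_N_function = continuous_N_function \<Omega> M
  for \<Omega> :: "(real^'n) set" and M :: "real^'n \<Rightarrow> real^'n \<Rightarrow> real" +
  fixes I :: "'n set" and P :: "'n \<Rightarrow> real^'n \<Rightarrow> real^'n" and \<gamma> C :: real
  assumes C_ge_1: "C \<ge> 1"
    and P_linear: "\<And>i. i \<in> I \<Longrightarrow> bounded_linear (P i)"
    and P_norm: "\<And>i \<xi>. i \<in> I \<Longrightarrow> norm (P i \<xi>) \<le> norm \<xi>"
    and M_split: "\<And>x \<xi>. x \<in> \<Omega> \<Longrightarrow> M x \<xi> = (\<Sum>i\<in>I. M x (norm (P i \<xi>) *\<^sub>R axis i 1))"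
    and M_balanced: "\<And>i x y r t. i \<in> I \<Longrightarrow> x \<in> \<Omega> \<Longrightarrow> y \<in> \<Omega> \<Longrightarrow> 0 < r \<Longrightarrow> r \<le> 1 \<Longrightarrow> dist x y < r \<Longrightarrow>
        0 \<le> t \<Longrightarrow> t \<le> r powr (\<gamma> - 1) \<Longrightarrow> M x (t *\<^sub>R axis i 1) \<le> M y ((C * t) *\<^sub>R axis i 1) + 1"

lemma esssup_ge_continuous:
  fixes f :: "'a::euclidean_space \<Rightarrow> real"
  assumes "open U" "continuous_on U f" "x \<in> U"
  shows "ereal (f x) \<le> esssup (lebesgue_on U) (\<lambda>y. ereal (f y))"
proof -
  obtain xs where xs: "\<And>n. xs n \<in> U" "\<And>n. ereal (f (xs n)) \<le> esssup (lebesgue_on U) (\<lambda>y. ereal (f y))" "xs \<longlonglongrightarrow> x"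
    by (rule AE_lebesgue_on_sequence[OF assms(1) esssup_AE assms(3)]) (rule that)
  have "(\<lambda>n. f (xs n)) \<longlonglongrightarrow> f x"
    using assms(2) xs(3) by (rule continuous_on_tendsto_compose) (use assms(3) xs(1) in auto)
  then have "(\<lambda>n. ereal (f (xs n))) \<longlonglongrightarrow> ereal (f x)" by simp
  then show ?thesis by (rule LIMSEQ_le_const2) (use xs(2) in blast)
qed

text \<open>For continuous functions on an open set, essential bounds are bounds.\<close>

lemma N_plus_minus_pointwise:
  fixes m :: "real^'n \<Rightarrow> 'b \<Rightarrow> real"
  assumes "open \<Omega>" "continuous_on \<Omega> (\<lambda>x. m x s)" "continuous_on \<Omega> (\<lambda>x. m x t)"
    and le: "N_plus \<Omega> (ball z r) m s \<le> N_minus \<Omega> (ball z r) m t + 1"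
    and x: "x \<in> \<Omega>" "x \<in> ball z r" and y: "y \<in> \<Omega>" "y \<in> ball z r"
  shows "m x s \<le> m y t + 1"
proof -
  have U: "open (ball z r \<inter> \<Omega>)" using \<open>open \<Omega>\<close> by auto
  have "ereal (m x s) \<le> N_plus \<Omega> (ball z r) m s"
    unfolding N_plus_def
    by (rule esssup_ge_continuous[OF U]) (use assms(2) x in \<open>auto intro: continuous_on_subset\<close>)
  also note le
  also have "N_minus \<Omega> (ball z r) m t \<le> ereal (m y t)"
  proof -
    have "ereal (- m y t) \<le> esssup (lebesgue_on (ball z r \<inter> \<Omega>)) (\<lambda>y. ereal (- m y t))"
      by (rule esssup_ge_continuous[OF U]) (use assms(3) y in \<open>auto intro!: continuous_intros intro: continuous_on_subset\<close>)
    then show ?thesis unfolding N_minus_def by (simp add: ereal_uminus_le_reorder)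
  qed
  then have "N_minus \<Omega> (ball z r) m t + 1 \<le> ereal (m y t) + 1" by (rule add_right_mono)
  finally have "ereal (m x s) \<le> ereal (m y t + 1)" by (simp add: one_ereal_def)
  then show ?thesis by simp
qed

context continuous_N_function
begin

lemma continuous_on_M_fixed: "continuous_on \<Omega> (\<lambda>x. M x \<xi>)"
proof -
  have "continuous_on \<Omega> (\<lambda>x. (\<lambda>(x, \<xi>). M x \<xi>) (x, \<xi>))"
    by (rule continuous_on_compose2[OF M_continuous]) (auto intro!: continuous_intros)
  then show ?thesis by simp
qed

lemma balanced_iso:
  assumes "B_iso \<gamma> \<Omega> M"
  shows "\<exists>I P C. balanced_N_function \<Omega> M I P \<gamma> C"
proof -
  obtain m c C where m: "\<And>x \<xi>. x \<in> \<Omega> \<Longrightarrow> M x \<xi> = m x (norm \<xi>)" and cC: "c \<ge> 1" "C \<ge> 1"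
    and B: "\<And>z r \<xi>. 0 < r \<Longrightarrow> r \<le> 1 \<Longrightarrow> norm (\<xi> :: real^'n) \<le> c * r powr (\<gamma> - 1) \<Longrightarrow>
              N_plus \<Omega> (ball z r) m (norm \<xi>) \<le> N_minus \<Omega> (ball z r) m (C * norm \<xi>) + 1"
    using assms unfolding B_iso_def by blast
  define i :: 'n where "i = undefined"
  have mt: "m x t = M x (t *\<^sub>R axis i 1)" if "x \<in> \<Omega>" "t \<ge> 0" for x t
    using m[OF that(1), of "t *\<^sub>R axis i 1"] that(2) by simp
  have mc: "continuous_on \<Omega> (\<lambda>x. m x t)" if "t \<ge> 0" for t
    using continuous_on_M_fixed[of "t *\<^sub>R axis i 1"] mt that by (simp cong: continuous_on_cong)
  have "balanced_N_function \<Omega> M {i} (\<lambda>_ \<xi>. \<xi>) \<gamma> C"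
  proof (intro balanced_N_function.intro balanced_N_function_axioms.intro continuous_N_function_axioms)
    show "C \<ge> 1" by fact
    show "M x \<xi> = (\<Sum>i\<in>{i}. M x (norm \<xi> *\<^sub>R axis i 1))" if "x \<in> \<Omega>" for x \<xi>
      unfolding m[OF that, of \<xi>] by (simp only: mt[OF that norm_ge_zero]) simp
    fix j x y r t
    assume a: "j \<in> {i}" "x \<in> \<Omega>" "y \<in> \<Omega>" "0 < r" "r \<le> 1" "dist x y < r" "0 \<le> t" "t \<le> r powr (\<gamma> - 1)"
    have "t \<le> 1 * r powr (\<gamma> - 1)" using a(8) by simp
    also have "\<dots> \<le> c * r powr (\<gamma> - 1)" using cC by (intro mult_right_mono) auto
    finally have "norm (t *\<^sub>R axis i 1 :: real^'n) \<le> c * r powr (\<gamma> - 1)" using a(7) by simp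
    from B[OF a(4,5) this, of x] have "N_plus \<Omega> (ball x r) m t \<le> N_minus \<Omega> (ball x r) m (C * t) + 1"
      using a(7) by simp
    from N_plus_minus_pointwise[OF \<Omega>_open mc mc this a(2) _ a(3)] have "m x t \<le> m y (C * t) + 1"
      using a cC by simp
    then show "M x (t *\<^sub>R axis j 1) \<le> M y ((C * t) *\<^sub>R axis j 1) + 1"
      using a cC mt[of x t] mt[of y "C * t"] by simp
  qed (simp_all only: bounded_linear_ident order_refl)
  then show ?thesis by blast
qed

text \<open>Continuity is known for the sum only. It passes to the summands because each of them vanishes
  at zero, which makes it the restriction of \<open>M\<close> to an axis.\<close>

lemma balanced_ort:
  assumes "B_ort \<gamma> \<Omega> M"
  shows "\<exists>I P C. balanced_N_function \<Omega> M I P \<gamma> C"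
proof -
  obtain m :: "'n \<Rightarrow> real^'n \<Rightarrow> real \<Rightarrow> real" and c C where hm: "\<And>i. weak_N_function_half \<Omega> (m i)"
    and m: "\<And>x \<xi>. x \<in> \<Omega> \<Longrightarrow> M x \<xi> = (\<Sum>i\<in>UNIV. m i x \<bar>\<xi> $ i\<bar>)" and cC: "c \<ge> 1" "C \<ge> 1"
    and B: "\<And>z r i t. 0 < r \<Longrightarrow> r \<le> 1 \<Longrightarrow> \<bar>t\<bar> \<le> c * r powr (\<gamma> - 1) \<Longrightarrow>
              N_plus \<Omega> (ball z r) (m i) \<bar>t\<bar> \<le> N_minus \<Omega> (ball z r) (m i) (C * \<bar>t\<bar>) + 1"
    using assms unfolding B_ort_def by blast
  have nn: "0 \<le> m i x \<bar>t\<bar>" if "x \<in> \<Omega>" for i x t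
    using hm[of i] that by (simp add: weak_N_function_half_def weak_N_function_def)
  have m0: "m i x 0 = 0" if "x \<in> \<Omega>" for i x
  proof -
    have "(\<Sum>i\<in>UNIV. m i x 0) = 0" using m[OF that, of 0] M_zero[OF that] by simp
    moreover have "0 \<le> m i x 0" for i using nn[OF that, of i 0] by simp
    ultimately show ?thesis using sum_nonneg_0[of UNIV "\<lambda>i. m i x 0" i] by simp
  qed
  have mt: "m i x t = M x (t *\<^sub>R axis i 1)" if "x \<in> \<Omega>" "t \<ge> 0" for i x t
  proof -
    have "M x (t *\<^sub>R axis i 1) = (\<Sum>j\<in>UNIV. m j x \<bar>(t *\<^sub>R axis i 1) $ j\<bar>)" by (rule m[OF that(1)])
    also have "\<dots> = (\<Sum>j\<in>UNIV. if j = i then m i x t else 0)"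
      using that m0[OF that(1)] by (intro sum.cong) (auto simp: axis_def)
    finally show ?thesis by simp
  qed
  have mc: "continuous_on \<Omega> (\<lambda>x. m i x t)" if "t \<ge> 0" for i t
    using continuous_on_M_fixed[of "t *\<^sub>R axis i 1"] mt that by (simp cong: continuous_on_cong)
  have "balanced_N_function \<Omega> M UNIV (\<lambda>i \<xi>. (\<xi> $ i) *\<^sub>R axis i 1) \<gamma> C"
  proof (intro balanced_N_function.intro balanced_N_function_axioms.intro continuous_N_function_axioms)
    show "C \<ge> 1" by fact
    show "bounded_linear (\<lambda>\<xi>. (\<xi> $ i) *\<^sub>R axis i (1::real) :: real^'n)" for i
      by (intro bounded_linear_scaleR_const bounded_linear_vec_nth)
    show "norm ((\<xi> $ i) *\<^sub>R axis i (1::real) :: real^'n) \<le> norm \<xi>" for i and \<xi> :: "real^'n"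
      using component_le_norm_cart[of \<xi> i] by simp
    show "M x \<xi> = (\<Sum>i\<in>UNIV. M x (norm ((\<xi> $ i) *\<^sub>R axis i (1::real) :: real^'n) *\<^sub>R axis i 1))" if "x \<in> \<Omega>" for x \<xi>
      unfolding m[OF that, of \<xi>] by (intro sum.cong refl) (simp only: mt[OF that abs_ge_zero] norm_scaleR norm_axis_1 mult_1_right)
    fix i x y r t
    assume a: "x \<in> \<Omega>" "y \<in> \<Omega>" "0 < r" "r \<le> 1" "dist x y < r" "0 \<le> t" "t \<le> r powr (\<gamma> - 1)"
    have "t \<le> 1 * r powr (\<gamma> - 1)" using a(7) by simp
    also have "\<dots> \<le> c * r powr (\<gamma> - 1)" using cC by (intro mult_right_mono) auto
    finally have "\<bar>t\<bar> \<le> c * r powr (\<gamma> - 1)" using a(6) by simp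
    from B[OF a(3,4) this, of x i] have "N_plus \<Omega> (ball x r) (m i) t \<le> N_minus \<Omega> (ball x r) (m i) (C * t) + 1"
      using a(6) by simp
    from N_plus_minus_pointwise[OF \<Omega>_open mc mc this a(1) _ a(2)] have "m i x t \<le> m i y (C * t) + 1"
      using a cC by simp
    then show "M x (t *\<^sub>R axis i 1) \<le> M y ((C * t) *\<^sub>R axis i 1) + 1"
      using a cC mt[of x t i] mt[of y "C * t" i] by simp
  qed
  then show ?thesis by blast
qed

end

section \<open>The pointwise estimate\<close>

context balanced_N_function
begin

text \<open>The estimate behind the theorem, for an average of mollifications \<open>conv (k l) G\<close> at
  increasing scales \<open>r l\<close>. Let \<open>t\<close> be the size of the average. Among the scales whose tail of
  larger scales still contributes \<open>t / 2\<close>, let \<open>j\<close> be the largest. The bound on the tail makes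
  \<open>t / 2\<close> admissible on the ball of radius \<open>r j\<close>, while the scales up to \<open>j\<close>, which only see that
  ball, contribute the other half of \<open>t\<close>. So \<open>t / 2\<close> is compared on this ball with the averages
  of \<open>G\<close>; the comparison with the linear function \<open>f \<mapsto> f - t / 2\<close> replaces Jensen's
  inequality, which is not available since an infimum of convex functions need not be convex.
  The tails decrease as \<open>L\<close> grows, so that \<open>\<mu>\<close> may stay fixed for larger and larger mollifications \<open>conv (k l) G\<close>.\<close>

lemma multiscale_estimate:
  fixes G :: "real^'n \<Rightarrow> real^'n" and L :: nat
  assumes i: "i \<in> I" and x: "x \<in> \<Omega>" and L: "L > 0" and \<mu>: "\<mu> > 0"
    and k: "\<And>l. l < L \<Longrightarrow> mollifier_on (S l) (k l)" "\<And>l. l < L \<Longrightarrow> S l \<subseteq> ball 0 (r l)"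
    and r: "\<And>l. l < L \<Longrightarrow> 0 < r l \<and> r l \<le> 1" "\<And>l l'. l \<le> l' \<Longrightarrow> l' < L \<Longrightarrow> r l \<le> r l'"
    and G: "integrable lborel G" "\<And>y. y \<notin> \<Omega> \<Longrightarrow> G y = 0"
    and H: "integrable lborel H" "\<And>y. y \<notin> \<Omega> \<Longrightarrow> H y = 0"
      "\<And>y. y \<in> \<Omega> \<Longrightarrow> H y = M y ((2 * C * \<mu> * norm (P i (G y))) *\<^sub>R axis i 1)"
    and tail: "\<And>j. j < L \<Longrightarrow> \<mu> / L * (\<Sum>l\<in>{j..<L}. norm (conv (k l) G x)) \<le> r j powr (\<gamma> - 1)"
  shows "M x ((\<mu> / 2 * norm (P i ((1 / L) *\<^sub>R (\<Sum>l<L. conv (k l) G x)))) *\<^sub>R axis i 1)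
    \<le> 1 + (1 / L) * (\<Sum>l<L. conv (k l) H x)"
proof -
  interpret P: bounded_linear "P i" by (rule P_linear[OF i])
  let ?m = "\<lambda>y t. M y (t *\<^sub>R axis i 1)"
  define a where "a l = norm (P i (conv (k l) G x))" for l
  define T where "T j = \<mu> / L * (\<Sum>l\<in>{j..<L}. a l)" for j
  define t where "t = \<mu> * norm (P i ((1 / L) *\<^sub>R (\<Sum>l<L. conv (k l) G x)))"
  have kS: "kernel_on (S l) (k l)" and k0: "0 \<le> k l z" and k1: "(LINT z|lborel. k l z) = 1" if "l < L" for l z
    using k(1)[OF that] by (auto simp: mollifier_on_def)
  have H0: "0 \<le> H y" for y using H(2,3)[of y] M_nonneg[of y] by (cases "y \<in> \<Omega>") auto
  have conv_H: "0 \<le> conv (k l) H x" if "l < L" for l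
    unfolding conv_def using k0[OF that] H0 by (intro Bochner_Integration.integral_nonneg) auto
  have rhs: "1 \<le> 1 + (1 / L) * (\<Sum>l<L. conv (k l) H x)"
  proof -
    have "0 \<le> (1 / L) * (\<Sum>l<L. conv (k l) H x)"
      by (intro mult_nonneg_nonneg sum_nonneg conv_H) auto
    then show ?thesis by linarith
  qed
  have t_T: "t \<le> T 0"
  proof -
    have "norm (P i ((1 / L) *\<^sub>R (\<Sum>l<L. conv (k l) G x))) = (1 / L) * norm (\<Sum>l<L. P i (conv (k l) G x))"
      by (simp add: P.scaleR P.sum)
    also have "\<dots> \<le> (1 / L) * (\<Sum>l<L. a l)"
      unfolding a_def by (intro mult_left_mono norm_sum) simp
    finally have "t \<le> \<mu> * ((1 / L) * (\<Sum>l<L. a l))"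
      unfolding t_def using \<mu> by (intro mult_left_mono) auto
    then show ?thesis by (simp add: T_def lessThan_atLeast0)
  qed
  have T_bound: "T j \<le> r j powr (\<gamma> - 1)" if "j < L" for j
  proof -
    have "T j \<le> \<mu> / L * (\<Sum>l\<in>{j..<L}. norm (conv (k l) G x))"
      unfolding T_def a_def using \<mu> by (intro mult_left_mono sum_mono P_norm[OF i]) auto
    then show ?thesis using tail[OF that] by linarith
  qed
  have t0: "0 \<le> t" using \<mu> by (simp add: t_def)
  show ?thesis
  proof (cases "?m x (t / 2) \<le> 1")
    case True
    then show ?thesis using rhs by (simp add: t_def)
  next
    case False
    define N where "N = ?m x (t / 2) - 1"
    have N: "N > 0" using False by (simp add: N_def)
    have t: "t > 0"
    proof (rule ccontr)
      assume "\<not> t > 0"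
      then have "t = 0" using t0 by simp
      then show False using False M_zero[OF x] by simp
    qed
    define J where "J = {j. j < L \<and> t / 2 \<le> T j}"
    have J: "finite J" "0 \<in> J" using L t_T t by (auto simp: J_def)
    define j where "j = Max J"
    have "j \<in> J" unfolding j_def using J by (intro Max_in) auto
    then have j: "j < L" "t / 2 \<le> T j" by (auto simp: J_def)
    have next_tail: "T (Suc j) \<le> t / 2"
    proof (cases "Suc j < L")
      case True
      have "Suc j \<notin> J" using Max_ge[OF J(1), of "Suc j"] by (auto simp: j_def)
      then show ?thesis using True by (simp add: J_def)
    next
      case False
      then show ?thesis using t by (simp add: T_def)
    qed
    have adm: "t / 2 \<le> r j powr (\<gamma> - 1)" using j T_bound[OF j(1)] by linarith
    have r_j: "0 < r j" "r j \<le> 1" using r(1)[OF j(1)] by auto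
    have lL: "l < L" if "l \<le> j" for l using that j(1) by simp
    have "T 0 = \<mu> / L * (\<Sum>l\<in>{0..<Suc j}. a l) + T (Suc j)"
      using j(1) unfolding T_def distrib_left[symmetric]
      by (subst sum.atLeastLessThan_concat) auto
    then have "T 0 = \<mu> / L * (\<Sum>l\<le>j. a l) + T (Suc j)"
      by (simp only: atLeast0LessThan lessThan_Suc_atMost)
    then have small: "t / 2 \<le> \<mu> / L * (\<Sum>l\<le>j. a l)"
      using t_T next_tail by linarith
    define f where "f y = 2 * \<mu> * norm (P i (G y))" for y
    define K where "K y = (1 / L) * (\<Sum>l\<le>j. k l (x - y))" for y
    have K0: "0 \<le> K y" for y unfolding K_def by (intro mult_nonneg_nonneg sum_nonneg k0 lL) auto
    have f0: "0 \<le> f y" for y using \<mu> by (simp add: f_def)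
    have PG: "integrable lborel (\<lambda>y. norm (P i (G y)))"
      by (intro integrable_norm integrable_bounded_linear[OF P_linear[OF i] G(1)])
    have ik: "integrable lborel (\<lambda>y. k l (x - y))" if "l \<le> j" for l
      by (intro integrable_lborel_reflect kernel_on_integrable(1)[OF kS[OF lL[OF that]]])
    have iPG: "integrable lborel (\<lambda>y. k l (x - y) * norm (P i (G y)))" if "l \<le> j" for l
      using integrable_conv[OF PG kS[OF lL[OF that]], of x] by simp
    have iH: "integrable lborel (\<lambda>y. k l (x - y) * H y)" if "l \<le> j" for l
      using integrable_conv[OF H(1) kS[OF lL[OF that]], of x] by simp
    have iK: "integrable lborel K" unfolding K_def
      by (intro integrable_mult_right Bochner_Integration.integrable_sum ik) auto
    have K_mass: "(LINT y|lborel. K y) \<le> 1"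
    proof -
      have "(LINT y|lborel. K y) = (1 / L) * (\<Sum>l\<le>j. LINT y|lborel. k l (x - y))"
        unfolding K_def using ik by simp
      also have "\<dots> = (1 / L) * (\<Sum>l\<le>j. 1)"
      proof (intro arg_cong[where f="\<lambda>s. (1 / L) * s"] sum.cong refl)
        fix l assume "l \<in> {..j}"
        then have l: "l < L" using lL by simp
        show "(LINT y|lborel. k l (x - y)) = 1"
          using integral_lborel_reflect[OF kernel_onD(8)[OF kS[OF l]], of x] k1[OF l] by simp
      qed
      also have "\<dots> \<le> 1" using j(1) L by simp
      finally show ?thesis .
    qed
    have fK_eq: "f y * K y = (2 * \<mu> / L) * (\<Sum>l\<le>j. k l (x - y) * norm (P i (G y)))" for y
      by (simp add: f_def K_def sum_distrib_left sum_distrib_right algebra_simps)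
    have ifK: "integrable lborel (\<lambda>y. f y * K y)" unfolding fK_eq
      by (intro integrable_mult_right Bochner_Integration.integrable_sum iPG) auto
    have HK_eq: "H y * K y = (1 / L) * (\<Sum>l\<le>j. k l (x - y) * H y)" for y
      by (simp add: K_def sum_distrib_left sum_distrib_right algebra_simps)
    have iHK: "integrable lborel (\<lambda>y. H y * K y)" unfolding HK_eq
      by (intro integrable_mult_right Bochner_Integration.integrable_sum iH) auto
    have fK: "t \<le> (LINT y|lborel. f y * K y)"
    proof -
      have a_le: "a l \<le> (LINT y|lborel. k l (x - y) * norm (P i (G y)))" if l: "l \<le> j" for l
      proof -
        have "P i (conv (k l) G x) = (LINT y|lborel. P i (k l (x - y) *\<^sub>R G y))"
          unfolding conv_def
          by (rule integral_bounded_linear[OF P_linear[OF i] integrable_conv[OF G(1) kS[OF lL[OF l]]], symmetric])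
        also have "norm \<dots> \<le> (LINT y|lborel. norm (P i (k l (x - y) *\<^sub>R G y)))"
          by (rule integral_norm_bound)
        also have "\<dots> = (LINT y|lborel. k l (x - y) * norm (P i (G y)))"
          using k0[OF lL[OF l]] by (simp add: P.scaleR)
        finally show ?thesis by (simp add: a_def)
      qed
      have "(2 * \<mu> / L) * (\<Sum>l\<le>j. a l) = 2 * (\<mu> / L * (\<Sum>l\<le>j. a l))" by simp
      then have "t \<le> (2 * \<mu> / L) * (\<Sum>l\<le>j. a l)" using small by linarith
      also have "\<dots> \<le> (2 * \<mu> / L) * (\<Sum>l\<le>j. LINT y|lborel. k l (x - y) * norm (P i (G y)))"
        using \<mu> a_le by (intro mult_left_mono sum_mono) auto
      also have "\<dots> = (LINT y|lborel. f y * K y)"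
        unfolding fK_eq using iPG by simp
      finally show ?thesis .
    qed
    have pointwise: "(2 / t) * N * (f y * K y - (t / 2) * K y) \<le> H y * K y" for y
    proof (cases "K y = 0 \<or> f y \<le> t / 2")
      case True
      have "(f y - t / 2) * K y \<le> 0"
        using True K0[of y] by (cases "K y = 0") (auto intro: mult_nonpos_nonneg)
      moreover have "0 \<le> (2 / t) * N" using t N by simp
      ultimately have "(2 / t) * N * (f y * K y - (t / 2) * K y) \<le> 0"
        unfolding left_diff_distrib[symmetric] by (rule mult_nonneg_nonpos[rotated])
      also have "0 \<le> H y * K y" using H0 K0 by simp
      finally show ?thesis .
    next
      case False
      then have fy: "t / 2 < f y" and Ky: "K y \<noteq> 0" by auto
      have "G y \<noteq> 0" using fy t by (auto simp: f_def P.zero)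
      then have y: "y \<in> \<Omega>" using G(2) by blast
      from Ky obtain l where l: "l \<le> j" "k l (x - y) \<noteq> 0"
        unfolding K_def by (metis atMost_iff mult_zero_right sum.neutral)
      have "x - y \<in> S l" using kernel_onD(3)[OF kS[OF lL[OF l(1)]]] l(2) by blast
      then have "x - y \<in> ball 0 (r l)" by (rule subsetD[OF k(2)[OF lL[OF l(1)]]])
      then have "dist x y < r l" by (simp add: dist_norm norm_minus_commute)
      then have "dist x y < r j" using r(2)[OF l(1) j(1)] by simp
      from M_balanced[OF i x y r_j this _ adm] have bal: "N \<le> ?m y (C * (t / 2))"
        using t by (simp add: N_def)
      have ft: "1 \<le> 2 * f y / t" using fy t by (simp add: field_simps)
      have "(2 / t) * N * (f y - t / 2) \<le> (2 / t) * N * f y"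
        using t N by (intro mult_left_mono) auto
      also have "\<dots> = (2 * f y / t) * N" by simp
      also have "\<dots> \<le> (2 * f y / t) * ?m y (C * (t / 2))"
        using ft bal by (intro mult_left_mono) auto
      also have "\<dots> \<le> M y ((2 * f y / t) *\<^sub>R (C * (t / 2)) *\<^sub>R axis i 1)"
        by (rule M_scale_ge[OF y ft])
      also have "\<dots> = H y"
        unfolding H(3)[OF y] using t
        by (intro arg_cong[where f="M y"]) (simp add: f_def field_simps)
      finally have "(2 / t) * N * (f y - t / 2) * K y \<le> H y * K y"
        using K0 by (rule mult_right_mono)
      then show ?thesis by (simp only: left_diff_distrib[symmetric] mult.assoc)
    qed
    have "N = (2 / t) * N * (t - t / 2 * 1)" using t by (simp add: field_simps)
    also have "\<dots> \<le> (2 / t) * N * ((LINT y|lborel. f y * K y) - (t / 2) * (LINT y|lborel. K y))"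
      using t N fK K_mass by (intro mult_left_mono diff_mono) auto
    also have "\<dots> = (LINT y|lborel. (2 / t) * N * (f y * K y - (t / 2) * K y))"
      using ifK iK by (simp only: integral_mult_right_zero Bochner_Integration.integral_diff integrable_mult_right)
    also have "\<dots> \<le> (LINT y|lborel. H y * K y)"
      by (intro integral_mono[OF _ iHK pointwise] integrable_mult_right Bochner_Integration.integrable_diff ifK iK)
    also have "\<dots> = (1 / L) * (\<Sum>l\<le>j. conv (k l) H x)"
      unfolding HK_eq conv_def using iH by simp
    also have "\<dots> \<le> (1 / L) * (\<Sum>l<L. conv (k l) H x)"
      using conv_H lL by (intro mult_left_mono sum_mono2) auto
    finally show ?thesis by (simp add: N_def t_def)
  qed
qed

end

section \<open>Approximation of bounded functions\<close>

definition L1_tendsto :: "(nat \<Rightarrow> 'a::euclidean_space \<Rightarrow> 'b::{banach, second_countable_topology}) \<Rightarrow> ('a \<Rightarrow> 'b) \<Rightarrow> bool" where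
  "L1_tendsto a b \<longleftrightarrow> (\<forall>n. integrable lborel (a n)) \<and> integrable lborel b \<and>
     (\<lambda>n. LINT x|lborel. norm (a n x - b x)) \<longlonglongrightarrow> 0"

lemma L1_tendsto_const: "integrable lborel b \<Longrightarrow> L1_tendsto (\<lambda>n. b) b"
  by (simp add: L1_tendsto_def)

lemma L1_tendsto_scaleR:
  assumes "L1_tendsto a b"
  shows "L1_tendsto (\<lambda>n x. c *\<^sub>R a n x) (\<lambda>x. c *\<^sub>R b x)"
proof -
  have "(LINT x|lborel. norm (c *\<^sub>R a n x - c *\<^sub>R b x)) = \<bar>c\<bar> * (LINT x|lborel. norm (a n x - b x))" for n
    by (simp add: scaleR_diff_right[symmetric])
  moreover have "(\<lambda>n. \<bar>c\<bar> * (LINT x|lborel. norm (a n x - b x))) \<longlonglongrightarrow> 0"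
    using tendsto_mult_left[of _ 0 sequentially "\<bar>c\<bar>"] assms by (simp add: L1_tendsto_def)
  ultimately show ?thesis using assms by (simp add: L1_tendsto_def integrable_scaleR_right)
qed

lemma L1_tendsto_add:
  assumes "L1_tendsto a b" "L1_tendsto a' b'"
  shows "L1_tendsto (\<lambda>n x. a n x + a' n x) (\<lambda>x. b x + b' x)"
proof -
  have i: "integrable lborel (a n)" "integrable lborel (a' n)" "integrable lborel b" "integrable lborel b'" for n
    using assms by (auto simp: L1_tendsto_def)
  have "(\<lambda>n. LINT x|lborel. norm ((a n x + a' n x) - (b x + b' x))) \<longlonglongrightarrow> 0"
  proof (rule tendsto_0_squeeze)
    show "(\<lambda>n. (LINT x|lborel. norm (a n x - b x)) + (LINT x|lborel. norm (a' n x - b' x))) \<longlonglongrightarrow> 0"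
    proof -
      have "(\<lambda>n. LINT x|lborel. norm (a n x - b x)) \<longlonglongrightarrow> 0" "(\<lambda>n. LINT x|lborel. norm (a' n x - b' x)) \<longlonglongrightarrow> 0"
        using assms unfolding L1_tendsto_def by blast+
      from tendsto_add[OF this] show ?thesis by simp
    qed
    fix n
    show "0 \<le> (LINT x|lborel. norm ((a n x + a' n x) - (b x + b' x)))" by simp
    have "(LINT x|lborel. norm ((a n x + a' n x) - (b x + b' x)))
       \<le> (LINT x|lborel. norm (a n x - b x) + norm (a' n x - b' x))"
      by (intro integral_mono norm_diff_triangle_ineq integrable_norm Bochner_Integration.integrable_add
          Bochner_Integration.integrable_diff i)
    also have "\<dots> = (LINT x|lborel. norm (a n x - b x)) + (LINT x|lborel. norm (a' n x - b' x))"
      by (intro Bochner_Integration.integral_add integrable_norm Bochner_Integration.integrable_diff i)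
    finally show "(LINT x|lborel. norm ((a n x + a' n x) - (b x + b' x)))
       \<le> (LINT x|lborel. norm (a n x - b x)) + (LINT x|lborel. norm (a' n x - b' x))" .
  qed
  then show ?thesis using i by (simp add: L1_tendsto_def)
qed

lemma L1_tendsto_sum:
  assumes "\<And>j. j \<in> J \<Longrightarrow> L1_tendsto (a j) (b j)"
  shows "L1_tendsto (\<lambda>n x. \<Sum>j\<in>J. a j n x) (\<lambda>x. \<Sum>j\<in>J. b j x)"
  using assms
proof (induction J rule: infinite_finite_induct)
  case (insert j J)
  then have "L1_tendsto (\<lambda>n x. a j n x + (\<Sum>j\<in>J. a j n x)) (\<lambda>x. b j x + (\<Sum>j\<in>J. b j x))"
    by (intro L1_tendsto_add) auto
  with insert show ?case by simp
qed (simp_all add: L1_tendsto_def)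

lemma L1_tendsto_conv:
  fixes f :: "real^'n \<Rightarrow> 'b::{banach, second_countable_topology}"
  assumes f: "integrable lborel f"
    and k: "\<And>n. mollifier_on (S n) (k n)" "\<And>n. S n \<subseteq> cball 0 (r n)" "r \<longlonglongrightarrow> 0"
  shows "L1_tendsto (\<lambda>n. conv (k n) f) f"
  unfolding L1_tendsto_def
proof (intro conjI allI)
  show "integrable lborel (conv (k n) f)" for n
    using k(1)[of n] by (intro integrable_conv_Young[OF _ f] kernel_on_integrable) (auto simp: mollifier_on_def)
  show "(\<lambda>n. LINT x|lborel. norm (conv (k n) f x - f x)) \<longlonglongrightarrow> 0"
    by (rule conv_mollifier_L1_tendsto[OF f k])
qed (rule f)

lemma grad_sum:
  fixes f :: "'j \<Rightarrow> real^'n \<Rightarrow> real"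
  assumes "\<And>j. j \<in> J \<Longrightarrow> f j differentiable (at x)"
  shows "grad (\<lambda>x. \<Sum>j\<in>J. f j x) x = (\<Sum>j\<in>J. grad (f j) x)"
proof (rule grad_eqI)
  have "((\<lambda>x. \<Sum>j\<in>J. f j x) has_derivative (\<lambda>h. \<Sum>j\<in>J. grad (f j) x \<bullet> h)) (at x)"
    by (intro has_derivative_sum has_derivative_grad assms)
  then show "((\<lambda>x. \<Sum>j\<in>J. f j x) has_derivative (\<lambda>h. (\<Sum>j\<in>J. grad (f j) x) \<bullet> h)) (at x)"
    by (simp add: inner_sum_left)
qed

lemma grad_cmult:
  fixes f :: "real^'n \<Rightarrow> real"
  assumes "f differentiable (at x)"
  shows "grad (\<lambda>x. c * f x) x = c *\<^sub>R grad f x"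
  using has_derivative_mult_right[OF has_derivative_grad[OF assms], of c] by (intro grad_eqI) simp

lemma Cc_infinity_0: "(\<lambda>x. 0) \<in> Cc_infinity \<Omega>"
  by (rule Cc_infinityI[where S="{}"]) auto

lemma Cc_infinity_add:
  assumes "u \<in> Cc_infinity \<Omega>" "v \<in> Cc_infinity \<Omega>"
  shows "(\<lambda>x. u x + v x) \<in> Cc_infinity \<Omega>"
proof (rule Cc_infinityI[where S="closure {x. u x \<noteq> 0} \<union> closure {x. v x \<noteq> 0}"])
  show "C_k j (\<lambda>x. u x + v x)" for j by (intro C_k_add Cc_infinityD(3)[OF assms(1)] Cc_infinityD(3)[OF assms(2)])
  show "compact (closure {x. u x \<noteq> 0} \<union> closure {x. v x \<noteq> 0})"
    by (intro compact_Un Cc_infinityD(4)[OF assms(1)] Cc_infinityD(4)[OF assms(2)])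
  show "closure {x. u x \<noteq> 0} \<union> closure {x. v x \<noteq> 0} \<subseteq> \<Omega>"
    by (intro Un_least Cc_infinityD(2)[OF assms(1)] Cc_infinityD(2)[OF assms(2)])
  show "u x + v x = 0" if "x \<notin> closure {x. u x \<noteq> 0} \<union> closure {x. v x \<noteq> 0}" for x
    using that kernel_onD(3)[OF Cc_infinityD(1)[OF assms(1)], of x]
      kernel_onD(3)[OF Cc_infinityD(1)[OF assms(2)], of x] by simp
qed

lemma Cc_infinity_cmult:
  assumes "u \<in> Cc_infinity \<Omega>"
  shows "(\<lambda>x. c * u x) \<in> Cc_infinity \<Omega>"
proof (rule Cc_infinityI[where S="closure {x. u x \<noteq> 0}"])
  show "C_k j (\<lambda>x. c * u x)" for j by (intro C_k_mult C_k_const Cc_infinityD(3)[OF assms])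
  show "c * u x = 0" if "x \<notin> closure {x. u x \<noteq> 0}" for x
    using kernel_onD(3)[OF Cc_infinityD(1)[OF assms] that] by simp
qed (rule Cc_infinityD(4,2)[OF assms])+

lemma Cc_infinity_sum:
  assumes "\<And>j. j \<in> J \<Longrightarrow> u j \<in> Cc_infinity \<Omega>"
  shows "(\<lambda>x. \<Sum>j\<in>J. u j x) \<in> Cc_infinity \<Omega>"
  using assms
  by (induction J rule: infinite_finite_induct) (auto intro: Cc_infinity_0 Cc_infinity_add)

lemma Cc_infinity_differentiable: "u \<in> Cc_infinity \<Omega> \<Longrightarrow> u differentiable (at x)"
  by (rule C_k_differentiable[OF Cc_infinityD(3)])

lemma abs_conv_mollifier_le:
  fixes f :: "real^'n \<Rightarrow> real"
  assumes k: "mollifier_on S k" and f: "integrable lborel f" "AE y in lborel. \<bar>f y\<bar> \<le> B"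
  shows "\<bar>conv k f x\<bar> \<le> B"
proof -
  have kS: "kernel_on S k" and k0: "\<And>z. 0 \<le> k z" and k1: "(LINT z|lborel. k z) = 1"
    using k by (auto simp: mollifier_on_def)
  have ik: "integrable lborel (\<lambda>y. k (x - y))"
    by (rule integrable_lborel_reflect[OF kernel_on_integrable(1)[OF kS]])
  have i: "integrable lborel (\<lambda>y. k (x - y) * f y)" using integrable_conv[OF f(1) kS, of x] by simp
  have "\<bar>conv k f x\<bar> \<le> (LINT y|lborel. \<bar>k (x - y) * f y\<bar>)"
    unfolding conv_def real_scaleR_def by (rule integral_abs_bound)
  also have "\<dots> \<le> (LINT y|lborel. B * k (x - y))"
  proof (rule integral_mono_AE)
    show "AE y in lborel. \<bar>k (x - y) * f y\<bar> \<le> B * k (x - y)"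
      using f(2)
    proof eventually_elim
      case (elim y)
      then show ?case using k0[of "x - y"] by (simp add: abs_mult mult.commute[of B] mult_left_mono)
    qed
  qed (use i ik in auto)
  also have "\<dots> = B" using integral_lborel_reflect[OF kernel_onD(8)[OF kS], of x] k1 by simp
  finally show ?thesis .
qed

locale approximation = cutoff_system \<Omega> Z \<theta> S k A D s0 + balanced_N_function \<Omega> M I P \<gamma> C
  for \<Omega> :: "(real^'n) set" and Z \<theta> S k A D s0 M I P \<gamma> C
begin

abbreviation "J \<equiv> real (card Z)"

lemma J_ge_1: "J \<ge> 1"
  using finite_Z Z_nonempty by (simp add: card_gt_0_iff Suc_leI)

lemma sum_grad_\<theta>:
  assumes x: "x \<in> \<Omega>"
  shows "(\<Sum>z\<in>Z. grad (\<theta> z) x) = 0"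
proof -
  have "grad (\<lambda>x. \<Sum>z\<in>Z. \<theta> z x) x = (\<Sum>z\<in>Z. grad (\<theta> z) x)"
    by (rule grad_sum) (rule C_k_differentiable[OF \<theta>_C1[unfolded One_nat_def]])
  moreover have "((\<lambda>x. \<Sum>z\<in>Z. \<theta> z x) has_derivative (\<lambda>h. 0)) (at x)"
    by (rule has_derivative_transform_within_open[OF has_derivative_const[of 1] open_domain x])
      (simp add: sum_\<theta>)
  then have "grad (\<lambda>x. \<Sum>z\<in>Z. \<theta> z x) x = 0" by (intro grad_eqI) simp
  ultimately show ?thesis by simp
qed

lemma localized:
  assumes "sobolev0 \<Omega> f G" "z \<in> Z"
  shows "sobolev0 \<Omega> (\<lambda>x. \<theta> z x * f x) (\<lambda>x. \<theta> z x *\<^sub>R G x + f x *\<^sub>R grad (\<theta> z) x)"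
  using assms \<theta>_nonneg \<theta>_le_1 grad_\<theta> \<theta>_C1
  by (intro sobolev0_mult[where T=1 and D=D]) auto

text \<open>The additional term \<open>f grad \<theta>\<close> of the product rule is bounded, because \<open>f\<close> is.\<close>

lemma localized_energy_integrable:
  assumes W: "sobolev0 \<Omega> f G" and f: "\<And>x. \<bar>f x\<bar> \<le> N" and fin: "emeasure lborel \<Omega> < \<infinity>" and a: "a \<ge> 0"
    and G: "integrable lborel (\<lambda>x. indicator \<Omega> x * M x ((2 * a) *\<^sub>R G x))" and z: "z \<in> Z"
  shows "integrable lborel (\<lambda>x. indicator \<Omega> x * M x (a *\<^sub>R (\<theta> z x *\<^sub>R G x + f x *\<^sub>R grad (\<theta> z) x)))"
proof -
  let ?\<Gamma> = "\<lambda>x. \<theta> z x *\<^sub>R G x + f x *\<^sub>R grad (\<theta> z) x"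
  have N: "N \<ge> 0" using f[of 0] by linarith
  have D: "D \<ge> 0" using order_trans[OF norm_ge_zero grad_\<theta>[OF z, of 0]] .
  obtain B where B: "\<And>x \<xi>. x \<in> \<Omega> \<Longrightarrow> norm \<xi> \<le> 2 * a * N * D \<Longrightarrow> M x \<xi> \<le> B" using M_bounded by blast
  have "(\<lambda>x. a *\<^sub>R ?\<Gamma> x) \<in> borel_measurable borel"
    using sobolev0D(6)[OF localized[OF W z]] by measurable
  from measurable_M_compose[OF this]
  have m: "(\<lambda>x. indicator \<Omega> x * M x (a *\<^sub>R ?\<Gamma> x)) \<in> borel_measurable borel" .
  show ?thesis
  proof (rule Bochner_Integration.integrable_bound[where f="\<lambda>x. indicator \<Omega> x * M x ((2 * a) *\<^sub>R G x) + B * indicator \<Omega> x"])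
    show "integrable lborel (\<lambda>x. indicator \<Omega> x * M x ((2 * a) *\<^sub>R G x) + B * indicator \<Omega> x)"
      using G fin open_domain by (intro Bochner_Integration.integrable_add integrable_mult_right integrable_real_indicator) auto
    show "AE x in lborel. norm (indicator \<Omega> x * M x (a *\<^sub>R ?\<Gamma> x)) \<le> norm (indicator \<Omega> x * M x ((2 * a) *\<^sub>R G x) + B * indicator \<Omega> x)"
    proof (rule AE_I2)
      fix x
      show "norm (indicator \<Omega> x * M x (a *\<^sub>R ?\<Gamma> x)) \<le> norm (indicator \<Omega> x * M x ((2 * a) *\<^sub>R G x) + B * indicator \<Omega> x)"
      proof (cases "x \<in> \<Omega>")
        case True
        have "M x (a *\<^sub>R ?\<Gamma> x) \<le> M x ((2 * a * \<theta> z x) *\<^sub>R G x) / 2 + M x ((2 * a * f x) *\<^sub>R grad (\<theta> z) x) / 2"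
          using M_midpoint[OF True, of "(a * \<theta> z x) *\<^sub>R G x" "(a * f x) *\<^sub>R grad (\<theta> z) x"]
          by (simp add: scaleR_add_right mult.assoc)
        also have "M x ((2 * a * \<theta> z x) *\<^sub>R G x) \<le> M x ((2 * a) *\<^sub>R G x)"
          using a \<theta>_nonneg[OF z] \<theta>_le_1[OF z] by (intro M_scale_mono[OF True]) (auto simp: mult_left_le)
        also have "M x ((2 * a * f x) *\<^sub>R grad (\<theta> z) x) \<le> B"
        proof (rule B[OF True])
          have "norm ((2 * a * f x) *\<^sub>R grad (\<theta> z) x) = 2 * a * \<bar>f x\<bar> * norm (grad (\<theta> z) x)"
            using a by (simp add: abs_mult)
          also have "\<dots> \<le> 2 * a * N * D"
            using a N f[of x] grad_\<theta>[OF z, of x] by (intro mult_mono) auto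
          finally show "norm ((2 * a * f x) *\<^sub>R grad (\<theta> z) x) \<le> 2 * a * N * D" .
        qed
        finally have "M x (a *\<^sub>R ?\<Gamma> x) \<le> M x ((2 * a) *\<^sub>R G x) / 2 + B / 2" by simp
        moreover have "0 \<le> M x (a *\<^sub>R ?\<Gamma> x)" "0 \<le> M x ((2 * a) *\<^sub>R G x)" by (rule M_nonneg[OF True])+
        moreover have "0 \<le> B" using B[OF True, of 0] a N D M_zero[OF True] by simp
        ultimately show ?thesis using True by simp
      qed simp
    qed
  qed (use m in simp)
qed

text \<open>The pointwise estimate is summed over the axes. Both the energy of the average and the
  mollified energies then recombine to values of \<open>M\<close>.\<close>

lemma energy_of_average:
  fixes \<Gamma> :: "real^'n \<Rightarrow> real^'n" and L :: nat
  assumes x: "x \<in> \<Omega>" and z: "z \<in> Z" and L: "L > 0" and \<mu>: "\<mu> > 0" and s: "0 < s" "4 * 2 ^ L * s \<le> 1"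
    and \<Gamma>: "integrable lborel \<Gamma>" "\<And>y. y \<notin> \<Omega> \<Longrightarrow> \<Gamma> y = 0"
    and H: "integrable lborel (\<lambda>y. indicator \<Omega> y * M y ((2 * C * \<mu>) *\<^sub>R \<Gamma> y))"
    and tail: "\<And>j. j < L \<Longrightarrow> \<mu> / L * (\<Sum>l\<in>{j..<L}. norm (conv (k z (2 ^ l * s)) \<Gamma> x)) \<le> (4 * 2 ^ j * s) powr (\<gamma> - 1)"
  shows "M x ((\<mu> / 2) *\<^sub>R ((1 / L) *\<^sub>R (\<Sum>l<L. conv (k z (2 ^ l * s)) \<Gamma> x)))
    \<le> card I + (1 / L) * (\<Sum>l<L. conv (k z (2 ^ l * s)) (\<lambda>y. indicator \<Omega> y * M y ((2 * C * \<mu>) *\<^sub>R \<Gamma> y)) x)"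
proof -
  let ?V = "(1 / real L) *\<^sub>R (\<Sum>l<L. conv (k z (2 ^ l * s)) \<Gamma> x)"
  define h where "h i y = indicator \<Omega> y * M y ((2 * C * \<mu> * norm (P i (\<Gamma> y))) *\<^sub>R axis i 1)" for i y
  have C\<mu>: "2 * C * \<mu> \<ge> 0" using C_ge_1 \<mu> by simp
  have lin: "norm (P i (c *\<^sub>R \<xi>)) = c * norm (P i \<xi>)" if "i \<in> I" "c \<ge> 0" for i c \<xi>
    using linear_scale[OF bounded_linear.linear[OF P_linear[OF that(1)]], of c \<xi>] that(2) by simp
  have sum_h: "indicator \<Omega> y * M y ((2 * C * \<mu>) *\<^sub>R \<Gamma> y) = (\<Sum>i\<in>I. h i y)" for y
  proof (cases "y \<in> \<Omega>")
    case True
    have "M y ((2 * C * \<mu>) *\<^sub>R \<Gamma> y) = (\<Sum>i\<in>I. M y (norm (P i ((2 * C * \<mu>) *\<^sub>R \<Gamma> y)) *\<^sub>R axis i 1))"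
      by (rule M_split[OF True])
    also have "\<dots> = (\<Sum>i\<in>I. h i y)"
      using True by (intro sum.cong refl) (simp only: h_def lin[OF _ C\<mu>] indicator_simps mult_1)
    finally show ?thesis using True by simp
  qed (simp add: h_def)
  have h_nn: "0 \<le> h i y" for i y unfolding h_def using M_nonneg[of y] by (cases "y \<in> \<Omega>") auto
  have h_int: "integrable lborel (h i)" if i: "i \<in> I" for i
  proof (rule Bochner_Integration.integrable_bound[OF H])
    have [measurable]: "\<Gamma> \<in> borel_measurable borel" using borel_measurable_integrable[OF \<Gamma>(1)] by simp
    have [measurable]: "P i \<in> borel_measurable borel"
      by (intro borel_measurable_continuous_onI linear_continuous_on P_linear[OF i])
    have "(\<lambda>y. (2 * C * \<mu> * norm (P i (\<Gamma> y))) *\<^sub>R (axis i 1 :: real^'n)) \<in> borel_measurable borel"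
      by measurable
    from measurable_M_compose[OF this] show "h i \<in> borel_measurable lborel" by (simp add: h_def[abs_def])
    show "AE y in lborel. norm (h i y) \<le> norm (indicator \<Omega> y * M y ((2 * C * \<mu>) *\<^sub>R \<Gamma> y))"
    proof (rule AE_I2)
      fix y
      have "h i y \<le> (\<Sum>i\<in>I. h i y)" by (rule member_le_sum[OF i]) (auto simp: h_nn)
      then show "norm (h i y) \<le> norm (indicator \<Omega> y * M y ((2 * C * \<mu>) *\<^sub>R \<Gamma> y))"
        using h_nn[of i y] unfolding sum_h real_norm_def by linarith
    qed
  qed
  have sl: "0 < 2 ^ l * s" "4 * (2 ^ l * s) \<le> 1" if "l < L" for l
  proof -
    have "(2::real) ^ l * s \<le> 2 ^ L * s" using that s by (intro mult_right_mono power_increasing) auto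
    then show "4 * (2 ^ l * s) \<le> 1" using s(2) by linarith
    show "0 < 2 ^ l * s" using s by simp
  qed
  have est: "M x ((\<mu> / 2 * norm (P i ?V)) *\<^sub>R axis i 1) \<le> 1 + (1 / L) * (\<Sum>l<L. conv (k z (2 ^ l * s)) (h i) x)"
    if i: "i \<in> I" for i
  proof (rule multiscale_estimate[OF i x L \<mu>, where S="\<lambda>l. S z (2 ^ l * s)" and r="\<lambda>l. 4 * (2 ^ l * s)" and G=\<Gamma>])
    fix l assume l: "l < L"
    show "mollifier_on (S z (2 ^ l * s)) (k z (2 ^ l * s))" by (rule k_mollifier[OF z sl(1)[OF l]])
    show "S z (2 ^ l * s) \<subseteq> ball 0 (4 * (2 ^ l * s))"
      using k_support[OF z sl(1)[OF l]] sl(1)[OF l] by fastforce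
    show "0 < 4 * (2 ^ l * s) \<and> 4 * (2 ^ l * s) \<le> 1" using sl[OF l] by simp
    show "\<mu> / L * (\<Sum>l\<in>{l..<L}. norm (conv (k z (2 ^ l * s)) \<Gamma> x)) \<le> (4 * (2 ^ l * s)) powr (\<gamma> - 1)"
      using tail[OF l] by (simp only: mult.assoc)
  next
    show "4 * (2 ^ l * s) \<le> 4 * (2 ^ l' * s)" if "l \<le> l'" for l l'
      using that s by (intro mult_left_mono mult_right_mono power_increasing) auto
    show "integrable lborel (h i)" by (rule h_int[OF i])
    show "h i y = M y ((2 * C * \<mu> * norm (P i (\<Gamma> y))) *\<^sub>R axis i 1)" if "y \<in> \<Omega>" for y
      using that by (simp add: h_def)
    show "h i y = 0" if "y \<notin> \<Omega>" for y using that by (simp add: h_def)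
  qed (use \<Gamma> in auto)
  have "M x ((\<mu> / 2) *\<^sub>R ?V) = (\<Sum>i\<in>I. M x (norm (P i ((\<mu> / 2) *\<^sub>R ?V)) *\<^sub>R axis i 1))"
    by (rule M_split[OF x])
  also have "\<dots> = (\<Sum>i\<in>I. M x ((\<mu> / 2 * norm (P i ?V)) *\<^sub>R axis i 1))"
    using \<mu> by (intro sum.cong refl) (simp only: lin[of _ "\<mu> / 2"])
  also have "\<dots> \<le> (\<Sum>i\<in>I. 1 + (1 / L) * (\<Sum>l<L. conv (k z (2 ^ l * s)) (h i) x))"
    by (rule sum_mono) (rule est)
  also have "\<dots> = card I + (1 / L) * (\<Sum>i\<in>I. \<Sum>l<L. conv (k z (2 ^ l * s)) (h i) x)"
    by (simp add: sum.distrib sum_divide_distrib)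
  also have "(\<Sum>i\<in>I. \<Sum>l<L. conv (k z (2 ^ l * s)) (h i) x) = (\<Sum>l<L. \<Sum>i\<in>I. conv (k z (2 ^ l * s)) (h i) x)"
    by (rule sum.swap)
  also have "(\<Sum>l<L. \<Sum>i\<in>I. conv (k z (2 ^ l * s)) (h i) x)
      = (\<Sum>l<L. conv (k z (2 ^ l * s)) (\<lambda>y. indicator \<Omega> y * M y ((2 * C * \<mu>) *\<^sub>R \<Gamma> y)) x)"
  proof (intro sum.cong refl)
    fix l assume "l \<in> {..<L}"
    then have "kernel_on (S z (2 ^ l * s)) (k z (2 ^ l * s))"
      using k_mollifier[OF z sl(1)] by (simp add: mollifier_on_def)
    from integrable_conv[OF h_int this, of _ x]
    have "integrable lborel (\<lambda>y. k z (2 ^ l * s) (x - y) * h i y)" if "i \<in> I" for i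
      using that by simp
    then show "(\<Sum>i\<in>I. conv (k z (2 ^ l * s)) (h i) x)
      = conv (k z (2 ^ l * s)) (\<lambda>y. indicator \<Omega> y * M y ((2 * C * \<mu>) *\<^sub>R \<Gamma> y)) x"
      unfolding sum_h conv_def real_scaleR_def sum_distrib_left by (simp only: Bochner_Integration.integral_sum)
  qed
  finally show ?thesis .
qed

end

context approximation
begin

text \<open>For a fixed number \<open>L\<close> of scales the dominating functions converge in \<open>L\<^sup>1\<close> as the finest
  scale tends to zero, since they are mollifications of fixed integrable functions. As to the
  constants: \<open>\<Lambda>\<close> loses a factor \<open>2\<close> to separate \<open>grad u\<close> from \<open>G\<close>, a factor \<open>J\<close> to separate the
  members of the partition of unity, a factor \<open>4 C\<close> in the pointwise estimate, and a factor \<open>2\<close> to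
  separate the two terms of the product rule. None of them depends on the bound of \<open>f\<close> or on \<open>L\<close>.\<close>

lemma bounded_approximation:
  fixes f :: "real^'n \<Rightarrow> real" and L :: nat
  assumes W: "sobolev0 \<Omega> f G" and f: "\<And>x. \<bar>f x\<bar> \<le> N" and fin: "emeasure lborel \<Omega> < \<infinity>"
    and \<Lambda>: "\<Lambda> > 0" and L: "L > 0"
    and G: "integrable lborel (\<lambda>x. indicator \<Omega> x * M x ((16 * C * J / \<Lambda>) *\<^sub>R G x))"
    and s1: "s1 > 0"
    and tail: "\<And>z s j x. z \<in> Z \<Longrightarrow> 0 < s \<Longrightarrow> s \<le> s1 \<Longrightarrow> j < L \<Longrightarrow>
      (4 * J / \<Lambda>) / L * (\<Sum>l\<in>{j..<L}. norm (conv (k z (2 ^ l * s)) (\<lambda>x. \<theta> z x *\<^sub>R G x + f x *\<^sub>R grad (\<theta> z) x) x))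
        \<le> (4 * 2 ^ j * s) powr (\<gamma> - 1)"
    and \<epsilon>: "\<epsilon> > 0"
  obtains u where "u \<in> Cc_infinity \<Omega>" "(LINT x|lborel. norm (u x - f x)) < \<epsilon>"
    "integrable lborel (\<lambda>x. indicator \<Omega> x * M x ((1 / \<Lambda>) *\<^sub>R (grad u x - G x)))"
    "(LINT x|lborel. indicator \<Omega> x * M x ((1 / \<Lambda>) *\<^sub>R (grad u x - G x))) < \<epsilon>"
    "\<And>B x. (AE x in lborel. \<bar>f x\<bar> \<le> B) \<Longrightarrow> \<bar>u x\<bar> \<le> J * B"
proof -
  note fG = sobolev0D[OF W]
  define \<mu> where "\<mu> = 4 * J / \<Lambda>"
  have \<mu>: "\<mu> > 0" using J_ge_1 \<Lambda> by (simp add: \<mu>_def)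
  define \<psi> where "\<psi> z x = \<theta> z x * f x" for z x
  define \<Gamma> where "\<Gamma> z x = \<theta> z x *\<^sub>R G x + f x *\<^sub>R grad (\<theta> z) x" for z x
  define H where "H z y = indicator \<Omega> y * M y ((2 * C * \<mu>) *\<^sub>R \<Gamma> z y)" for z y
  have W\<psi>: "sobolev0 \<Omega> (\<psi> z) (\<Gamma> z)" if "z \<in> Z" for z
    using localized[OF W that] by (simp add: \<psi>_def[abs_def] \<Gamma>_def[abs_def])
  note \<psi>\<Gamma> = sobolev0D[OF W\<psi>]
  have C\<mu>: "2 * C * \<mu> \<ge> 0" using C_ge_1 \<mu> by simp
  have C\<mu>2: "2 * (2 * C * \<mu>) = 16 * C * J / \<Lambda>" by (simp add: \<mu>_def)
  have H_int: "integrable lborel (H z)" if "z \<in> Z" for z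
    unfolding H_def \<Gamma>_def
    by (rule localized_energy_integrable[OF W f fin C\<mu> _ that]) (simp only: C\<mu>2 G)
  have H_nn: "0 \<le> H z y" for z y unfolding H_def using M_nonneg[of y] by (cases "y \<in> \<Omega>") auto
  define \<sigma> where "\<sigma> = min s1 (min (s0 / 2 ^ L) (1 / (4 * 2 ^ L)))"
  have \<sigma>: "\<sigma> > 0" "\<sigma> \<le> s1" "2 ^ L * \<sigma> \<le> s0" "4 * 2 ^ L * \<sigma> \<le> 1"
  proof -
    show "\<sigma> > 0" "\<sigma> \<le> s1" using s1 s0_pos by (auto simp: \<sigma>_def)
    have "\<sigma> \<le> s0 / 2 ^ L" "\<sigma> \<le> 1 / (4 * 2 ^ L)" by (auto simp: \<sigma>_def)
    then show "2 ^ L * \<sigma> \<le> s0" "4 * 2 ^ L * \<sigma> \<le> 1" by (simp_all add: field_simps)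
  qed
  define s where "s n = \<sigma> * inverse (real (Suc n))" for n
  have s: "0 < s n" "s n \<le> \<sigma>" for n
  proof -
    show "0 < s n" using \<sigma>(1) by (simp add: s_def)
    have "inverse (real (Suc n)) \<le> 1" by (simp add: inverse_le_1_iff)
    then show "s n \<le> \<sigma>" unfolding s_def using \<sigma>(1) by (intro mult_left_le) auto
  qed
  have s_lim: "s \<longlonglongrightarrow> 0"
    unfolding s_def using tendsto_mult_left[OF LIMSEQ_inverse_real_of_nat, of \<sigma>] by simp
  have s4: "4 * 2 ^ L * s n \<le> 1" for n
  proof -
    have "4 * 2 ^ L * s n \<le> 4 * 2 ^ L * \<sigma>" by (intro mult_left_mono s) simp
    then show ?thesis using \<sigma>(4) by linarith
  qed
  have sl: "0 < 2 ^ l * s n" "l < L \<Longrightarrow> 2 ^ l * s n \<le> s0" for l n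
  proof -
    show "0 < 2 ^ l * s n" using s(1) by simp
    assume "l < L"
    then have "2 ^ l * s n \<le> 2 ^ L * \<sigma>"
      using s[of n] by (intro mult_mono power_increasing) auto
    then show "2 ^ l * s n \<le> s0" using \<sigma>(3) by linarith
  qed
  define \<kappa> where "\<kappa> z l n = k z (2 ^ l * s n)" for z l n
  have moll: "mollifier_on (S z (2 ^ l * s n)) (\<kappa> z l n)" if "z \<in> Z" for z l n
    unfolding \<kappa>_def by (rule k_mollifier[OF that sl(1)])
  have kern: "kernel_on (S z (2 ^ l * s n)) (\<kappa> z l n)" if "z \<in> Z" for z l n
    using moll[OF that] by (simp add: mollifier_on_def)
  have conv_lim: "L1_tendsto (\<lambda>n. conv (\<kappa> z l n) w) w"
    if z: "z \<in> Z" and w: "integrable lborel w" for z l and w :: "real^'n \<Rightarrow> 'b::{banach, second_countable_topology}"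
  proof (rule L1_tendsto_conv[OF w moll[OF z]])
    show "S z (2 ^ l * s n) \<subseteq> cball 0 (2 * (2 ^ l * s n))" for n by (rule k_support[OF z sl(1)])
    show "(\<lambda>n. 2 * (2 ^ l * s n)) \<longlonglongrightarrow> 0"
      using tendsto_mult_left[OF tendsto_mult_left[OF s_lim, of "2 ^ l"], of 2] by simp
  qed
  define u where "u n x = (\<Sum>z\<in>Z. (1 / L) *\<^sub>R (\<Sum>l<L. conv (\<kappa> z l n) (\<psi> z) x))" for n x
  define U where "U n x = (\<Sum>z\<in>Z. (1 / L) *\<^sub>R (\<Sum>l<L. conv (\<kappa> z l n) (\<Gamma> z) x))" for n x
  have test: "conv (\<kappa> z l n) (\<psi> z) \<in> Cc_infinity \<Omega>" if z: "z \<in> Z" and l: "l < L" for z l n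
    unfolding \<kappa>_def
  proof (rule conv_test[OF z sl(1) sl(2)[OF l] \<psi>\<Gamma>(1)[OF z]])
    show "x \<in> \<Omega> \<and> \<theta> z x \<noteq> 0" if "\<psi> z x \<noteq> 0" for x
      using that fG(3)[of x] by (auto simp: \<psi>_def)
  qed
  have test_sum: "(\<lambda>x. \<Sum>l<L. conv (\<kappa> z l n) (\<psi> z) x) \<in> Cc_infinity \<Omega>" if "z \<in> Z" for z n
    by (intro Cc_infinity_sum test that) simp
  have test_z: "(\<lambda>x. (1 / L) * (\<Sum>l<L. conv (\<kappa> z l n) (\<psi> z) x)) \<in> Cc_infinity \<Omega>" if "z \<in> Z" for z n
    by (intro Cc_infinity_cmult test_sum that)
  have u_test: "u n \<in> Cc_infinity \<Omega>" for n
    unfolding u_def[abs_def] real_scaleR_def by (intro Cc_infinity_sum test_z)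
  have grad_u: "grad (u n) x = U n x" for n x
  proof -
    have "grad (u n) x = (\<Sum>z\<in>Z. grad (\<lambda>x. (1 / L) * (\<Sum>l<L. conv (\<kappa> z l n) (\<psi> z) x)) x)"
      unfolding u_def[abs_def] real_scaleR_def
      by (rule grad_sum) (rule Cc_infinity_differentiable[OF test_z])
    also have "\<dots> = U n x"
      unfolding U_def
    proof (intro sum.cong refl)
      fix z assume z: "z \<in> Z"
      have "grad (\<lambda>x. (1 / L) * (\<Sum>l<L. conv (\<kappa> z l n) (\<psi> z) x)) x
        = (1 / L) *\<^sub>R grad (\<lambda>x. \<Sum>l<L. conv (\<kappa> z l n) (\<psi> z) x) x"
        by (rule grad_cmult[OF Cc_infinity_differentiable[OF test_sum[OF z]]])
      also have "grad (\<lambda>x. \<Sum>l<L. conv (\<kappa> z l n) (\<psi> z) x) x = (\<Sum>l<L. grad (conv (\<kappa> z l n) (\<psi> z)) x)"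
        by (rule grad_sum) (rule Cc_infinity_differentiable[OF test[OF z]], simp)
      also have "\<dots> = (\<Sum>l<L. conv (\<kappa> z l n) (\<Gamma> z) x)"
        by (intro sum.cong refl sobolev0_grad_conv[OF W\<psi>[OF z] kern[OF z]])
      finally show "grad (\<lambda>x. (1 / L) * (\<Sum>l<L. conv (\<kappa> z l n) (\<psi> z) x)) x
        = (1 / L) *\<^sub>R (\<Sum>l<L. conv (\<kappa> z l n) (\<Gamma> z) x)" .
    qed
    finally show ?thesis .
  qed
  have average: "(\<Sum>z\<in>Z. (1 / L) *\<^sub>R (\<Sum>l<L. w z)) = (\<Sum>z\<in>Z. w z)" for w :: "real^'n \<Rightarrow> 'b::real_vector"
    using L by (intro sum.cong refl) (simp add: sum_constant_scaleR)
  have sum_\<psi>: "(\<Sum>z\<in>Z. \<psi> z x) = f x" for x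
    using sum_\<theta>[of x] fG(3)[of x] by (cases "x \<in> \<Omega>") (simp_all add: \<psi>_def sum_distrib_right[symmetric])
  have sum_\<Gamma>: "(\<Sum>z\<in>Z. \<Gamma> z x) = G x" for x
    using sum_\<theta>[of x] sum_grad_\<theta>[of x] fG(3,4)[of x]
    by (cases "x \<in> \<Omega>") (simp_all add: \<Gamma>_def sum.distrib scaleR_sum_left[symmetric] scaleR_sum_right[symmetric])
  have "L1_tendsto u (\<lambda>x. \<Sum>z\<in>Z. (1 / L) *\<^sub>R (\<Sum>l<L. \<psi> z x))"
    unfolding u_def[abs_def] by (intro L1_tendsto_sum L1_tendsto_scaleR conv_lim \<psi>\<Gamma>(1))
  then have u_lim: "L1_tendsto u f" by (simp only: average sum_\<psi>)
  have "L1_tendsto U (\<lambda>x. \<Sum>z\<in>Z. (1 / L) *\<^sub>R (\<Sum>l<L. \<Gamma> z x))"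
    unfolding U_def[abs_def] by (intro L1_tendsto_sum L1_tendsto_scaleR conv_lim \<psi>\<Gamma>(2))
  then have U_lim: "L1_tendsto U G" by (simp only: average sum_\<Gamma>)
  define F where "F n x = indicator \<Omega> x * M x ((1 / \<Lambda>) *\<^sub>R (U n x - G x))" for n x
  define R where "R x = indicator \<Omega> x * real (card I) + indicator \<Omega> x * M x ((16 * C * J / \<Lambda>) *\<^sub>R G x)" for x
  define D' where "D' n x = R x + (\<Sum>z\<in>Z. (1 / J) *\<^sub>R ((1 / L) *\<^sub>R (\<Sum>l<L. conv (\<kappa> z l n) (H z) x)))" for n x
  define D'' where "D'' x = R x + (\<Sum>z\<in>Z. (1 / J) *\<^sub>R ((1 / L) *\<^sub>R (\<Sum>l<L. H z x)))" for x
  have R_int: "integrable lborel R"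
    unfolding R_def using G fin open_domain
    by (intro Bochner_Integration.integrable_add integrable_mult_left integrable_real_indicator) auto
  have D_lim: "L1_tendsto D' D''"
    unfolding D'_def[abs_def] D''_def[abs_def]
    by (intro L1_tendsto_add L1_tendsto_const R_int L1_tendsto_sum L1_tendsto_scaleR conv_lim H_int)
  have conv_H: "0 \<le> conv (\<kappa> z l n) (H z) x" if "z \<in> Z" for z l n x
    unfolding conv_def using moll[OF that] H_nn by (intro Bochner_Integration.integral_nonneg) (auto simp: mollifier_on_def)
  have F_nn: "0 \<le> F n x" for n x unfolding F_def using M_nonneg[of x] by (cases "x \<in> \<Omega>") auto
  have F_le: "F n x \<le> D' n x" for n x
  proof (cases "x \<in> \<Omega>")
    case False
    have "0 \<le> (\<Sum>z\<in>Z. (1 / J) *\<^sub>R ((1 / L) *\<^sub>R (\<Sum>l<L. conv (\<kappa> z l n) (H z) x)))"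
      using conv_H by (intro sum_nonneg scaleR_nonneg_nonneg) auto
    then show ?thesis using False by (simp add: F_def D'_def R_def)
  next
    case x: True
    define V where "V z = (1 / L) *\<^sub>R (\<Sum>l<L. conv (\<kappa> z l n) (\<Gamma> z) x)" for z
    have V: "M x ((\<mu> / 2) *\<^sub>R V z) \<le> card I + (1 / L) * (\<Sum>l<L. conv (\<kappa> z l n) (H z) x)" if z: "z \<in> Z" for z
      unfolding V_def H_def \<kappa>_def
    proof (rule energy_of_average[OF x z L \<mu> s(1) s4 \<psi>\<Gamma>(2)[OF z] \<psi>\<Gamma>(4)[OF z]])
      show "integrable lborel (\<lambda>y. indicator \<Omega> y * M y ((2 * C * \<mu>) *\<^sub>R \<Gamma> z y))"
        using H_int[OF z] by (simp add: H_def[abs_def])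
      show "\<mu> / L * (\<Sum>l\<in>{j..<L}. norm (conv (k z (2 ^ l * s n)) (\<Gamma> z) x)) \<le> (4 * 2 ^ j * s n) powr (\<gamma> - 1)"
        if "j < L" for j
        unfolding \<mu>_def \<Gamma>_def[abs_def] using s[of n] \<sigma>(2) by (intro tail[OF z _ _ that]) auto
    qed auto
    have "M x ((1 / \<Lambda>) *\<^sub>R (U n x - G x)) = M x ((1 / \<Lambda>) *\<^sub>R U n x + - ((1 / \<Lambda>) *\<^sub>R G x))"
      by (simp add: scaleR_diff_right)
    also have "\<dots> \<le> M x (2 *\<^sub>R ((1 / \<Lambda>) *\<^sub>R U n x)) / 2 + M x (2 *\<^sub>R (- ((1 / \<Lambda>) *\<^sub>R G x))) / 2"
      by (rule M_midpoint[OF x])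
    also have "M x (2 *\<^sub>R (- ((1 / \<Lambda>) *\<^sub>R G x))) = M x ((2 / \<Lambda>) *\<^sub>R G x)"
      using M_even[OF x, of "(2 / \<Lambda>) *\<^sub>R G x"] by simp
    also have "M x ((2 / \<Lambda>) *\<^sub>R G x) \<le> M x ((16 * C * J / \<Lambda>) *\<^sub>R G x)"
    proof (rule M_scale_mono[OF x])
      have "1 * 1 \<le> C * J" using C_ge_1 J_ge_1 by (intro mult_mono) auto
      then have "2 \<le> 16 * C * J" by linarith
      then show "2 / \<Lambda> \<le> 16 * C * J / \<Lambda>" using \<Lambda> by (intro divide_right_mono) auto
    qed (use \<Lambda> in simp)
    also have "2 *\<^sub>R ((1 / \<Lambda>) *\<^sub>R U n x) = (\<Sum>z\<in>Z. (2 / \<Lambda>) *\<^sub>R V z)"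
      by (simp add: U_def V_def scaleR_sum_right)
    also have "M x (\<Sum>z\<in>Z. (2 / \<Lambda>) *\<^sub>R V z) \<le> (\<Sum>z\<in>Z. M x (J *\<^sub>R ((2 / \<Lambda>) *\<^sub>R V z))) / J"
      by (rule M_average[OF x finite_Z Z_nonempty])
    also have "(\<Sum>z\<in>Z. M x (J *\<^sub>R ((2 / \<Lambda>) *\<^sub>R V z))) = (\<Sum>z\<in>Z. M x ((\<mu> / 2) *\<^sub>R V z))"
      by (simp add: \<mu>_def mult.commute)
    also have "\<dots> / J \<le> (\<Sum>z\<in>Z. card I + (1 / L) * (\<Sum>l<L. conv (\<kappa> z l n) (H z) x)) / J"
      by (intro divide_right_mono sum_mono V) simp_all
    also have "\<dots> = card I + (\<Sum>z\<in>Z. (1 / J) *\<^sub>R ((1 / L) *\<^sub>R (\<Sum>l<L. conv (\<kappa> z l n) (H z) x)))"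
      using J_ge_1 by (simp add: sum.distrib add_divide_distrib sum_divide_distrib)
    finally have "M x ((1 / \<Lambda>) *\<^sub>R (U n x - G x)) \<le>
      (card I + (\<Sum>z\<in>Z. (1 / J) *\<^sub>R ((1 / L) *\<^sub>R (\<Sum>l<L. conv (\<kappa> z l n) (H z) x)))) / 2
        + M x ((16 * C * J / \<Lambda>) *\<^sub>R G x) / 2" by simp
    moreover have "0 \<le> (\<Sum>z\<in>Z. (1 / J) *\<^sub>R ((1 / L) *\<^sub>R (\<Sum>l<L. conv (\<kappa> z l n) (H z) x)))"
      using conv_H by (intro sum_nonneg scaleR_nonneg_nonneg) auto
    moreover have "0 \<le> M x ((16 * C * J / \<Lambda>) *\<^sub>R G x)" by (rule M_nonneg[OF x])
    moreover have "0 \<le> real (card I)" by simp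
    moreover have "a \<le> c + m + X" if "a \<le> (c + X) / 2 + m / 2" "0 \<le> X" "0 \<le> m" "0 \<le> c" for a c m X :: real
      using that by (simp add: field_simps)
    ultimately show ?thesis
      unfolding F_def D'_def R_def indicator_simps(1)[OF x] mult_1 by blast
  qed
  have F_meas: "F n \<in> borel_measurable borel" for n
  proof -
    have "integrable lborel (U n)" using U_lim by (simp add: L1_tendsto_def)
    then have "(\<lambda>x. (1 / \<Lambda>) *\<^sub>R (U n x - G x)) \<in> borel_measurable borel"
      using borel_measurable_integrable[of lborel "U n"] fG(6) by simp
    from measurable_M_compose[OF this] show ?thesis by (simp add: F_def[abs_def])
  qed
  have D_int: "integrable lborel (D' n)" "integrable lborel D''" for n using D_lim by (simp_all add: L1_tendsto_def)
  have F_int: "integrable lborel (F n)" for n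
  proof (rule Bochner_Integration.integrable_bound[OF D_int(1)[of n]])
    show "AE x in lborel. norm (F n x) \<le> norm (D' n x)"
      using F_nn F_le by (intro AE_I2) (smt (verit) real_norm_def)
  qed (use F_meas in simp)
  have U_int: "integrable lborel (\<lambda>x. U n x - G x)" for n
    using U_lim by (simp add: L1_tendsto_def)
  have "(\<lambda>n. LINT x|lborel. norm (U n x - G x)) \<longlonglongrightarrow> 0" using U_lim by (simp add: L1_tendsto_def)
  from tendsto_L1_AE_subseq[OF U_int this] obtain r where r: "strict_mono r" "AE x in lborel. (\<lambda>n. U (r n) x - G x) \<longlonglongrightarrow> 0"
    by blast
  have sub: "(\<lambda>n. a (r n)) \<longlonglongrightarrow> 0" if "a \<longlonglongrightarrow> 0" for a :: "nat \<Rightarrow> real"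
    using LIMSEQ_subseq_LIMSEQ[OF that r(1)] by (simp add: comp_def)
  have F_lim: "(\<lambda>n. LINT x|lborel. F (r n) x) \<longlonglongrightarrow> 0"
  proof (rule generalized_dominated_convergence_0[where D="D''" and D'="\<lambda>n. D' (r n)"])
    show "(\<lambda>n. LINT x|lborel. norm (D' (r n) x - D'' x)) \<longlonglongrightarrow> 0"
      using D_lim by (intro sub) (simp add: L1_tendsto_def)
    show "AE x in lborel. (\<lambda>n. F (r n) x) \<longlonglongrightarrow> 0"
      using r(2)
    proof eventually_elim
      case (elim x)
      show ?case
      proof (cases "x \<in> \<Omega>")
        case True
        have "(\<lambda>n. M x ((1 / \<Lambda>) *\<^sub>R (U (r n) x - G x))) \<longlonglongrightarrow> M x ((1 / \<Lambda>) *\<^sub>R 0)"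
          by (rule tendsto_M[OF True tendsto_const True tendsto_scaleR[OF tendsto_const elim]])
        then show ?thesis using True M_zero[OF True] by (simp add: F_def)
      qed (simp add: F_def)
    qed
    show "F (r n) \<in> borel_measurable lborel" for n using F_meas by simp
    show "AE x in lborel. 0 \<le> F (r n) x \<and> F (r n) x \<le> D' (r n) x" for n using F_nn F_le by simp
  qed (rule D_int)+
  have "(\<lambda>n. LINT x|lborel. norm (u (r n) x - f x)) \<longlonglongrightarrow> 0"
    using u_lim by (intro sub) (simp add: L1_tendsto_def)
  from eventually_conj[OF order_tendstoD(2)[OF this \<epsilon>] order_tendstoD(2)[OF F_lim \<epsilon>]]
  obtain n where n: "(LINT x|lborel. norm (u (r n) x - f x)) < \<epsilon>" "(LINT x|lborel. F (r n) x) < \<epsilon>"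
    unfolding eventually_sequentially by blast
  show ?thesis
  proof (rule that[OF u_test n(1)])
    show "integrable lborel (\<lambda>x. indicator \<Omega> x * M x ((1 / \<Lambda>) *\<^sub>R (grad (u (r n)) x - G x)))"
      using F_int[of "r n"] by (simp add: F_def[abs_def] grad_u)
    show "(LINT x|lborel. indicator \<Omega> x * M x ((1 / \<Lambda>) *\<^sub>R (grad (u (r n)) x - G x))) < \<epsilon>"
      using n(2) by (simp add: F_def grad_u)
    fix B x assume B: "AE x in lborel. \<bar>f x\<bar> \<le> B"
    have "\<bar>conv (\<kappa> z l (r n)) (\<psi> z) x\<bar> \<le> B" if z: "z \<in> Z" for z l
    proof (rule abs_conv_mollifier_le[OF moll[OF z] \<psi>\<Gamma>(1)[OF z]])
      show "AE y in lborel. \<bar>\<psi> z y\<bar> \<le> B"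
        using B
      proof eventually_elim
        case (elim y)
        have "\<bar>\<psi> z y\<bar> = \<theta> z y * \<bar>f y\<bar>" using \<theta>_nonneg[OF z] by (simp add: \<psi>_def abs_mult)
        also have "\<dots> \<le> 1 * \<bar>f y\<bar>" using \<theta>_le_1[OF z] by (intro mult_right_mono) auto
        finally show ?case using elim by simp
      qed
    qed
    then have "\<bar>(1 / L) *\<^sub>R (\<Sum>l<L. conv (\<kappa> z l (r n)) (\<psi> z) x)\<bar> \<le> B" if "z \<in> Z" for z
    proof -
      have "\<bar>\<Sum>l<L. conv (\<kappa> z l (r n)) (\<psi> z) x\<bar> \<le> (\<Sum>l<L. B)"
        using \<open>\<And>z l. z \<in> Z \<Longrightarrow> \<bar>conv (\<kappa> z l (r n)) (\<psi> z) x\<bar> \<le> B\<close>[OF that]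
        by (intro order_trans[OF sum_abs] sum_mono)
      then show ?thesis using L by (simp add: abs_mult field_simps)
    qed
    then have "\<bar>u (r n) x\<bar> \<le> (\<Sum>z\<in>Z. B)"
      unfolding u_def by (intro order_trans[OF sum_abs] sum_mono)
    then show "\<bar>u (r n) x\<bar> \<le> J * B" by simp
  qed
qed

end

section \<open>From representatives to the modular convergence\<close>

lemma measurable_lebesgue_on_ident: "(\<lambda>x. x) \<in> borel_measurable (lebesgue_on \<Omega>)"
  by (intro measurable_restrict_space1 measurable_completion) simp

context continuous_N_function
begin

lemma measurable_M_lebesgue_on:
  assumes "\<xi> \<in> borel_measurable (lebesgue_on \<Omega>)"
  shows "(\<lambda>x. M x (\<xi> x)) \<in> borel_measurable (lebesgue_on \<Omega>)"
proof -
  have s: "\<Omega> \<times> (UNIV :: (real^'n) set) \<in> sets borel"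
    by (intro borel_open open_Times \<Omega>_open open_UNIV)
  have 1: "(\<lambda>p. indicator (\<Omega> \<times> UNIV) p *\<^sub>R (\<lambda>(x, \<xi>). M x \<xi>) p) \<in> borel_measurable borel"
    by (rule borel_measurable_continuous_on_indicator[OF s M_continuous])
  have 2: "(\<lambda>x. (x, \<xi> x)) \<in> borel_measurable (lebesgue_on \<Omega>)"
    by (intro borel_measurable_Pair measurable_lebesgue_on_ident assms)
  from measurable_compose[OF 2 1]
  have "(\<lambda>x. indicator (\<Omega> \<times> UNIV) (x, \<xi> x) *\<^sub>R M x (\<xi> x)) \<in> borel_measurable (lebesgue_on \<Omega>)"
    by simp
  then show ?thesis
    by (rule measurable_cong[THEN iffD1, rotated]) simp
qed

text \<open>By convexity, the functions with some multiple of finite modular form a linear space, which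
  therefore contains the hull.\<close>

lemma L_M_finite_modular:
  assumes "\<xi> \<in> L_M \<Omega> M"
  obtains a where "a > 0" "modular \<Omega> M (\<lambda>x. a *\<^sub>R \<xi> x) < \<infinity>"
proof -
  define V where "V = {\<xi> \<in> borel_measurable (lebesgue_on \<Omega>). \<exists>a>0. modular \<Omega> M (\<lambda>x. a *\<^sub>R \<xi> x) < \<infinity>}"
  have zero: "modular \<Omega> M (\<lambda>x. 0) = 0"
  proof -
    have "modular \<Omega> M (\<lambda>x. 0) = (\<integral>\<^sup>+x. 0 \<partial>lebesgue_on \<Omega>)"
      unfolding modular_def by (intro nn_integral_cong) (simp add: M_zero)
    then show ?thesis by simp
  qed
  have "linear_function_space V"
    unfolding linear_function_space_def
  proof (intro conjI ballI allI)
    have "(\<lambda>x. 0) \<in> borel_measurable (lebesgue_on \<Omega>)" by simp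
    moreover have "modular \<Omega> M (\<lambda>x. 1 *\<^sub>R 0) < \<infinity>" by (simp add: zero)
    ultimately show "(\<lambda>x. 0) \<in> V" unfolding V_def using zero_less_one by blast
  next
    fix f g assume "f \<in> V" "g \<in> V"
    then obtain a b where m: "f \<in> borel_measurable (lebesgue_on \<Omega>)" "g \<in> borel_measurable (lebesgue_on \<Omega>)"
      and ab: "a > 0" "b > 0" "modular \<Omega> M (\<lambda>x. a *\<^sub>R f x) < \<infinity>" "modular \<Omega> M (\<lambda>x. b *\<^sub>R g x) < \<infinity>"
      unfolding V_def by blast
    define c where "c = min a b / 2"
    have "modular \<Omega> M (\<lambda>x. c *\<^sub>R (f x + g x)) \<le> (\<integral>\<^sup>+x. ennreal (M x (a *\<^sub>R f x)) + ennreal (M x (b *\<^sub>R g x)) \<partial>lebesgue_on \<Omega>)"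
      unfolding modular_def
    proof (intro nn_integral_mono)
      fix x assume "x \<in> space (lebesgue_on \<Omega>)"
      then have x: "x \<in> \<Omega>" by simp
      have "M x (c *\<^sub>R (f x + g x)) \<le> M x (2 *\<^sub>R c *\<^sub>R f x) / 2 + M x (2 *\<^sub>R c *\<^sub>R g x) / 2"
        using M_midpoint[OF x, of "c *\<^sub>R f x" "c *\<^sub>R g x"] by (simp add: scaleR_add_right)
      also have "M x (2 *\<^sub>R c *\<^sub>R f x) \<le> M x (a *\<^sub>R f x)"
        unfolding scaleR_scaleR using ab by (intro M_scale_mono[OF x]) (auto simp: c_def)
      also have "M x (2 *\<^sub>R c *\<^sub>R g x) \<le> M x (b *\<^sub>R g x)"
        unfolding scaleR_scaleR using ab by (intro M_scale_mono[OF x]) (auto simp: c_def)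
      finally have "M x (c *\<^sub>R (f x + g x)) \<le> M x (a *\<^sub>R f x) + M x (b *\<^sub>R g x)"
        using M_nonneg[OF x, of "a *\<^sub>R f x"] M_nonneg[OF x, of "b *\<^sub>R g x"] by simp
      then show "ennreal (M x (c *\<^sub>R (f x + g x))) \<le> ennreal (M x (a *\<^sub>R f x)) + ennreal (M x (b *\<^sub>R g x))"
        using M_nonneg[OF x] by (simp add: ennreal_plus[symmetric] ennreal_leI del: ennreal_plus)
    qed
    also have "\<dots> = modular \<Omega> M (\<lambda>x. a *\<^sub>R f x) + modular \<Omega> M (\<lambda>x. b *\<^sub>R g x)"
      unfolding modular_def
    proof (rule nn_integral_add)
      have sc: "(\<lambda>x. t *\<^sub>R h x) \<in> borel_measurable (lebesgue_on \<Omega>)"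
        if "h \<in> borel_measurable (lebesgue_on \<Omega>)" for t and h :: "real^'n \<Rightarrow> real^'n"
        using that by simp
      show "(\<lambda>x. ennreal (M x (a *\<^sub>R f x))) \<in> borel_measurable (lebesgue_on \<Omega>)"
        by (rule measurable_compose[OF measurable_M_lebesgue_on[OF sc[OF m(1)]] measurable_ennreal])
      show "(\<lambda>x. ennreal (M x (b *\<^sub>R g x))) \<in> borel_measurable (lebesgue_on \<Omega>)"
        by (rule measurable_compose[OF measurable_M_lebesgue_on[OF sc[OF m(2)]] measurable_ennreal])
    qed
    also have "\<dots> < \<infinity>" using ab by simp
    finally have "modular \<Omega> M (\<lambda>x. c *\<^sub>R (f x + g x)) < \<infinity>" .
    moreover have "c > 0" using ab by (simp add: c_def)
    ultimately show "(\<lambda>x. f x + g x) \<in> V"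
      unfolding V_def using borel_measurable_add[OF m] by blast
  next
    fix t f assume "f \<in> V"
    then obtain a where m: "f \<in> borel_measurable (lebesgue_on \<Omega>)" and a: "a > 0" "modular \<Omega> M (\<lambda>x. a *\<^sub>R f x) < \<infinity>"
      unfolding V_def by blast
    have "\<exists>b>0. modular \<Omega> M (\<lambda>x. b *\<^sub>R t *\<^sub>R f x) < \<infinity>"
    proof (cases "t = 0")
      case True
      then show ?thesis using zero by (intro exI[of _ 1]) simp
    next
      case False
      have "modular \<Omega> M (\<lambda>x. (a / \<bar>t\<bar>) *\<^sub>R t *\<^sub>R f x) = modular \<Omega> M (\<lambda>x. a *\<^sub>R f x)"
        unfolding modular_def
      proof (intro nn_integral_cong)
        fix x assume "x \<in> space (lebesgue_on \<Omega>)"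
        then have x: "x \<in> \<Omega>" by simp
        have "(a / \<bar>t\<bar>) *\<^sub>R t *\<^sub>R f x = a *\<^sub>R f x \<or> (a / \<bar>t\<bar>) *\<^sub>R t *\<^sub>R f x = - (a *\<^sub>R f x)"
          using False by (cases "t > 0") auto
        then show "ennreal (M x ((a / \<bar>t\<bar>) *\<^sub>R t *\<^sub>R f x)) = ennreal (M x (a *\<^sub>R f x))"
          using M_even[OF x, of "a *\<^sub>R f x"] by auto
      qed
      then show ?thesis using a False by (intro exI[of _ "a / \<bar>t\<bar>"]) simp
    qed
    moreover have "(\<lambda>x. t *\<^sub>R f x) \<in> borel_measurable (lebesgue_on \<Omega>)" using m by simp
    ultimately show "(\<lambda>x. t *\<^sub>R f x) \<in> V" unfolding V_def by blast
  qed
  moreover have "{\<xi> \<in> borel_measurable (lebesgue_on \<Omega>). modular \<Omega> M \<xi> < \<infinity>} \<subseteq> V"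
  proof
    fix \<eta> assume "\<eta> \<in> {\<xi> \<in> borel_measurable (lebesgue_on \<Omega>). modular \<Omega> M \<xi> < \<infinity>}"
    then have "\<eta> \<in> borel_measurable (lebesgue_on \<Omega>)" "modular \<Omega> M (\<lambda>x. 1 *\<^sub>R \<eta> x) < \<infinity>" by auto
    then show "\<eta> \<in> V" unfolding V_def using zero_less_one by blast
  qed
  ultimately have "L_M \<Omega> M \<subseteq> V" unfolding L_M_def by (intro hull_minimal)
  then show ?thesis using assms that unfolding V_def by blast
qed

lemma modular_eq_lborel:
  assumes V: "V \<in> borel_measurable borel" and ae: "AE x in lebesgue. x \<in> \<Omega> \<longrightarrow> \<xi> x = V x"
  shows "modular \<Omega> M \<xi> = (\<integral>\<^sup>+x. ennreal (indicator \<Omega> x * M x (V x)) \<partial>lborel)"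
proof -
  have "modular \<Omega> M \<xi> = (\<integral>\<^sup>+x. ennreal (M x (\<xi> x)) * indicator \<Omega> x \<partial>lebesgue)"
    unfolding modular_def using \<Omega>_open by (intro nn_integral_restrict_space) simp
  also have "\<dots> = (\<integral>\<^sup>+x. ennreal (indicator \<Omega> x * M x (V x)) \<partial>lebesgue)"
  proof (rule nn_integral_cong_AE)
    show "AE x in lebesgue. ennreal (M x (\<xi> x)) * indicator \<Omega> x = ennreal (indicator \<Omega> x * M x (V x))"
      using ae by eventually_elim (simp add: indicator_def)
  qed
  also have "\<dots> = (\<integral>\<^sup>+x. ennreal (indicator \<Omega> x * M x (V x)) \<partial>lborel)"
    by (rule nn_integral_completion)
  finally show ?thesis .
qed

lemma integrable_M_of_modular:
  assumes V: "V \<in> borel_measurable borel" and ae: "AE x in lebesgue. x \<in> \<Omega> \<longrightarrow> \<xi> x = V x"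
    and "modular \<Omega> M \<xi> < \<infinity>"
  shows "integrable lborel (\<lambda>x. indicator \<Omega> x * M x (V x))"
proof -
  have "0 \<le> indicator \<Omega> x * M x (V x)" for x using M_nonneg[of x] by (cases "x \<in> \<Omega>") auto
  then show ?thesis
    using assms(3) measurable_M_compose[OF V] unfolding modular_eq_lborel[OF V ae] integrable_iff_bounded by simp
qed

lemma nn_integral_lebesgue_on_eq_lborel:
  assumes w: "w \<in> borel_measurable borel" and ae: "AE x in lebesgue. x \<in> \<Omega> \<longrightarrow> v x = w x" "\<And>x. x \<notin> \<Omega> \<Longrightarrow> w x = (0::ennreal)"
  shows "(\<integral>\<^sup>+x. v x \<partial>lebesgue_on \<Omega>) = (\<integral>\<^sup>+x. w x \<partial>lborel)"
proof -
  have "(\<integral>\<^sup>+x. v x \<partial>lebesgue_on \<Omega>) = (\<integral>\<^sup>+x. v x * indicator \<Omega> x \<partial>lebesgue)"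
    using \<Omega>_open by (intro nn_integral_restrict_space) simp
  also have "\<dots> = (\<integral>\<^sup>+x. w x \<partial>lebesgue)"
  proof (rule nn_integral_cong_AE)
    show "AE x in lebesgue. v x * indicator \<Omega> x = w x"
      using ae(1) by eventually_elim (use ae(2) in \<open>simp add: indicator_def\<close>)
  qed
  also have "\<dots> = (\<integral>\<^sup>+x. w x \<partial>lborel)" by (rule nn_integral_completion)
  finally show ?thesis .
qed

lemma Linf_norm_le_of_bound:
  assumes \<Omega>: "\<Omega> \<noteq> {}" and \<phi>: "\<phi> \<in> Linf \<Omega>" and f: "AE x in lebesgue. x \<in> \<Omega> \<longrightarrow> \<phi> x = f x" "\<And>x. x \<notin> \<Omega> \<Longrightarrow> f x = 0"
    and u: "continuous_on UNIV u" "\<And>B x. (AE x in lborel. \<bar>f x\<bar> \<le> B) \<Longrightarrow> \<bar>u x\<bar> \<le> c * B"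
  shows "Linf_norm \<Omega> u \<le> ereal c * Linf_norm \<Omega> \<phi>"
proof -
  let ?b = "Linf_norm \<Omega> \<phi>"
  have ae: "AE x in lebesgue_on \<Omega>. ereal \<bar>\<phi> x\<bar> \<le> ?b" unfolding Linf_norm_def by (rule esssup_AE)
  obtain x0 where x0: "x0 \<in> \<Omega>" using \<Omega> by blast
  obtain xs where "\<And>n::nat. xs n \<in> \<Omega>" "\<And>n. ereal \<bar>\<phi> (xs n)\<bar> \<le> ?b" "xs \<longlonglongrightarrow> x0"
    by (rule AE_lebesgue_on_sequence[OF \<Omega>_open ae x0]) (rule that)
  then have "0 \<le> ?b" using order_trans[of 0 "ereal \<bar>\<phi> (xs 0)\<bar>" ?b] by simp
  moreover have "?b < \<infinity>" using \<phi> by (simp add: Linf_def)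
  ultimately obtain b where b: "?b = ereal b" "b \<ge> 0" by (cases ?b) auto
  have "AE x in lebesgue. x \<in> \<Omega> \<longrightarrow> ereal \<bar>\<phi> x\<bar> \<le> ?b"
    using ae \<Omega>_open by (simp add: AE_restrict_space_iff)
  with f(1) have "AE x in lebesgue. \<bar>f x\<bar> \<le> b"
  proof eventually_elim
    case (elim x)
    then show ?case using b f(2)[of x] by (cases "x \<in> \<Omega>") simp_all
  qed
  from u(2)[OF AE_lborel_if_lebesgue[OF this]] have "\<bar>u x\<bar> \<le> c * b" for x .
  then have "Linf_norm \<Omega> u \<le> ereal (c * b)"
    unfolding Linf_norm_def
  proof (intro esssup_I)
    have "u \<in> borel_measurable lebesgue"
      using borel_measurable_continuous_onI[OF u(1)] by (simp add: measurable_completion)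
    then show "(\<lambda>x. ereal \<bar>u x\<bar>) \<in> borel_measurable (lebesgue_on \<Omega>)"
      by (intro borel_measurable_ereal borel_measurable_abs measurable_restrict_space1)
  qed simp
  then show ?thesis by (simp add: b)
qed

text \<open>The convergence in measure follows from that in \<open>L\<^sup>1\<close> by the Markov inequality. The scaling
  factor \<open>\<Lambda>\<close> is fixed before \<open>\<epsilon>\<close>, as modular convergence
  requires.\<close>

lemma smooth_approximation_of_representatives:
  fixes \<phi> :: "real^'n \<Rightarrow> real"
  assumes \<Omega>: "\<Omega> \<noteq> {}" and W: "sobolev0 \<Omega> f G"
    and f: "AE x in lebesgue. x \<in> \<Omega> \<longrightarrow> \<phi> x = f x" and g: "AE x in lebesgue. x \<in> \<Omega> \<longrightarrow> weak_grad \<Omega> \<phi> x = G x"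
    and \<Lambda>: "\<Lambda> > 0"
    and approx: "\<And>\<epsilon>. \<epsilon> > 0 \<Longrightarrow> \<exists>u. u \<in> Cc_infinity \<Omega> \<and> (LINT x|lborel. norm (u x - f x)) < \<epsilon> \<and>
      integrable lborel (\<lambda>x. indicator \<Omega> x * M x ((1 / \<Lambda>) *\<^sub>R (grad u x - G x))) \<and>
      (LINT x|lborel. indicator \<Omega> x * M x ((1 / \<Lambda>) *\<^sub>R (grad u x - G x))) < \<epsilon> \<and>
      (\<forall>B. (AE x in lborel. \<bar>f x\<bar> \<le> B) \<longrightarrow> (\<forall>x. \<bar>u x\<bar> \<le> c * B))"
  shows "\<exists>\<Phi>. smooth_approximation \<Omega> M \<Phi> \<phi> \<and>
    (\<phi> \<in> Linf \<Omega> \<longrightarrow> (\<forall>\<delta>>0. Linf_norm \<Omega> (\<Phi> \<delta>) \<le> ereal c * Linf_norm \<Omega> \<phi>))"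
proof -
  note fG = sobolev0D[OF W]
  have "\<exists>\<Phi>. \<forall>\<delta>. \<delta> > 0 \<longrightarrow> \<Phi> \<delta> \<in> Cc_infinity \<Omega> \<and> (LINT x|lborel. norm (\<Phi> \<delta> x - f x)) < \<delta> \<and>
      integrable lborel (\<lambda>x. indicator \<Omega> x * M x ((1 / \<Lambda>) *\<^sub>R (grad (\<Phi> \<delta>) x - G x))) \<and>
      (LINT x|lborel. indicator \<Omega> x * M x ((1 / \<Lambda>) *\<^sub>R (grad (\<Phi> \<delta>) x - G x))) < \<delta> \<and>
      (\<forall>B. (AE x in lborel. \<bar>f x\<bar> \<le> B) \<longrightarrow> (\<forall>x. \<bar>\<Phi> \<delta> x\<bar> \<le> c * B))"
    by (rule choice) (use approx in blast)
  then obtain \<Phi> where \<Phi>: "\<And>\<delta>. \<delta> > 0 \<Longrightarrow> \<Phi> \<delta> \<in> Cc_infinity \<Omega>"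
    "\<And>\<delta>. \<delta> > 0 \<Longrightarrow> (LINT x|lborel. norm (\<Phi> \<delta> x - f x)) < \<delta>"
    "\<And>\<delta>. \<delta> > 0 \<Longrightarrow> integrable lborel (\<lambda>x. indicator \<Omega> x * M x ((1 / \<Lambda>) *\<^sub>R (grad (\<Phi> \<delta>) x - G x)))"
    "\<And>\<delta>. \<delta> > 0 \<Longrightarrow> (LINT x|lborel. indicator \<Omega> x * M x ((1 / \<Lambda>) *\<^sub>R (grad (\<Phi> \<delta>) x - G x))) < \<delta>"
    "\<And>\<delta> B x. \<delta> > 0 \<Longrightarrow> (AE x in lborel. \<bar>f x\<bar> \<le> B) \<Longrightarrow> \<bar>\<Phi> \<delta> x\<bar> \<le> c * B"
    by blast
  have to_0: "(Q \<longlongrightarrow> 0) (at_right 0)" if "\<And>\<delta>. \<delta> > 0 \<Longrightarrow> Q \<delta> \<le> ennreal (C' * \<delta>)" for Q and C' :: real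
  proof (rule tendsto_sandwich[OF _ _ tendsto_const])
    show "\<forall>\<^sub>F \<delta> in at_right 0. 0 \<le> Q \<delta>" by simp
    show "\<forall>\<^sub>F \<delta> in at_right 0. Q \<delta> \<le> ennreal (C' * \<delta>)"
      using that by (auto simp: eventually_at_filter)
    have "((\<lambda>\<delta>. C' * \<delta>) \<longlongrightarrow> C' * 0) (at_right 0)" by (intro tendsto_intros)
    from tendsto_ennrealI[OF this] show "((\<lambda>\<delta>. ennreal (C' * \<delta>)) \<longlongrightarrow> 0) (at_right 0)" by simp
  qed
  have L1: "(\<integral>\<^sup>+x. ennreal \<bar>\<Phi> \<delta> x - \<phi> x\<bar> \<partial>lebesgue_on \<Omega>) \<le> ennreal \<delta>" if \<delta>: "\<delta> > 0" for \<delta>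
  proof -
    note ku = kernel_onD[OF Cc_infinityD(1)[OF \<Phi>(1)[OF \<delta>]]] and ki = kernel_on_integrable(1)[OF Cc_infinityD(1)[OF \<Phi>(1)[OF \<delta>]]]
    have "\<Phi> \<delta> x = 0" if "x \<notin> \<Omega>" for x using ku(3)[of x] Cc_infinityD(2)[OF \<Phi>(1)[OF \<delta>]] that by blast
    then have "(\<integral>\<^sup>+x. ennreal \<bar>\<Phi> \<delta> x - \<phi> x\<bar> \<partial>lebesgue_on \<Omega>) = (\<integral>\<^sup>+x. ennreal (norm (\<Phi> \<delta> x - f x)) \<partial>lborel)"
      using ku(8) fG(3,5) f
      by (intro nn_integral_lebesgue_on_eq_lborel) (auto elim: eventually_mono)
    also have "\<dots> = ennreal (LINT x|lborel. norm (\<Phi> \<delta> x - f x))"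
      by (rule nn_integral_eq_integral) (use ki fG(1) in auto)
    also have "\<dots> \<le> ennreal \<delta>" using \<Phi>(2)[OF \<delta>] by (intro ennreal_leI) simp
    finally show ?thesis .
  qed
  have "converges_L1 \<Omega> \<Phi> \<phi>"
    unfolding converges_L1_def by (rule to_0[of _ 1]) (use L1 in simp)
  moreover have "converges_in_measure \<Omega> \<Phi> \<phi>"
    unfolding converges_in_measure_def
  proof (intro allI impI)
    fix e :: real assume e: "e > 0"
    show "((\<lambda>\<delta>. emeasure lebesgue {x \<in> \<Omega>. e \<le> \<bar>\<Phi> \<delta> x - \<phi> x\<bar>}) \<longlongrightarrow> 0) (at_right 0)"
    proof (rule to_0[of _ "1 / e"])
      fix \<delta> :: real assume \<delta>: "\<delta> > 0"
      note ku = kernel_onD[OF Cc_infinityD(1)[OF \<Phi>(1)[OF \<delta>]]]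
      have wm: "(\<lambda>x. indicator \<Omega> x * (\<Phi> \<delta> x - f x)) \<in> borel_measurable borel"
        using ku(8) fG(5) borel_open[OF \<Omega>_open] by measurable
      have m: "(\<lambda>x. indicator \<Omega> x * (\<Phi> \<delta> x - \<phi> x)) \<in> borel_measurable lebesgue"
      proof (rule borel_measurable_AE)
        show "(\<lambda>x. indicator \<Omega> x * (\<Phi> \<delta> x - f x)) \<in> borel_measurable lebesgue"
          using wm by (simp add: measurable_completion)
        show "AE x in lebesgue. indicator \<Omega> x * (\<Phi> \<delta> x - f x) = indicator \<Omega> x * (\<Phi> \<delta> x - \<phi> x)"
          using f by eventually_elim (simp add: indicator_def)
      qed
      let ?v = "\<lambda>x. ennreal \<bar>indicator \<Omega> x * (\<Phi> \<delta> x - \<phi> x)\<bar>"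
      have "{x \<in> \<Omega>. e \<le> \<bar>\<Phi> \<delta> x - \<phi> x\<bar>} = {x \<in> space lebesgue. x \<in> UNIV \<and> 1 \<le> ennreal (1 / e) * ?v x}"
      proof -
        have "1 \<le> ennreal (1 / e) * ennreal t \<longleftrightarrow> e \<le> t" if "t \<ge> 0" for t
          using e that by (simp add: ennreal_mult'[symmetric] ennreal_le_iff2 ennreal_1[symmetric] field_simps del: ennreal_1)
        from this[OF abs_ge_zero] show ?thesis
          using e by (auto simp: indicator_def)
      qed
      also have "emeasure lebesgue \<dots> \<le> ennreal (1 / e) * (\<integral>\<^sup>+x. ?v x * indicator UNIV x \<partial>lebesgue)"
        using nn_integral_Markov_inequality[of ?v UNIV lebesgue "ennreal (1 / e)"] m by simp
      also have "(\<integral>\<^sup>+x. ?v x * indicator UNIV x \<partial>lebesgue) = (\<integral>\<^sup>+x. ennreal \<bar>\<Phi> \<delta> x - \<phi> x\<bar> * indicator \<Omega> x \<partial>lebesgue)"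
        by (intro nn_integral_cong) (simp add: indicator_def)
      also have "\<dots> = (\<integral>\<^sup>+x. ennreal \<bar>\<Phi> \<delta> x - \<phi> x\<bar> \<partial>lebesgue_on \<Omega>)"
        using \<Omega>_open by (intro nn_integral_restrict_space[symmetric]) simp
      also have "ennreal (1 / e) * \<dots> \<le> ennreal (1 / e) * ennreal \<delta>"
        by (intro mult_left_mono L1 \<delta>) simp
      also have "\<dots> = ennreal (1 / e * \<delta>)" using e \<delta> by (simp only: ennreal_mult[symmetric] less_imp_le divide_nonneg_pos zero_le_one)
      finally show "emeasure lebesgue {x \<in> \<Omega>. e \<le> \<bar>\<Phi> \<delta> x - \<phi> x\<bar>} \<le> ennreal (1 / e * \<delta>)" .
    qed
  qed
  moreover have "converges_modularly \<Omega> M (\<lambda>\<delta>. grad (\<Phi> \<delta>)) (weak_grad \<Omega> \<phi>)"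
    unfolding converges_modularly_def
  proof (intro exI[of _ \<Lambda>] conjI \<Lambda> to_0[of _ 1])
    fix \<delta> :: real assume \<delta>: "\<delta> > 0"
    note ku = kernel_onD[OF Cc_infinityD(1)[OF \<Phi>(1)[OF \<delta>]]]
    have "modular \<Omega> M (\<lambda>x. (grad (\<Phi> \<delta>) x - weak_grad \<Omega> \<phi> x) /\<^sub>R \<Lambda>)
       = (\<integral>\<^sup>+x. ennreal (indicator \<Omega> x * M x ((1 / \<Lambda>) *\<^sub>R (grad (\<Phi> \<delta>) x - G x))) \<partial>lborel)"
    proof (rule modular_eq_lborel)
      show "(\<lambda>x. (1 / \<Lambda>) *\<^sub>R (grad (\<Phi> \<delta>) x - G x)) \<in> borel_measurable borel"
        using ku(9) fG(6) by measurable
      show "AE x in lebesgue. x \<in> \<Omega> \<longrightarrow> (grad (\<Phi> \<delta>) x - weak_grad \<Omega> \<phi> x) /\<^sub>R \<Lambda> = (1 / \<Lambda>) *\<^sub>R (grad (\<Phi> \<delta>) x - G x)"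
        using g by eventually_elim (simp add: inverse_eq_divide)
    qed
    also have "\<dots> = ennreal (LINT x|lborel. indicator \<Omega> x * M x ((1 / \<Lambda>) *\<^sub>R (grad (\<Phi> \<delta>) x - G x)))"
    proof (rule nn_integral_eq_integral[OF \<Phi>(3)[OF \<delta>]])
      show "AE x in lborel. 0 \<le> indicator \<Omega> x * M x ((1 / \<Lambda>) *\<^sub>R (grad (\<Phi> \<delta>) x - G x))"
        using M_nonneg by (intro AE_I2) (simp add: indicator_def)
    qed
    also have "\<dots> \<le> ennreal (1 * \<delta>)" using \<Phi>(4)[OF \<delta>] by (intro ennreal_leI) simp
    finally show "modular \<Omega> M (\<lambda>x. (grad (\<Phi> \<delta>) x - weak_grad \<Omega> \<phi> x) /\<^sub>R \<Lambda>) \<le> ennreal (1 * \<delta>)" .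
  qed
  ultimately have "smooth_approximation \<Omega> M \<Phi> \<phi>"
    unfolding smooth_approximation_def using \<Phi>(1) by blast
  moreover have "Linf_norm \<Omega> (\<Phi> \<delta>) \<le> ereal c * Linf_norm \<Omega> \<phi>" if "\<phi> \<in> Linf \<Omega>" "\<delta> > 0" for \<delta>
    by (rule Linf_norm_le_of_bound[OF \<Omega> that(1) f fG(3) kernel_onD(4)[OF Cc_infinityD(1)[OF \<Phi>(1)[OF that(2)]]] \<Phi>(5)[OF that(2)]])
  ultimately show ?thesis by blast
qed

end

section \<open>The unbounded case and the Hoelder case\<close>

text \<open>The gradient of the kernel has integral zero, so a constant may be subtracted from \<open>f\<close>.\<close>

lemma norm_grad_conv_le_oscillation:
  fixes f :: "real^'n \<Rightarrow> real"
  assumes f: "integrable lborel f" and k: "kernel_on S k" and osc: "\<And>y. x - y \<in> S \<Longrightarrow> \<bar>f y - c\<bar> \<le> Q"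
  shows "norm (grad (conv k f) x) \<le> Q * (LINT z|lborel. norm (grad k z))"
proof -
  note kd = kernel_onD[OF k]
  have gi: "integrable lborel (\<lambda>y. grad k (x - y))"
    by (rule integrable_lborel_reflect[OF kernel_on_integrable(2)[OF k]])
  have g0: "(LINT y|lborel. grad k (x - y)) = 0"
    using integral_lborel_reflect[OF kd(9), of x] integral_grad_zero[OF k] by simp
  have fg: "integrable lborel (\<lambda>y. f y *\<^sub>R grad k (x - y))" by (rule integrable_conv_grad[OF f k])
  have "grad (conv k f) x = (LINT y|lborel. f y *\<^sub>R grad k (x - y)) - (LINT y|lborel. c *\<^sub>R grad k (x - y))"
    using g0 gi by (simp add: grad_conv[OF f k])
  also have "\<dots> = (LINT y|lborel. f y *\<^sub>R grad k (x - y) - c *\<^sub>R grad k (x - y))"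
    by (rule Bochner_Integration.integral_diff[symmetric]) (intro fg integrable_scaleR_right gi)+
  also have "norm \<dots> \<le> (LINT y|lborel. Q * norm (grad k (x - y)))"
  proof (rule integral_norm_bound_scaled)
    show "integrable lborel (\<lambda>y. f y *\<^sub>R grad k (x - y) - c *\<^sub>R grad k (x - y))"
      by (intro Bochner_Integration.integrable_diff fg integrable_scaleR_right gi)
    show "integrable lborel (\<lambda>y. Q * norm (grad k (x - y)))" using gi by simp
    show "norm (f y *\<^sub>R grad k (x - y) - c *\<^sub>R grad k (x - y)) \<le> Q * norm (grad k (x - y))" for y
    proof (cases "x - y \<in> S")
      case True
      then show ?thesis
        unfolding scaleR_left_diff_distrib[symmetric] norm_scaleR real_norm_def
        by (intro mult_right_mono osc) auto
    qed (simp add: kd(7))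
  qed
  also have "\<dots> = Q * (LINT y|lborel. norm (grad k (x - y)))" by simp
  also have "(LINT y|lborel. norm (grad k (x - y))) = (LINT z|lborel. norm (grad k z))"
    using kd(9) by (intro integral_lborel_reflect[where F="\<lambda>z. norm (grad k z)"]) simp
  finally show ?thesis .
qed

lemma lipschitz_of_bounded_grad:
  fixes f :: "real^'n \<Rightarrow> real"
  assumes f: "C_k 1 f" and D: "\<And>x. norm (grad f x) \<le> D"
  shows "\<bar>f x - f y\<bar> \<le> D * dist x y"
proof -
  have "norm (f x - f y) \<le> D * norm (x - y)"
  proof (rule differentiable_bound[of UNIV])
    show "(f has_derivative (\<lambda>h. grad f x \<bullet> h)) (at x within UNIV)" for x
      using has_derivative_grad[OF C_k_differentiable[OF f[unfolded One_nat_def]]] by simp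
    show "onorm (\<lambda>h. grad f x \<bullet> h) \<le> D" for x
    proof (rule onorm_le)
      fix h
      show "norm (grad f x \<bullet> h) \<le> D * norm h"
        using Cauchy_Schwarz_ineq2[of "grad f x" h] mult_right_mono[OF D[of x] norm_ge_zero[of h]] by simp
    qed
  qed auto
  then show ?thesis by (simp add: dist_norm)
qed

text \<open>The truncations \<open>t \<mapsto> n arctan (t / n)\<close> are bounded, and both they and their derivatives
  converge without exceeding their limits.\<close>

definition trunc :: "nat \<Rightarrow> real \<Rightarrow> real" where
  "trunc n t = real (Suc n) * arctan (t / real (Suc n))"

definition trunc' :: "nat \<Rightarrow> real \<Rightarrow> real" where
  "trunc' n t = inverse (1 + (t / real (Suc n))\<^sup>2)"

lemma trunc_has_derivative: "(trunc n has_real_derivative trunc' n t) (at t)"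
proof -
  have "((\<lambda>t. t / real (Suc n)) has_real_derivative 1 / real (Suc n)) (at t)"
    by (intro DERIV_cdivide DERIV_ident)
  from DERIV_cmult[OF DERIV_chain2[OF DERIV_arctan this], of "real (Suc n)"]
  show ?thesis by (simp add: trunc_def[abs_def] trunc'_def del: of_nat_Suc)
qed

lemma trunc'_bounds: "0 \<le> trunc' n t" "trunc' n t \<le> 1"
  by (simp_all add: trunc'_def inverse_le_1_iff)

lemma trunc'_continuous: "continuous_on UNIV (trunc' n)"
  unfolding trunc'_def
  by (intro continuous_intros) (auto simp: add_nonneg_eq_0_iff)

lemma trunc_0: "trunc n 0 = 0"
  by (simp add: trunc_def)

lemma abs_trunc_le: "\<bar>trunc n t\<bar> \<le> \<bar>t\<bar>"
proof -
  have "\<bar>trunc' n t\<bar> \<le> 1" for t using trunc'_bounds[of n t] by simp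
  from lipschitz_of_bounded_deriv[OF trunc_has_derivative this, of t 0] show ?thesis by (simp add: trunc_0)
qed

lemma trunc_bounded: "\<bar>trunc n t\<bar> \<le> real (Suc n) * 2"
proof -
  have "\<bar>arctan (t / real (Suc n))\<bar> \<le> 2"
    using arctan_bounded[of "t / real (Suc n)"] pi_less_4 by (simp add: abs_le_iff)
  then show ?thesis unfolding trunc_def abs_mult abs_of_nat by (intro mult_left_mono) simp_all
qed

lemma scaled_index_tendsto: "(\<lambda>n. t / real (Suc n)) \<longlonglongrightarrow> 0"
  using tendsto_mult_left[OF LIMSEQ_inverse_real_of_nat, of t] by (simp add: divide_inverse)

lemma trunc'_tendsto: "(\<lambda>n. trunc' n t) \<longlonglongrightarrow> 1"
proof -
  have "(\<lambda>n. inverse (1 + (t / real (Suc n))\<^sup>2)) \<longlonglongrightarrow> inverse (1 + 0\<^sup>2)"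
    by (intro tendsto_intros scaled_index_tendsto) simp
  then show ?thesis by (simp add: trunc'_def)
qed

lemma trunc_tendsto: "(\<lambda>n. trunc n t) \<longlonglongrightarrow> t"
proof (cases "t = 0")
  case False
  have "((\<lambda>h::real. arctan h / h) \<longlongrightarrow> 1) (at 0)"
    using DERIV_arctan[of 0] by (simp add: DERIV_def)
  moreover have "filterlim (\<lambda>n. t / real (Suc n)) (at 0) sequentially"
    using False by (intro filterlim_atI scaled_index_tendsto always_eventually) (auto simp del: of_nat_Suc)
  ultimately have "(\<lambda>n. arctan (t / real (Suc n)) / (t / real (Suc n))) \<longlonglongrightarrow> 1"
    by (rule filterlim_compose)
  from tendsto_mult_left[OF this, of t] show ?thesis
    using False by (simp add: trunc_def field_simps del: of_nat_Suc)
qed (simp add: trunc_0)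

context approximation
begin

lemma tail_bound:
  assumes W: "sobolev0 \<Omega> f G" and z: "z \<in> Z" and s: "s > 0"
    and osc: "\<And>y. norm (x - y) \<le> 2 * s \<Longrightarrow> \<bar>\<theta> z y * f y - c\<bar> \<le> Q" and Q: "Q \<ge> 0"
  shows "norm (conv (k z s) (\<lambda>x. \<theta> z x *\<^sub>R G x + f x *\<^sub>R grad (\<theta> z) x) x) \<le> Q * (A / s)"
proof -
  note W\<psi> = localized[OF W z]
  have kS: "kernel_on (S z s) (k z s)" using k_mollifier[OF z s] by (simp add: mollifier_on_def)
  have "norm (grad (conv (k z s) (\<lambda>x. \<theta> z x * f x)) x) \<le> Q * (LINT y|lborel. norm (grad (k z s) y))"
  proof (rule norm_grad_conv_le_oscillation[OF sobolev0D(1)[OF W\<psi>] kS])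
    fix y assume "x - y \<in> S z s"
    then have "x - y \<in> cball 0 (2 * s)" by (rule subsetD[OF k_support[OF z s]])
    then show "\<bar>\<theta> z y * f y - c\<bar> \<le> Q" by (intro osc) simp
  qed
  also have "\<dots> \<le> Q * (A / s)" by (intro mult_left_mono k_grad[OF z s] Q)
  finally show ?thesis by (simp only: sobolev0_grad_conv[OF W\<psi> kS])
qed

text \<open>Truncation replaces \<open>f\<close> by a function with \<open>\<bar>f\<bar> \<le> N\<close>, whose mollification at scale \<open>s\<close> has a
  gradient of size up to \<open>N A / s\<close>; compared with the admissible size \<open>1 / s\<close>, a factor \<open>N\<close> is lost.
  Averaging over \<open>L\<close> dyadic scales wins a factor \<open>L\<close>, because the bounds form a geometric series.
  Hence \<open>L\<close> proportional to \<open>N\<close> works for all levels of truncation with the same \<open>\<Lambda>\<close>.\<close>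

lemma unbounded_approximation:
  fixes f :: "real^'n \<Rightarrow> real"
  assumes \<gamma>: "\<gamma> = 0" and W: "sobolev0 \<Omega> f G" and fin: "emeasure lborel \<Omega> < \<infinity>"
    and a: "a > 0" "integrable lborel (\<lambda>x. indicator \<Omega> x * M x (a *\<^sub>R G x))" and \<epsilon>: "\<epsilon> > 0"
    and \<Lambda>: "\<Lambda> = 16 * C * J / a"
  shows "\<exists>u. u \<in> Cc_infinity \<Omega> \<and> (LINT x|lborel. norm (u x - f x)) < \<epsilon> \<and>
      integrable lborel (\<lambda>x. indicator \<Omega> x * M x ((1 / (2 * \<Lambda>)) *\<^sub>R (grad u x - G x))) \<and>
      (LINT x|lborel. indicator \<Omega> x * M x ((1 / (2 * \<Lambda>)) *\<^sub>R (grad u x - G x))) < \<epsilon> \<and>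
      (\<forall>B. (AE x in lborel. \<bar>f x\<bar> \<le> B) \<longrightarrow> (\<forall>x. \<bar>u x\<bar> \<le> J * B))"
proof -
  note fG = sobolev0D[OF W]
  have CJ: "1 \<le> 16 * C * J"
  proof -
    have "1 * 1 \<le> C * J" using C_ge_1 J_ge_1 by (intro mult_mono) auto
    then show ?thesis by linarith
  qed
  have \<Lambda>0: "\<Lambda> > 0" using CJ a(1) unfolding \<Lambda> by (intro divide_pos_pos) linarith+
  have \<Lambda>a: "1 / \<Lambda> \<le> a"
  proof -
    have "1 / \<Lambda> = a / (16 * C * J)" using a(1) by (simp add: \<Lambda>)
    also have "\<dots> \<le> a / 1" using CJ a(1) by (intro divide_left_mono) auto
    finally show ?thesis by simp
  qed
  define fn where "fn n x = trunc n (f x)" for n x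
  define Gn where "Gn n x = trunc' n (f x) *\<^sub>R G x" for n x
  have b1: "\<bar>trunc' n t\<bar> \<le> 1" for n t using trunc'_bounds[of n t] by simp
  have Wn: "sobolev0 \<Omega> (fn n) (Gn n)" for n
    unfolding fn_def Gn_def
    by (rule sobolev0_chain[OF W trunc_has_derivative trunc'_continuous b1 trunc_0])
  define E where "E n x = indicator \<Omega> x * M x ((1 / \<Lambda>) *\<^sub>R (Gn n x - G x))" for n x
  have E_meas: "E n \<in> borel_measurable borel" for n
  proof -
    have "(\<lambda>x. (1 / \<Lambda>) *\<^sub>R (Gn n x - G x)) \<in> borel_measurable borel"
      using sobolev0D(6)[OF Wn] fG(6) by measurable
    from measurable_M_compose[OF this] show ?thesis by (simp add: E_def[abs_def])
  qed
  have E_nn: "0 \<le> E n x" for n x unfolding E_def using M_nonneg[of x] by (cases "x \<in> \<Omega>") auto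
  have E_le: "E n x \<le> (1 - trunc' n (f x)) * (indicator \<Omega> x * M x (a *\<^sub>R G x))" for n x
  proof (cases "x \<in> \<Omega>")
    case True
    have "(1 / \<Lambda>) *\<^sub>R (Gn n x - G x) = - ((1 - trunc' n (f x)) *\<^sub>R ((1 / \<Lambda>) *\<^sub>R G x))"
      by (simp add: Gn_def algebra_simps)
    then have "M x ((1 / \<Lambda>) *\<^sub>R (Gn n x - G x)) = M x ((1 - trunc' n (f x)) *\<^sub>R ((1 / \<Lambda>) *\<^sub>R G x))"
      by (simp only: M_even[OF True])
    also have "\<dots> \<le> (1 - trunc' n (f x)) * M x ((1 / \<Lambda>) *\<^sub>R G x)"
      using trunc'_bounds[of n "f x"] by (intro M_scale_le[OF True]) auto
    also have "\<dots> \<le> (1 - trunc' n (f x)) * M x (a *\<^sub>R G x)"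
      using trunc'_bounds[of n "f x"] \<Lambda>0 \<Lambda>a by (intro mult_left_mono M_scale_mono[OF True]) auto
    finally show ?thesis using True by (simp add: E_def)
  qed (simp add: E_def)
  have E_le': "E n x \<le> indicator \<Omega> x * M x (a *\<^sub>R G x)" for n x
  proof -
    have "0 \<le> indicator \<Omega> x * M x (a *\<^sub>R G x)" using M_nonneg[of x] by (cases "x \<in> \<Omega>") auto
    then have "(1 - trunc' n (f x)) * (indicator \<Omega> x * M x (a *\<^sub>R G x)) \<le> 1 * (indicator \<Omega> x * M x (a *\<^sub>R G x))"
      using trunc'_bounds[of n "f x"] by (intro mult_right_mono) auto
    then show ?thesis using E_le[of n x] by simp
  qed
  have E_int: "integrable lborel (E n)" for n
  proof (rule Bochner_Integration.integrable_bound[OF a(2)])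
    show "AE x in lborel. norm (E n x) \<le> norm (indicator \<Omega> x * M x (a *\<^sub>R G x))"
      using E_nn[of n] E_le'[of n] by (intro AE_I2) (smt (verit) real_norm_def)
  qed (use E_meas in simp)
  have "(\<lambda>n. LINT x|lborel. E n x) \<longlonglongrightarrow> (LINT x::real^'n|lborel. (0::real))"
  proof (rule integral_dominated_convergence[where w="\<lambda>x. indicator \<Omega> x * M x (a *\<^sub>R G x)"])
    show "AE x in lborel. (\<lambda>n. E n x) \<longlonglongrightarrow> 0"
    proof (rule AE_I2)
      fix x
      have "(\<lambda>n. (1 - trunc' n (f x)) * (indicator \<Omega> x * M x (a *\<^sub>R G x))) \<longlonglongrightarrow> (1 - 1) * (indicator \<Omega> x * M x (a *\<^sub>R G x))"
        by (intro tendsto_intros trunc'_tendsto)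
      then have "(\<lambda>n. (1 - trunc' n (f x)) * (indicator \<Omega> x * M x (a *\<^sub>R G x))) \<longlonglongrightarrow> 0" by simp
      then show "(\<lambda>n. E n x) \<longlonglongrightarrow> 0" by (rule tendsto_0_squeeze[OF _ E_nn E_le])
    qed
    show "AE x in lborel. norm (E n x) \<le> indicator \<Omega> x * M x (a *\<^sub>R G x)" for n
      using E_nn[of n] E_le'[of n] by (intro AE_I2) simp
  qed (use E_int a(2) in auto)
  then have E_lim: "(\<lambda>n. LINT x|lborel. E n x) \<longlonglongrightarrow> 0" by simp
  have "(\<lambda>n. LINT x|lborel. norm (fn n x - f x)) \<longlonglongrightarrow> (LINT x::real^'n|lborel. (0::real))"
  proof (rule integral_dominated_convergence[where w="\<lambda>x. 2 * \<bar>f x\<bar>"])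
    show "AE x in lborel. (\<lambda>n. norm (fn n x - f x)) \<longlonglongrightarrow> 0"
      unfolding fn_def by (intro AE_I2 tendsto_norm_zero LIM_zero trunc_tendsto)
    show "AE x in lborel. norm (norm (fn n x - f x)) \<le> 2 * \<bar>f x\<bar>" for n
    proof (rule AE_I2)
      fix x show "norm (norm (fn n x - f x)) \<le> 2 * \<bar>f x\<bar>"
        using abs_trunc_le[of n "f x"] by (simp add: fn_def)
    qed
  qed (use fG(1,5) sobolev0D(5)[OF Wn] in auto)
  then have f_lim: "(\<lambda>n. LINT x|lborel. norm (fn n x - f x)) \<longlonglongrightarrow> 0" by simp
  have "\<epsilon> / 2 > 0" using \<epsilon> by simp
  from eventually_conj[OF order_tendstoD(2)[OF f_lim this] order_tendstoD(2)[OF E_lim \<epsilon>]]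
  obtain n where n: "(LINT x|lborel. norm (fn n x - f x)) < \<epsilon> / 2" "(LINT x|lborel. E n x) < \<epsilon>"
    unfolding eventually_sequentially by blast
  define N where "N = real (Suc n) * 2"
  have N: "\<bar>fn n x\<bar> \<le> N" for x unfolding fn_def N_def by (rule trunc_bounded)
  have N0: "N > 0" by (simp add: N_def)
  define \<mu> where "\<mu> = 4 * J / \<Lambda>"
  have \<mu>: "\<mu> > 0" using J_ge_1 \<Lambda>0 by (simp add: \<mu>_def)
  define L where "L = nat \<lceil>8 * \<mu> * N * A\<rceil> + 1"
  have L: "L > 0" "8 * \<mu> * N * A \<le> real L" by (simp_all add: L_def) linarith
  \<comment> \<open>The number of scales is chosen according to the level of truncation.\<close>
  have tail: "(4 * J / \<Lambda>) / L * (\<Sum>l\<in>{j..<L}. norm (conv (k z (2 ^ l * s)) (\<lambda>x. \<theta> z x *\<^sub>R Gn n x + fn n x *\<^sub>R grad (\<theta> z) x) x))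
        \<le> (4 * 2 ^ j * s) powr (\<gamma> - 1)"
    if z: "z \<in> Z" and s: "0 < s" for z s j x
  proof -
    have each: "norm (conv (k z (2 ^ l * s)) (\<lambda>x. \<theta> z x *\<^sub>R Gn n x + fn n x *\<^sub>R grad (\<theta> z) x) x) \<le> (N * A / s) * (1 / 2) ^ l" for l
    proof -
      have "norm (conv (k z (2 ^ l * s)) (\<lambda>x. \<theta> z x *\<^sub>R Gn n x + fn n x *\<^sub>R grad (\<theta> z) x) x) \<le> N * (A / (2 ^ l * s))"
      proof (rule tail_bound[OF Wn z, where c=0])
        show "\<bar>\<theta> z y * fn n y - 0\<bar> \<le> N" for y
        proof -
          have "\<bar>\<theta> z y * fn n y\<bar> \<le> 1 * N"
            unfolding abs_mult using \<theta>_nonneg[OF z, of y] \<theta>_le_1[OF z, of y] N[of y] by (intro mult_mono) auto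
          then show ?thesis by simp
        qed
      qed (use s N0 in auto)
      then show ?thesis by (simp add: power_one_over field_simps)
    qed
    have geo: "(\<Sum>l\<in>{j..<L}. (1 / 2 :: real) ^ l) \<le> 2 * (1 / 2) ^ j"
    proof (cases "j \<le> L")
      case True
      then have "(\<Sum>l\<in>{j..<L}. (1 / 2 :: real) ^ l) = 2 * (1 / 2) ^ j - 2 * (1 / 2) ^ L"
        by (induction L rule: dec_induct) simp_all
      then show ?thesis by simp
    qed simp
    have "(4 * J / \<Lambda>) / L * (\<Sum>l\<in>{j..<L}. norm (conv (k z (2 ^ l * s)) (\<lambda>x. \<theta> z x *\<^sub>R Gn n x + fn n x *\<^sub>R grad (\<theta> z) x) x))
      \<le> \<mu> / L * (\<Sum>l\<in>{j..<L}. (N * A / s) * (1 / 2) ^ l)"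
      unfolding \<mu>_def[symmetric] using \<mu> by (intro mult_left_mono sum_mono each) auto
    also have "\<dots> = \<mu> / L * (N * A / s) * (\<Sum>l\<in>{j..<L}. (1 / 2) ^ l)"
      by (simp add: sum_distrib_left mult.assoc)
    also have "\<dots> \<le> \<mu> / L * (N * A / s) * (2 * (1 / 2) ^ j)"
      using \<mu> N0 A_pos s by (intro mult_left_mono geo) auto
    also have "\<dots> = (8 * \<mu> * N * A) * (1 / (L * (4 * 2 ^ j * s)))"
      by (simp add: power_one_over field_simps)
    also have "\<dots> \<le> real L * (1 / (L * (4 * 2 ^ j * s)))"
      using L s by (intro mult_right_mono) auto
    also have "\<dots> = 1 / (4 * 2 ^ j * s)" using L(1) by simp
    also have "\<dots> = (4 * 2 ^ j * s) powr (\<gamma> - 1)"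
      using s by (simp add: \<gamma> powr_minus_divide)
    finally show ?thesis .
  qed
  have Gn_int: "integrable lborel (\<lambda>x. indicator \<Omega> x * M x ((16 * C * J / \<Lambda>) *\<^sub>R Gn n x))"
  proof (rule Bochner_Integration.integrable_bound[OF a(2)])
    have "X / (X / a) = a" if "1 \<le> X" for X :: real using that a(1) by simp
    from this[OF CJ] have eq: "16 * C * J / \<Lambda> = a" by (simp only: \<Lambda>)
    have "(\<lambda>x. (16 * C * J / \<Lambda>) *\<^sub>R Gn n x) \<in> borel_measurable borel"
      using sobolev0D(6)[OF Wn] by measurable
    from measurable_M_compose[OF this]
    show "(\<lambda>x. indicator \<Omega> x * M x ((16 * C * J / \<Lambda>) *\<^sub>R Gn n x)) \<in> borel_measurable lborel" by simp
    show "AE x in lborel. norm (indicator \<Omega> x * M x ((16 * C * J / \<Lambda>) *\<^sub>R Gn n x)) \<le> norm (indicator \<Omega> x * M x (a *\<^sub>R G x))"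
    proof (rule AE_I2)
      fix x
      show "norm (indicator \<Omega> x * M x ((16 * C * J / \<Lambda>) *\<^sub>R Gn n x)) \<le> norm (indicator \<Omega> x * M x (a *\<^sub>R G x))"
      proof (cases "x \<in> \<Omega>")
        case True
        have "M x ((a * trunc' n (f x)) *\<^sub>R G x) \<le> M x (a *\<^sub>R G x)"
          using trunc'_bounds[of n "f x"] a(1) by (intro M_scale_mono[OF True]) (auto simp: mult_left_le)
        then show ?thesis
          using True M_nonneg[OF True] by (simp add: eq Gn_def)
      qed simp
    qed
  qed
  obtain u where u: "u \<in> Cc_infinity \<Omega>" "(LINT x|lborel. norm (u x - fn n x)) < \<epsilon> / 2"
    "integrable lborel (\<lambda>x. indicator \<Omega> x * M x ((1 / \<Lambda>) *\<^sub>R (grad u x - Gn n x)))"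
    "(LINT x|lborel. indicator \<Omega> x * M x ((1 / \<Lambda>) *\<^sub>R (grad u x - Gn n x))) < \<epsilon> / 2"
    "\<And>B x. (AE x in lborel. \<bar>fn n x\<bar> \<le> B) \<Longrightarrow> \<bar>u x\<bar> \<le> J * B"
    by (rule bounded_approximation[OF Wn N fin \<Lambda>0 L(1) Gn_int zero_less_one tail \<open>\<epsilon> / 2 > 0\<close>])
      (assumption | rule that)+
  note ku = kernel_onD[OF Cc_infinityD(1)[OF u(1)]] and ui = kernel_on_integrable[OF Cc_infinityD(1)[OF u(1)]]
  let ?K = "\<lambda>x. indicator \<Omega> x * M x ((1 / (2 * \<Lambda>)) *\<^sub>R (grad u x - G x))"
  let ?K' = "\<lambda>x. indicator \<Omega> x * M x ((1 / \<Lambda>) *\<^sub>R (grad u x - Gn n x))"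
  have K_nn: "0 \<le> ?K x" for x using M_nonneg[of x] by (cases "x \<in> \<Omega>") auto
  have K_le: "?K x \<le> ?K' x / 2 + E n x / 2" for x
  proof (cases "x \<in> \<Omega>")
    case True
    have "(1 / (2 * \<Lambda>)) *\<^sub>R (grad u x - G x)
      = (1 / (2 * \<Lambda>)) *\<^sub>R (grad u x - Gn n x) + (1 / (2 * \<Lambda>)) *\<^sub>R (Gn n x - G x)"
      by (simp add: scaleR_add_right[symmetric])
    then have "M x ((1 / (2 * \<Lambda>)) *\<^sub>R (grad u x - G x)) \<le>
      M x (2 *\<^sub>R (1 / (2 * \<Lambda>)) *\<^sub>R (grad u x - Gn n x)) / 2 + M x (2 *\<^sub>R (1 / (2 * \<Lambda>)) *\<^sub>R (Gn n x - G x)) / 2"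
      using M_midpoint[OF True] by metis
    then show ?thesis using True by (simp add: E_def)
  qed (simp add: E_def)
  have K_int: "integrable lborel ?K"
  proof (rule Bochner_Integration.integrable_bound[where f="\<lambda>x. ?K' x / 2 + E n x / 2"])
    show "integrable lborel (\<lambda>x. ?K' x / 2 + E n x / 2)" using u(3) E_int[of n] by simp
    have "(\<lambda>x. (1 / (2 * \<Lambda>)) *\<^sub>R (grad u x - G x)) \<in> borel_measurable borel"
      using ku(9) fG(6) by measurable
    from measurable_M_compose[OF this] show "?K \<in> borel_measurable lborel" by simp
    show "AE x in lborel. norm (?K x) \<le> norm (?K' x / 2 + E n x / 2)"
    proof (rule AE_I2)
      fix x
      show "norm (?K x) \<le> norm (?K' x / 2 + E n x / 2)"
        using K_nn[of x] K_le[of x] unfolding real_norm_def by linarith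
    qed
  qed
  have "(LINT x|lborel. ?K x) \<le> (LINT x|lborel. ?K' x / 2 + E n x / 2)"
    by (rule integral_mono[OF K_int _ K_le]) (use u(3) E_int[of n] in simp)
  also have "\<dots> = (LINT x|lborel. ?K' x) / 2 + (LINT x|lborel. E n x) / 2"
    using u(3) E_int[of n] by simp
  also have "\<dots> < \<epsilon>" using u(4) n(2) \<epsilon> by linarith
  finally have K_small: "(LINT x|lborel. ?K x) < \<epsilon>" .
  have i1: "integrable lborel (\<lambda>x. norm (u x - fn n x))" "integrable lborel (\<lambda>x. norm (fn n x - f x))"
    using ui(1) sobolev0D(1)[OF Wn] fG(1) by auto
  have "(LINT x|lborel. norm (u x - f x)) \<le> (LINT x|lborel. norm (u x - fn n x) + norm (fn n x - f x))"
  proof (rule integral_mono)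
    show "norm (u x - f x) \<le> norm (u x - fn n x) + norm (fn n x - f x)" for x
      using norm_triangle_ineq[of "u x - fn n x" "fn n x - f x"] by simp
  qed (use i1 ui(1) fG(1) in auto)
  also have "\<dots> = (LINT x|lborel. norm (u x - fn n x)) + (LINT x|lborel. norm (fn n x - f x))"
    by (rule Bochner_Integration.integral_add[OF i1])
  also have "\<dots> < \<epsilon>" using u(2) n(1) by linarith
  finally have f_small: "(LINT x|lborel. norm (u x - f x)) < \<epsilon>" .
  have "\<bar>u x\<bar> \<le> J * B" if "AE x in lborel. \<bar>f x\<bar> \<le> B" for B x
  proof (rule u(5))
    show "AE x in lborel. \<bar>fn n x\<bar> \<le> B"
      using that by eventually_elim (use abs_trunc_le[of n] in \<open>auto simp: fn_def intro: order_trans\<close>)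
  qed
  with u(1) f_small K_int K_small show ?thesis by blast
qed

text \<open>A Hoelder continuous function oscillates by at most \<open>Q s powr \<gamma>\<close> at scale \<open>s\<close>, so the gradient of
  its mollification has at most the order \<open>s powr (\<gamma> - 1)\<close> of the admissible size. The constant is
  absorbed by \<open>\<Lambda>\<close>, and a single scale is enough.\<close>

lemma Hoelder_approximation:
  fixes f :: "real^'n \<Rightarrow> real"
  assumes \<gamma>: "0 < \<gamma>" "\<gamma> \<le> 1" and W: "sobolev0 \<Omega> f G" and fin: "emeasure lborel \<Omega> < \<infinity>"
    and f: "\<And>x. \<bar>f x\<bar> \<le> N" "\<And>x y. \<bar>f x - f y\<bar> \<le> H * dist x y powr \<gamma>"
    and a: "a > 0" "integrable lborel (\<lambda>x. indicator \<Omega> x * M x (a *\<^sub>R G x))"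
  obtains \<Lambda> where "\<Lambda> > 0" "\<And>\<epsilon>. \<epsilon> > 0 \<Longrightarrow> \<exists>u. u \<in> Cc_infinity \<Omega> \<and> (LINT x|lborel. norm (u x - f x)) < \<epsilon> \<and>
      integrable lborel (\<lambda>x. indicator \<Omega> x * M x ((1 / \<Lambda>) *\<^sub>R (grad u x - G x))) \<and>
      (LINT x|lborel. indicator \<Omega> x * M x ((1 / \<Lambda>) *\<^sub>R (grad u x - G x))) < \<epsilon> \<and>
      (\<forall>B. (AE x in lborel. \<bar>f x\<bar> \<le> B) \<longrightarrow> (\<forall>x. \<bar>u x\<bar> \<le> J * B))"
proof -
  note fG = sobolev0D[OF W]
  obtain z0 where z0: "z0 \<in> Z" using Z_nonempty by blast
  have N: "N \<ge> 0" using f(1)[of 0] by linarith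
  have D: "D \<ge> 0" using order_trans[OF norm_ge_zero grad_\<theta>[OF z0, of 0]] .
  have H: "H \<ge> 0" using f(2)[of 0 "axis undefined 1"] by (simp add: dist_norm)
  define Q where "Q = H + N * D"
  have Q: "Q \<ge> 0" using H N D by (simp add: Q_def)
  have osc: "\<bar>\<theta> z y * f y - \<theta> z x * f x\<bar> \<le> Q * (2 * s) powr \<gamma>"
    if z: "z \<in> Z" and s: "0 < s" "2 * s \<le> 1" and xy: "norm (x - y) \<le> 2 * s" for z x y s
  proof -
    have d: "dist y x \<le> 2 * s" using xy by (simp add: dist_norm norm_minus_commute)
    have "2 * s = (2 * s) powr 1" using s by simp
    also have "\<dots> \<le> (2 * s) powr \<gamma>" using s \<gamma> by (intro powr_mono') auto
    finally have s_le: "2 * s \<le> (2 * s) powr \<gamma>" .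
    have "\<theta> z y * f y - \<theta> z x * f x = \<theta> z y * (f y - f x) + f x * (\<theta> z y - \<theta> z x)" by (simp add: algebra_simps)
    also have "\<bar>\<dots>\<bar> \<le> \<theta> z y * \<bar>f y - f x\<bar> + \<bar>f x\<bar> * \<bar>\<theta> z y - \<theta> z x\<bar>"
      using abs_triangle_ineq[of "\<theta> z y * (f y - f x)" "f x * (\<theta> z y - \<theta> z x)"] \<theta>_nonneg[OF z, of y]
      by (simp add: abs_mult)
    also have "\<dots> \<le> 1 * (H * (2 * s) powr \<gamma>) + N * (D * (2 * s) powr \<gamma>)"
    proof (intro add_mono mult_mono)
      have "\<bar>f y - f x\<bar> \<le> H * dist y x powr \<gamma>" by (rule f(2))
      also have "\<dots> \<le> H * (2 * s) powr \<gamma>" using d \<gamma> H by (intro mult_left_mono powr_mono2) auto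
      finally show "\<bar>f y - f x\<bar> \<le> H * (2 * s) powr \<gamma>" .
      have "\<bar>\<theta> z y - \<theta> z x\<bar> \<le> D * dist y x" by (rule lipschitz_of_bounded_grad[OF \<theta>_C1[OF z] grad_\<theta>[OF z]])
      also have "\<dots> \<le> D * (2 * s) powr \<gamma>" using d s_le D by (intro mult_left_mono) auto
      finally show "\<bar>\<theta> z y - \<theta> z x\<bar> \<le> D * (2 * s) powr \<gamma>" .
    qed (use f(1) \<theta>_le_1[OF z] N in auto)
    finally show ?thesis by (simp add: Q_def algebra_simps)
  qed
  define \<Lambda> where "\<Lambda> = 16 * C * J / a + 32 * J * Q * A"
  have CJ: "1 \<le> 16 * C * J"
  proof -
    have "1 * 1 \<le> C * J" using C_ge_1 J_ge_1 by (intro mult_mono) auto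
    then show ?thesis by linarith
  qed
  have first: "16 * C * J / a > 0" using CJ a(1) by (intro divide_pos_pos) linarith+
  have QA: "0 \<le> 32 * J * Q * A" using Q A_pos by simp
  have \<Lambda>0: "\<Lambda> > 0" using first QA unfolding \<Lambda>_def by linarith
  have \<Lambda>a: "16 * C * J / \<Lambda> \<le> a"
  proof -
    have "16 * C * J / a \<le> \<Lambda>" using QA by (simp only: \<Lambda>_def)
    then have "16 * C * J \<le> \<Lambda> * a" using a(1) by (simp add: pos_divide_le_eq)
    then show ?thesis using \<Lambda>0 by (simp add: pos_divide_le_eq mult.commute)
  qed
  have G_int: "integrable lborel (\<lambda>x. indicator \<Omega> x * M x ((16 * C * J / \<Lambda>) *\<^sub>R G x))"
  proof (rule Bochner_Integration.integrable_bound[OF a(2)])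
    have "(\<lambda>x. (16 * C * J / \<Lambda>) *\<^sub>R G x) \<in> borel_measurable borel" using fG(6) by measurable
    from measurable_M_compose[OF this]
    show "(\<lambda>x. indicator \<Omega> x * M x ((16 * C * J / \<Lambda>) *\<^sub>R G x)) \<in> borel_measurable lborel" by simp
    show "AE x in lborel. norm (indicator \<Omega> x * M x ((16 * C * J / \<Lambda>) *\<^sub>R G x)) \<le> norm (indicator \<Omega> x * M x (a *\<^sub>R G x))"
    proof (rule AE_I2)
      fix x
      have "0 \<le> 16 * C * J / \<Lambda>" using CJ \<Lambda>0 by (intro divide_nonneg_pos) linarith+
      then have "M x ((16 * C * J / \<Lambda>) *\<^sub>R G x) \<le> M x (a *\<^sub>R G x)" if "x \<in> \<Omega>"
        by (intro M_scale_mono[OF that] \<Lambda>a)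
      then show "norm (indicator \<Omega> x * M x ((16 * C * J / \<Lambda>) *\<^sub>R G x)) \<le> norm (indicator \<Omega> x * M x (a *\<^sub>R G x))"
        using M_nonneg[of x] by (cases "x \<in> \<Omega>") simp_all
    qed
  qed
  have tail: "(4 * J / \<Lambda>) / real (Suc 0) * (\<Sum>l\<in>{j..<Suc 0}. norm (conv (k z (2 ^ l * s)) (\<lambda>x. \<theta> z x *\<^sub>R G x + f x *\<^sub>R grad (\<theta> z) x) x))
        \<le> (4 * 2 ^ j * s) powr (\<gamma> - 1)"
    if z: "z \<in> Z" and s: "0 < s" "s \<le> 1 / 2" and j: "j < Suc 0" for z s j x
  proof -
    have s2: "2 * s \<le> 1" using s by simp
    have "norm (conv (k z s) (\<lambda>x. \<theta> z x *\<^sub>R G x + f x *\<^sub>R grad (\<theta> z) x) x) \<le> (Q * (2 * s) powr \<gamma>) * (A / s)"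
      by (rule tail_bound[OF W z s(1), where c="\<theta> z x * f x"]) (use osc[OF z s(1) s2] Q in auto)
    then have "(4 * J / \<Lambda>) * norm (conv (k z s) (\<lambda>x. \<theta> z x *\<^sub>R G x + f x *\<^sub>R grad (\<theta> z) x) x)
       \<le> (4 * J / \<Lambda>) * ((Q * (2 * s) powr \<gamma>) * (A / s))"
      using \<Lambda>0 by (intro mult_left_mono) auto
    also have "\<dots> = (32 * J * Q * A / \<Lambda>) * ((2 * s) powr \<gamma> / (8 * s))" by simp
    also have "\<dots> \<le> 1 * ((2 * s) powr \<gamma> / (8 * s))"
    proof (intro mult_right_mono)
      have "32 * J * Q * A \<le> \<Lambda>" using first by (simp only: \<Lambda>_def)
      then show "32 * J * Q * A / \<Lambda> \<le> 1" using \<Lambda>0 by (simp add: pos_divide_le_eq)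
    qed (use s in simp)
    also have "\<dots> \<le> (4 * s) powr \<gamma> / (4 * s)"
      using s \<gamma> by (intro order_trans[OF _ divide_right_mono[OF powr_mono2[of \<gamma> "2 * s" "4 * s"]]]) (auto intro!: divide_left_mono)
    also have "\<dots> = (4 * s) powr (\<gamma> - 1)" using s by (simp add: powr_diff)
    finally show ?thesis using j by simp
  qed
  have half: "(1 / 2 :: real) > 0" by simp
  show ?thesis
  proof (rule that[OF \<Lambda>0])
    fix \<epsilon> :: real assume \<epsilon>: "\<epsilon> > 0"
    show "\<exists>u. u \<in> Cc_infinity \<Omega> \<and> (LINT x|lborel. norm (u x - f x)) < \<epsilon> \<and>
      integrable lborel (\<lambda>x. indicator \<Omega> x * M x ((1 / \<Lambda>) *\<^sub>R (grad u x - G x))) \<and>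
      (LINT x|lborel. indicator \<Omega> x * M x ((1 / \<Lambda>) *\<^sub>R (grad u x - G x))) < \<epsilon> \<and>
      (\<forall>B. (AE x in lborel. \<bar>f x\<bar> \<le> B) \<longrightarrow> (\<forall>x. \<bar>u x\<bar> \<le> J * B))"
      by (rule bounded_approximation[OF W f(1) fin \<Lambda>0 zero_less_Suc[of 0] G_int half tail \<epsilon>]) (assumption | blast)+
  qed
qed

end

section \<open>The density theorem\<close>

lemma emeasure_bounded_domain:
  fixes \<Omega> :: "(real^'n) set"
  assumes "bounded_Lipschitz_domain \<Omega>"
  shows "emeasure lborel \<Omega> < \<infinity>"
  using assms emeasure_bounded_finite by (auto simp: bounded_Lipschitz_domain_def)

context approximation
begin

lemma V10_LM_representatives:
  assumes \<phi>: "\<phi> \<in> V10_LM \<Omega> M"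
  obtains f G a where "sobolev0 \<Omega> f G" "AE x in lebesgue. x \<in> \<Omega> \<longrightarrow> \<phi> x = f x"
    "AE x in lebesgue. x \<in> \<Omega> \<longrightarrow> weak_grad \<Omega> \<phi> x = G x"
    "a > 0" "integrable lborel (\<lambda>x. indicator \<Omega> x * M x (a *\<^sub>R G x))"
proof -
  have "\<phi> \<in> W11_0 \<Omega>" and g: "weak_grad \<Omega> \<phi> \<in> L_M \<Omega> M" using \<phi> by (auto simp: V10_LM_def)
  from W11_0_sobolev0[OF \<Omega>_open this(1)] obtain f G where f: "sobolev0 \<Omega> f G"
    "AE x in lebesgue. x \<in> \<Omega> \<longrightarrow> \<phi> x = f x" "AE x in lebesgue. x \<in> \<Omega> \<longrightarrow> weak_grad \<Omega> \<phi> x = G x" .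
  obtain a where a: "a > 0" "modular \<Omega> M (\<lambda>x. a *\<^sub>R weak_grad \<Omega> \<phi> x) < \<infinity>"
    by (rule L_M_finite_modular[OF g]) (rule that)
  have "integrable lborel (\<lambda>x. indicator \<Omega> x * M x (a *\<^sub>R G x))"
  proof (rule integrable_M_of_modular[OF _ _ a(2)])
    show "(\<lambda>x. a *\<^sub>R G x) \<in> borel_measurable borel" using sobolev0D(6)[OF f(1)] by simp
    show "AE x in lebesgue. x \<in> \<Omega> \<longrightarrow> a *\<^sub>R weak_grad \<Omega> \<phi> x = a *\<^sub>R G x" using f(3) by eventually_elim simp
  qed
  with f a(1) that show ?thesis by blast
qed

lemma smooth_approximation_unbounded:
  assumes \<Omega>: "bounded_Lipschitz_domain \<Omega>" and \<gamma>: "\<gamma> = 0" and \<phi>: "\<phi> \<in> V10_LM \<Omega> M"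
  shows "\<exists>\<Phi>. smooth_approximation \<Omega> M \<Phi> \<phi> \<and>
    (\<phi> \<in> Linf \<Omega> \<longrightarrow> (\<forall>\<delta>>0. Linf_norm \<Omega> (\<Phi> \<delta>) \<le> ereal J * Linf_norm \<Omega> \<phi>))"
proof -
  obtain f G a where f: "sobolev0 \<Omega> f G" "AE x in lebesgue. x \<in> \<Omega> \<longrightarrow> \<phi> x = f x"
    "AE x in lebesgue. x \<in> \<Omega> \<longrightarrow> weak_grad \<Omega> \<phi> x = G x"
    "a > 0" "integrable lborel (\<lambda>x. indicator \<Omega> x * M x (a *\<^sub>R G x))"
    by (rule V10_LM_representatives[OF \<phi>]) (rule that)
  have \<Lambda>: "0 < 2 * (16 * C * J / a)" using C_ge_1 J_ge_1 f(4) by simp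
  have "\<Omega> \<noteq> {}" using \<Omega> by (simp add: bounded_Lipschitz_domain_def)
  from smooth_approximation_of_representatives[OF this f(1-3) \<Lambda>
      unbounded_approximation[OF \<gamma> f(1) emeasure_bounded_domain[OF \<Omega>] f(4,5) _ refl]]
  show ?thesis .
qed

lemma smooth_approximation_Hoelder:
  assumes \<Omega>: "bounded_Lipschitz_domain \<Omega>" and \<gamma>: "0 < \<gamma>" "\<gamma> \<le> 1"
    and \<phi>: "\<phi> \<in> V10_LM \<Omega> M" and hoelder: "\<phi> \<in> C_0_gamma \<gamma> \<Omega>"
  shows "\<exists>\<Phi>. smooth_approximation \<Omega> M \<Phi> \<phi> \<and>
    (\<phi> \<in> Linf \<Omega> \<longrightarrow> (\<forall>\<delta>>0. Linf_norm \<Omega> (\<Phi> \<delta>) \<le> ereal J * Linf_norm \<Omega> \<phi>))"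
proof -
  obtain f0 G a where f0: "sobolev0 \<Omega> f0 G" "AE x in lebesgue. x \<in> \<Omega> \<longrightarrow> \<phi> x = f0 x"
    "AE x in lebesgue. x \<in> \<Omega> \<longrightarrow> weak_grad \<Omega> \<phi> x = G x"
    "a > 0" "integrable lborel (\<lambda>x. indicator \<Omega> x * M x (a *\<^sub>R G x))"
    by (rule V10_LM_representatives[OF \<phi>]) (rule that)
  obtain H where H: "H \<ge> 0" "\<And>x y. x \<in> \<Omega> \<Longrightarrow> y \<in> \<Omega> \<Longrightarrow> \<bar>\<phi> x - \<phi> y\<bar> \<le> H * dist x y powr \<gamma>"
    by (rule C_0_gammaD[OF hoelder]) (rule that)
  define f where "f x = (if x \<in> \<Omega> then \<phi> x else 0)" for x
  have f_hoelder: "\<bar>f x - f y\<bar> \<le> H * dist x y powr \<gamma>" for x y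
    unfolding f_def by (rule Hoelder_extension_by_zero[OF \<Omega> f0(1) AE_lborel_if_lebesgue[OF f0(2)] \<gamma>(1) H])
  have "continuous_on UNIV f"
    unfolding continuous_on_def
  proof
    fix x :: "real^'n"
    have "((\<lambda>y. H * dist y x powr \<gamma>) \<longlongrightarrow> H * dist x x powr \<gamma>) (at x)"
    proof (intro tendsto_mult tendsto_const tendsto_powr' tendsto_dist tendsto_ident_at)
      show "dist x x \<noteq> 0 \<or> 0 < \<gamma> \<and> (\<forall>\<^sub>F y in at x. 0 \<le> dist y x)" using \<gamma> by simp
    qed
    then have "((\<lambda>y. H * dist y x powr \<gamma>) \<longlongrightarrow> 0) (at x)" by simp
    then have "((\<lambda>y. f y - f x) \<longlongrightarrow> 0) (at x)"
      by (rule Lim_null_comparison[rotated]) (simp add: f_hoelder)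
    then show "(f \<longlongrightarrow> f x) (at x)" by (rule LIM_zero_cancel)
  qed
  then have f_meas: "f \<in> borel_measurable borel" by (rule borel_measurable_continuous_onI)
  have "AE x in lebesgue. f0 x = f x"
    using f0(2) by eventually_elim (use sobolev0D(3)[OF f0(1)] in \<open>auto simp: f_def\<close>)
  then have W: "sobolev0 \<Omega> f G"
    by (intro sobolev0_cong[OF f0(1) f_meas AE_lborel_if_lebesgue]) (simp_all add: f_def)
  have "bounded \<Omega>" "\<Omega> \<noteq> {}" using \<Omega> by (simp_all add: bounded_Lipschitz_domain_def)
  then obtain x0 r where r: "\<And>x. x \<in> \<Omega> \<Longrightarrow> dist x0 x \<le> r" "x0 \<in> \<Omega>" by (metis bounded_any_center ex_in_conv)
  have r0: "0 \<le> r" using r(1)[OF r(2)] by simp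
  have f_bounded: "\<bar>f x\<bar> \<le> \<bar>f x0\<bar> + H * r powr \<gamma>" for x
  proof (cases "x \<in> \<Omega>")
    case True
    have "\<bar>f x\<bar> \<le> \<bar>f x0\<bar> + \<bar>f x0 - f x\<bar>" by linarith
    also have "\<bar>f x0 - f x\<bar> \<le> H * dist x0 x powr \<gamma>" by (rule f_hoelder)
    also have "\<dots> \<le> H * r powr \<gamma>" using r(1)[OF True] \<gamma> H(1) by (intro mult_left_mono powr_mono2) auto
    finally show ?thesis by simp
  next
    case False
    then show ?thesis using H(1) by (simp add: f_def)
  qed
  obtain \<Lambda> where \<Lambda>: "\<Lambda> > 0" "\<And>\<epsilon>. \<epsilon> > 0 \<Longrightarrow> \<exists>u. u \<in> Cc_infinity \<Omega> \<and> (LINT x|lborel. norm (u x - f x)) < \<epsilon> \<and>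
      integrable lborel (\<lambda>x. indicator \<Omega> x * M x ((1 / \<Lambda>) *\<^sub>R (grad u x - G x))) \<and>
      (LINT x|lborel. indicator \<Omega> x * M x ((1 / \<Lambda>) *\<^sub>R (grad u x - G x))) < \<epsilon> \<and>
      (\<forall>B. (AE x in lborel. \<bar>f x\<bar> \<le> B) \<longrightarrow> (\<forall>x. \<bar>u x\<bar> \<le> J * B))"
    by (rule Hoelder_approximation[OF \<gamma> W emeasure_bounded_domain[OF \<Omega>] f_bounded f_hoelder f0(4,5)]) (rule that)
  have "AE x in lebesgue. x \<in> \<Omega> \<longrightarrow> \<phi> x = f x" by (simp add: f_def)
  from smooth_approximation_of_representatives[OF \<open>\<Omega> \<noteq> {}\<close> W this f0(3) \<Lambda>]
  show ?thesis .
qed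

end

theorem theorem2:
  fixes \<Omega> :: "(real^'n) set"
  assumes "bounded_Lipschitz_domain \<Omega>"
  shows "\<exists>c::real. c > 0 \<and>
    (\<forall>M :: real^'n \<Rightarrow> real^'n \<Rightarrow> real.
       weak_N_function \<Omega> M \<and> continuous_on (\<Omega> \<times> UNIV) (\<lambda>(x, \<xi>). M x \<xi>) \<longrightarrow>
       (B_iso 0 \<Omega> M \<or> B_ort 0 \<Omega> M \<longrightarrow>
          (\<forall>\<phi> \<in> V10_LM \<Omega> M. \<exists>\<Phi>. smooth_approximation \<Omega> M \<Phi> \<phi> \<and>
             (\<phi> \<in> Linf \<Omega> \<longrightarrow> (\<forall>\<delta>>0. Linf_norm \<Omega> (\<Phi> \<delta>) \<le> ereal c * Linf_norm \<Omega> \<phi>)))) \<and>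
       (\<forall>\<gamma>. 0 < \<gamma> \<and> \<gamma> \<le> 1 \<and> (B_iso \<gamma> \<Omega> M \<or> B_ort \<gamma> \<Omega> M) \<longrightarrow>
          (\<forall>\<phi> \<in> V10_LM \<Omega> M \<inter> C_0_gamma \<gamma> \<Omega>. \<exists>\<Phi>. smooth_approximation \<Omega> M \<Phi> \<phi> \<and>
             (\<phi> \<in> Linf \<Omega> \<longrightarrow> (\<forall>\<delta>>0. Linf_norm \<Omega> (\<Phi> \<delta>) \<le> ereal c * Linf_norm \<Omega> \<phi>)))))"
proof -
  obtain Z \<theta> S k A D s0 where cut: "cutoff_system \<Omega> Z \<theta> S k A D s0"
    using bounded_Lipschitz_domain_cutoff_system[OF assms] by blast
  interpret cutoff_system \<Omega> Z \<theta> S k A D s0 by (rule cut)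
  have approx: "\<exists>I P C. approximation \<Omega> Z \<theta> S k A D s0 M I P \<gamma> C"
    if M: "weak_N_function \<Omega> M" "continuous_on (\<Omega> \<times> UNIV) (\<lambda>(x, \<xi>). M x \<xi>)" and B: "B_iso \<gamma> \<Omega> M \<or> B_ort \<gamma> \<Omega> M" for M \<gamma>
  proof -
    have "continuous_N_function \<Omega> M" by (rule weak_N_function_continuous[OF open_domain M])
    then obtain I P C where "balanced_N_function \<Omega> M I P \<gamma> C"
      using B continuous_N_function.balanced_iso continuous_N_function.balanced_ort by blast
    then show ?thesis using cut approximation.intro by blast
  qed
  show ?thesis
  proof (intro exI[of _ "real (card Z)"] conjI allI impI ballI)
    show "0 < real (card Z)" using finite_Z Z_nonempty by (simp add: card_gt_0_iff)
  next
    fix M \<phi>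
    assume M: "weak_N_function \<Omega> M \<and> continuous_on (\<Omega> \<times> UNIV) (\<lambda>(x, \<xi>). M x \<xi>)"
      and B: "B_iso 0 \<Omega> M \<or> B_ort 0 \<Omega> M" and \<phi>: "\<phi> \<in> V10_LM \<Omega> M"
    obtain I P C where "approximation \<Omega> Z \<theta> S k A D s0 M I P 0 C" using approx M B by blast
    from approximation.smooth_approximation_unbounded[OF this assms refl \<phi>]
    show "\<exists>\<Phi>. smooth_approximation \<Omega> M \<Phi> \<phi> \<and>
      (\<phi> \<in> Linf \<Omega> \<longrightarrow> (\<forall>\<delta>>0. Linf_norm \<Omega> (\<Phi> \<delta>) \<le> ereal (real (card Z)) * Linf_norm \<Omega> \<phi>))" .
  next
    fix M \<gamma> \<phi>
    assume M: "weak_N_function \<Omega> M \<and> continuous_on (\<Omega> \<times> UNIV) (\<lambda>(x, \<xi>). M x \<xi>)"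
      and B: "0 < \<gamma> \<and> \<gamma> \<le> 1 \<and> (B_iso \<gamma> \<Omega> M \<or> B_ort \<gamma> \<Omega> M)" and \<phi>: "\<phi> \<in> V10_LM \<Omega> M \<inter> C_0_gamma \<gamma> \<Omega>"
    obtain I P C where ap: "approximation \<Omega> Z \<theta> S k A D s0 M I P \<gamma> C" using approx M B by blast
    have "0 < \<gamma>" "\<gamma> \<le> 1" "\<phi> \<in> V10_LM \<Omega> M" "\<phi> \<in> C_0_gamma \<gamma> \<Omega>" using B \<phi> by auto
    from approximation.smooth_approximation_Hoelder[OF ap assms this]
    show "\<exists>\<Phi>. smooth_approximation \<Omega> M \<Phi> \<phi> \<and>
      (\<phi> \<in> Linf \<Omega> \<longrightarrow> (\<forall>\<delta>>0. Linf_norm \<Omega> (\<Phi> \<delta>) \<le> ereal (real (card Z)) * Linf_norm \<Omega> \<phi>))" .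
  qed
qed

end
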